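(* For $h=1,\dots,n+m$ let $K_h=[a_h,b_h]$ and let $f_h\colon K_h\to[0,\infty)$ be Lipschitz continuous and concave with $f_h(a_h)=f_h(b_h)=0$, and assume $\sum_{i=1}^n f_i(0)-\sum_{j=n+1}^{n+m}f_j(0)=0$. Let $\hat g_h\in C^{0,1}([0,1],\mathbb R)$ and let $\hat G_h$ be the entropy flux corresponding to $\hat\eta_h$ (i.e. $\hat G_h'=\hat\eta_h'f_h'$), satisfying $$\hat g_h(y)=\pm_h\,\hat G_h\big((f_h|_{\Gamma_h^{\mathrm{out}}})^{-1}(y\cdot f_h^{\max})\big)\qquad\text{for a.e. }y\in[0,1],\ \text{for } h=1,\dots,n+m,$$ where $f_h^{\max}=\max_{K_h}f_h$, $\pm_h=+$ for $h\le n$ and $\pm_h=-$ for $h>n$. Then $\hat g_h$ is concave if and only if $\hat G_h$ is an entropy flux to a convex entropy $\hat\eta_h$. If we assume additionally that $\hat g_h$ is concave, then the definition of solutions to the generalized Riemann problem in the sense of Holden and Risebro (with the functions $\hat g_h$) and the definition of solutions to the generalized Riemann problem in the sense of the maximum entropy dissipation problem (with the entropy pairs $(\hat\eta_h,\hat G_h)$) are equivalent.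
   Context: **Network.** Roads $h=i\in\{1,\dots,n\}$ are incoming, with $\Omega_h=(-\infty,0)$; roads $h=j\in\{n+1,\dots,n+m\}$ are outgoing, with $\Omega_h=(0,\infty)$; the junction is $x=0$. Each $f_h$ is extended by $0$ to $\mathbb R\setminus K_h$, and $f_h^{\max}>0$. Monotone representatives of $f_h'$ and (for convex $\hat\eta_h$) of $\hat\eta_h'$ are used. An entropy pair is $(\eta_h,G_h)\colon\mathbb R\to\mathbb R^2$ with $\eta_h$ convex and $G_h'=\eta_h'f_h'$; $G_h$ is then called the entropy flux of $\eta_h$. The set of states with outgoing characteristics is $\Gamma_h^{\mathrm{out}}=\overline{\{\rho\in K_h:f_h'(\rho)<0\}}$ for $h\le n$ and $\Gamma_h^{\mathrm{out}}=\overline{\{\rho\in K_h:f_h'(\rho)>0\}}$ for $h>n$ (closure in $K_h$); $f_h$ is injective on $\Gamma_h^{\mathrm{out}}$ with range $[0,f_h^{\max}]$. In both definitions below, constant initial data $\rho_{0,h}\in K_h$ are fixed and, for $\tilde\rho_h\in K_h$, $\rho_h\colon[0,\infty)_t\times\mathbb R_x\to K_h$ denotes the weak entropy solution of the standard Riemann problem for $\partial_t\rho_h+\partial_xf_h(\rho_h)=0$ with $\rho_h(0,x)=\rho_{0,h}$ for $x\in\Omega_h$ and $\rho_h(0,x)=\tilde\rho_h$ for $x\notin\Omega_h$. A solution to the generalized Riemann problem is the tuple of restrictions of $(\rho_1,\dots,\rho_{n+m})$ to $x\in\Omega_h$, where the $\rho_h$ solve the stated optimization problem over $(\tilde\rho_h)_h$.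 The flux $f_h(\rho_h(t,0))$ is the same for the left and right traces at $x=0$. **Holden–Risebro.** With concave $\hat g_h\colon[0,1]\to\mathbb R$: $$\max_{\tilde\rho_h\in K_h}\ \sum_{h=1}^{n+m}\hat g_h\!\left(\frac{f_h(\rho_h(t,0))}{f_h^{\max}}\right)\quad\text{s.t.}\quad\sum_{i=1}^nf_i(\rho_i(t,0))-\sum_{j=n+1}^{n+m}f_j(\rho_j(t,0))=0.$$ **Maximum entropy dissipation.** With entropy pairs $(\hat\eta_h,\hat G_h)$ such that $\hat\eta_h\colon\mathbb R\to\mathbb R$ is convex and $\hat\eta_h'f_h'\le0$ a.e. on $K_h$: $$\max_{\tilde\rho_h\in K_h}\ \sum_{i=1}^n\hat G_i(\rho_i(t,0+))-\sum_{j=n+1}^{n+m}\hat G_j(\rho_j(t,0-))\quad\text{s.t.}\quad\sum_{i=1}^nf_i(\rho_i(t,0))-\sum_{j=n+1}^{n+m}f_j(\rho_j(t,0))=0.$$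
   Formalization: In the maximum entropy dissipation problem the junction traces (0+ incoming, 0- outgoing) must lie in Γ_h^out; convexity of η̂_h is claimed only on Γ_h^out, or for some convex entropy whose flux equals Ĝ_h on Γ_h^out. Read literally, both claims fail. *)

theory Defs
  imports "HOL-Analysis.Analysis"
begin

text \<open>
  Roads are numbered \<open>1, \<dots>, n + m\<close>; the roads \<open>h \<le> n\<close> are incoming and the roads \<open>h > n\<close> are
  outgoing. Road \<open>h\<close> has state space \<open>K = {a h..b h}\<close> and a flux \<open>f h\<close> that is extended by \<open>0\<close>
  outside \<open>K\<close>. Space-time functions take the time first.
\<close>

definition road_domain :: "nat \<Rightarrow> nat \<Rightarrow> real set" where
  "road_domain n h = (if h \<le> n then {..<0} else {0<..})"

definition road_sign :: "nat \<Rightarrow> nat \<Rightarrow> real" where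
  "road_sign n h = (if h \<le> n then 1 else -1)"

definition flux_max :: "real \<Rightarrow> real \<Rightarrow> (real \<Rightarrow> real) \<Rightarrow> real" where
  "flux_max a b f = (SUP \<rho>\<in>{a..b}. f \<rho>)"

text \<open>
  The derivative is the one of \<open>f\<close> on \<open>{a..b}\<close>, so it is one-sided at the endpoints; states where
  \<open>f\<close> has no derivative do not contribute.
\<close>

definition Gamma_out :: "nat \<Rightarrow> nat \<Rightarrow> real \<Rightarrow> real \<Rightarrow> (real \<Rightarrow> real) \<Rightarrow> real set" where
  "Gamma_out n h a b f =
    closure {\<rho> \<in> {a..b}. \<exists>D. (f has_real_derivative D) (at \<rho> within {a..b}) \<and>
                            (if h \<le> n then D < 0 else D > 0)}"


section \<open>Entropy pairs\<close>

text \<open>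
  \<open>F' = dF/dx\<close> almost everywhere with \<open>F\<close> the primitive of \<open>F'\<close>; stating it in integrated form
  rules out functions like the Cantor function, and makes \<open>F'\<close> matter only up to null sets.
\<close>

definition has_ae_derivative :: "(real \<Rightarrow> real) \<Rightarrow> (real \<Rightarrow> real) \<Rightarrow> bool" where
  "has_ae_derivative F F' \<longleftrightarrow> (\<forall>x y. x \<le> y \<longrightarrow> (F' has_integral (F y - F x)) {x..y})"

definition entropy_flux :: "(real \<Rightarrow> real) \<Rightarrow> (real \<Rightarrow> real) \<Rightarrow> (real \<Rightarrow> real) \<Rightarrow> bool" where
  "entropy_flux f \<eta> G \<longleftrightarrow>
    (\<exists>f' \<eta>'. has_ae_derivative f f' \<and> has_ae_derivative \<eta> \<eta>' \<and>
             has_ae_derivative G (\<lambda>\<rho>. \<eta>' \<rho> * f' \<rho>))"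

definition entropy_pair :: "(real \<Rightarrow> real) \<Rightarrow> (real \<Rightarrow> real) \<Rightarrow> (real \<Rightarrow> real) \<Rightarrow> bool" where
  "entropy_pair f \<eta> G \<longleftrightarrow> convex_on UNIV \<eta> \<and> entropy_flux f \<eta> G"

text \<open>
  The entropy pairs admitted in the maximum entropy dissipation problem. Convex \<open>\<eta>\<close> and concave \<open>f\<close>
  are differentiable almost everywhere, so \<^const>\<open>deriv\<close> is meaningful here.
\<close>

definition med_entropy_pair ::
    "real \<Rightarrow> real \<Rightarrow> (real \<Rightarrow> real) \<Rightarrow> (real \<Rightarrow> real) \<Rightarrow> (real \<Rightarrow> real) \<Rightarrow> bool" where
  "med_entropy_pair a b f \<eta> G \<longleftrightarrow>
    entropy_pair f \<eta> G \<and>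
    (AE \<rho> in lborel. \<rho> \<in> {a..b} \<longrightarrow> deriv \<eta> \<rho> * deriv f \<rho> \<le> 0)"


section \<open>Weak entropy solutions and their traces at the junction\<close>

text \<open>
  Nonnegative \<open>C\<^sup>1\<close> test functions with bounded support in the whole plane: their restrictions to
  \<open>t \<ge> 0\<close> need not vanish at \<open>t = 0\<close>, so that the weak formulation includes the initial data.
\<close>

definition test_function ::
    "(real \<times> real \<Rightarrow> real) \<Rightarrow> (real \<times> real \<Rightarrow> real) \<Rightarrow> (real \<times> real \<Rightarrow> real) \<Rightarrow> bool" where
  "test_function \<phi> \<phi>t \<phi>x \<longleftrightarrow>
    (\<forall>p. \<phi> p \<ge> 0) \<and> bounded {p. \<phi> p \<noteq> 0} \<and>
    (\<forall>p. (\<phi> has_derivative (\<lambda>(s, y). \<phi>t p * s + \<phi>x p * y)) (at p)) \<and>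
    continuous_on UNIV \<phi>t \<and> continuous_on UNIV \<phi>x"

text \<open>
  \<open>\<partial>\<^sub>t \<eta>(\<rho>) + \<partial>\<^sub>x G(\<rho>) \<le> 0\<close> for every entropy pair, with initial data \<open>u0\<close>. The conservation law
  itself is the case \<open>\<eta> = \<plusminus>id\<close>, \<open>G = \<plusminus>f\<close>.
\<close>

definition weak_entropy_solution ::
    "(real \<Rightarrow> real) \<Rightarrow> real set \<Rightarrow> (real \<Rightarrow> real) \<Rightarrow> (real \<Rightarrow> real \<Rightarrow> real) \<Rightarrow> bool" where
  "weak_entropy_solution f K u0 \<rho> \<longleftrightarrow>
    set_borel_measurable lborel ({0..} \<times> UNIV) (\<lambda>(t, x). \<rho> t x) \<and>
    (\<forall>t\<ge>0. \<forall>x. \<rho> t x \<in> K) \<and>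
    (\<forall>\<eta> G \<phi> \<phi>t \<phi>x. entropy_pair f \<eta> G \<longrightarrow> test_function \<phi> \<phi>t \<phi>x \<longrightarrow>
      0 \<le> (LINT p:{0..} \<times> UNIV|lborel.
              \<eta> (\<rho> (fst p) (snd p)) * \<phi>t p + G (\<rho> (fst p) (snd p)) * \<phi>x p)
           + (LINT x|lborel. \<eta> (u0 x) * \<phi> (0, x)))"

text \<open>
  The initial data are constant on either side of the junction, so the solution is self-similar and
  its traces at \<open>x = 0\<close> do not depend on \<open>t > 0\<close>. The essential limit makes them independent of the
  representative.
\<close>

definition left_trace :: "(real \<Rightarrow> real \<Rightarrow> real) \<Rightarrow> real \<Rightarrow> bool" where
  "left_trace \<rho> l \<longleftrightarrow>
    (AE t in lborel. t > 0 \<longrightarrow>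
      (\<forall>\<epsilon>>0. \<exists>\<delta>>0. AE x in lborel. - \<delta> < x \<and> x < 0 \<longrightarrow> \<bar>\<rho> t x - l\<bar> < \<epsilon>))"

definition right_trace :: "(real \<Rightarrow> real \<Rightarrow> real) \<Rightarrow> real \<Rightarrow> bool" where
  "right_trace \<rho> r \<longleftrightarrow>
    (AE t in lborel. t > 0 \<longrightarrow>
      (\<forall>\<epsilon>>0. \<exists>\<delta>>0. AE x in lborel. 0 < x \<and> x < \<delta> \<longrightarrow> \<bar>\<rho> t x - r\<bar> < \<epsilon>))"

text \<open>
  On every road \<open>h\<close>, \<open>\<rho> h\<close> solves the Riemann problem with datum \<open>\<rho>0 h\<close> on the road and datum
  \<open>\<sigma> h\<close> on the other side of the junction, and has the traces \<open>l h\<close> at \<open>0-\<close> and \<open>r h\<close> at \<open>0+\<close>.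
\<close>

definition riemann_solutions ::
    "nat \<Rightarrow> nat \<Rightarrow> (nat \<Rightarrow> real) \<Rightarrow> (nat \<Rightarrow> real) \<Rightarrow> (nat \<Rightarrow> real \<Rightarrow> real) \<Rightarrow> (nat \<Rightarrow> real) \<Rightarrow>
     (nat \<Rightarrow> real) \<Rightarrow> (nat \<Rightarrow> real \<Rightarrow> real \<Rightarrow> real) \<Rightarrow> (nat \<Rightarrow> real) \<Rightarrow> (nat \<Rightarrow> real) \<Rightarrow> bool" where
  "riemann_solutions n m a b f \<rho>0 \<sigma> \<rho> l r \<longleftrightarrow>
    (\<forall>h\<in>{1..n + m}.
      \<sigma> h \<in> {a h..b h} \<and>
      weak_entropy_solution (f h) {a h..b h}
        (\<lambda>x. if x \<in> road_domain n h then \<rho>0 h else \<sigma> h) (\<rho> h) \<and>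
      left_trace (\<rho> h) (l h) \<and> right_trace (\<rho> h) (r h))"

text \<open>
  By the Rankine-Hugoniot condition \<open>f h (l h) = f h (r h)\<close>; the flux at the junction is written
  with the left trace throughout.
\<close>

definition conserves_mass ::
    "nat \<Rightarrow> nat \<Rightarrow> (nat \<Rightarrow> real \<Rightarrow> real) \<Rightarrow> (nat \<Rightarrow> real) \<Rightarrow> bool" where
  "conserves_mass n m f l \<longleftrightarrow>
    (\<Sum>i=1..n. f i (l i)) - (\<Sum>j=n+1..n+m. f j (l j)) = 0"

definition restricts_to_roads ::
    "nat \<Rightarrow> nat \<Rightarrow> (nat \<Rightarrow> real \<Rightarrow> real \<Rightarrow> real) \<Rightarrow> (nat \<Rightarrow> real \<Rightarrow> real \<Rightarrow> real) \<Rightarrow> bool" where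
  "restricts_to_roads n m \<rho> u \<longleftrightarrow>
    (\<forall>h\<in>{1..n + m}.
      AE p in lborel. p \<in> {0..} \<times> road_domain n h \<longrightarrow> u h (fst p) (snd p) = \<rho> h (fst p) (snd p))"


section \<open>The generalized Riemann problem\<close>

definition hr_objective ::
    "nat \<Rightarrow> nat \<Rightarrow> (nat \<Rightarrow> real) \<Rightarrow> (nat \<Rightarrow> real) \<Rightarrow> (nat \<Rightarrow> real \<Rightarrow> real) \<Rightarrow> (nat \<Rightarrow> real \<Rightarrow> real) \<Rightarrow>
     (nat \<Rightarrow> real) \<Rightarrow> real" where
  "hr_objective n m a b f g l = (\<Sum>h=1..n+m. g h (f h (l h) / flux_max (a h) (b h) (f h)))"

definition hr_solution ::
    "nat \<Rightarrow> nat \<Rightarrow> (nat \<Rightarrow> real) \<Rightarrow> (nat \<Rightarrow> real) \<Rightarrow> (nat \<Rightarrow> real \<Rightarrow> real) \<Rightarrow> (nat \<Rightarrow> real \<Rightarrow> real) \<Rightarrow>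
     (nat \<Rightarrow> real) \<Rightarrow> (nat \<Rightarrow> real \<Rightarrow> real \<Rightarrow> real) \<Rightarrow> bool" where
  "hr_solution n m a b f g \<rho>0 u \<longleftrightarrow>
    (\<exists>\<sigma> \<rho> l r.
      riemann_solutions n m a b f \<rho>0 \<sigma> \<rho> l r \<and> conserves_mass n m f l \<and>
      (\<forall>\<sigma>' \<rho>' l' r'.
        riemann_solutions n m a b f \<rho>0 \<sigma>' \<rho>' l' r' \<and> conserves_mass n m f l' \<longrightarrow>
        hr_objective n m a b f g l' \<le> hr_objective n m a b f g l) \<and>
      restricts_to_roads n m \<rho> u)"

definition med_objective ::
    "nat \<Rightarrow> nat \<Rightarrow> (nat \<Rightarrow> real \<Rightarrow> real) \<Rightarrow> (nat \<Rightarrow> real) \<Rightarrow> (nat \<Rightarrow> real) \<Rightarrow> real" where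
  "med_objective n m G l r = (\<Sum>i=1..n. G i (r i)) - (\<Sum>j=n+1..n+m. G j (l j))"

text \<open>
  The traces on the junction side (\<open>0+\<close> on incoming, \<open>0-\<close> on outgoing roads) that enter the
  objective are required to be states with outgoing characteristics. This excludes no junction flux
  and no solution on the roads: keeping the solution on the road and replacing the datum beyond the
  junction by the state of \<^const>\<open>Gamma_out\<close> with the same flux gives a stationary admissible jump.
  It is needed because a datum \<open>\<sigma> h\<close> whose waves all enter the road beyond the junction
  leaves \<open>\<rho>0 h\<close> itself, possibly outside \<^const>\<open>Gamma_out\<close>, as the junction-side trace.
  There \<open>G h\<close> exceeds its value at the state of \<^const>\<open>Gamma_out\<close> with equal flux, by
  the dissipation of the stationary shock between the two, so the objective would not be a
  function of the junction fluxes.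
\<close>

definition junction_traces_outgoing ::
    "nat \<Rightarrow> nat \<Rightarrow> (nat \<Rightarrow> real) \<Rightarrow> (nat \<Rightarrow> real) \<Rightarrow> (nat \<Rightarrow> real \<Rightarrow> real) \<Rightarrow>
     (nat \<Rightarrow> real) \<Rightarrow> (nat \<Rightarrow> real) \<Rightarrow> bool" where
  "junction_traces_outgoing n m a b f l r \<longleftrightarrow>
    (\<forall>h\<in>{1..n + m}. (if h \<le> n then r h else l h) \<in> Gamma_out n h (a h) (b h) (f h))"

definition med_solution ::
    "nat \<Rightarrow> nat \<Rightarrow> (nat \<Rightarrow> real) \<Rightarrow> (nat \<Rightarrow> real) \<Rightarrow> (nat \<Rightarrow> real \<Rightarrow> real) \<Rightarrow> (nat \<Rightarrow> real \<Rightarrow> real) \<Rightarrow>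
     (nat \<Rightarrow> real) \<Rightarrow> (nat \<Rightarrow> real \<Rightarrow> real \<Rightarrow> real) \<Rightarrow> bool" where
  "med_solution n m a b f G \<rho>0 u \<longleftrightarrow>
    (\<exists>\<sigma> \<rho> l r.
      riemann_solutions n m a b f \<rho>0 \<sigma> \<rho> l r \<and> conserves_mass n m f l \<and>
      junction_traces_outgoing n m a b f l r \<and>
      (\<forall>\<sigma>' \<rho>' l' r'.
        riemann_solutions n m a b f \<rho>0 \<sigma>' \<rho>' l' r' \<and> conserves_mass n m f l' \<and>
        junction_traces_outgoing n m a b f l' r' \<longrightarrow>
        med_objective n m G l' r' \<le> med_objective n m G l r) \<and>
      restricts_to_roads n m \<rho> u)"

end

theory Submission
  imports Defs
begin

text \<open>
  On \<open>\<Gamma>\<^sup>o\<^sup>u\<^sup>t\<close> the flux \<open>f\<close> is strictly monotone with \<open>f' \<noteq> 0\<close> almost everywhere. For a slope \<open>s\<close>,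
  monotonicity of \<open>G - s f\<close> and of \<open>\<eta> - s id\<close> both say that \<open>(\<eta>' - s) f'\<close> resp. \<open>\<eta>' - s\<close> has a
  sign almost everywhere, so supporting slopes of \<open>\<eta>\<close> over the states are the supporting slopes of
  \<open>G\<close> over the fluxes, that is, of \<open>\<mp>g\<close>. The Lipschitz bound on \<open>g\<close> bounds these slopes and allows
  a linear continuation of \<open>\<eta>\<close> outside \<open>\<Gamma>\<^sup>o\<^sup>u\<^sup>t\<close>.

  For states in \<open>\<Gamma>\<^sup>o\<^sup>u\<^sup>t\<close> the two objectives agree by the Rankine-Hugoniot condition. Every Riemann
  solution can be altered beyond the junction to the constant state of \<open>\<Gamma>\<^sup>o\<^sup>u\<^sup>t\<close> with the same
  flux: the entropy inequality for the altered solution follows by testing with cutoffs at the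
  junction and from the admissibility of the stationary shock between the trace and that state.
\<close>

section \<open>Monotonicity and almost everywhere derivatives\<close>

text \<open>The derivatives \<open>f'\<close> and \<open>\<eta>'\<close> are given only through
  gauge integrals and up to null sets, so arguments run through increments over intervals and
  through null sets where a sign fails. That \<open>f'\<close> does not vanish on the branch is due
  to curvature: slopes of a strictly monotone concave function stay away from 0 on compact
  subintervals of the open branch. The factor \<open>- road_sign n h\<close> makes the flux
  increasing on the branch of either kind of road. Riemann solutions enter through their entropy
  inequality and their traces. Testing with \<phi>(t, x) \<theta>(k x) leaves, as k grows, the
  weights \<theta>(0) - cl and cr - \<theta>(0) on the two trace fluxes, and the profile decides
  what is read off: a bump yields the jump inequality, one-sided steps cut a solution at the
  junction. The stationary shock is admissible because the state of \<open>Gamma_out\<close> lies on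
  the right side of the trace: with s a supporting slope of \<eta> at a maximiser of f between the
  two states, s f - G increases across the shock, while f takes the same value at both ends.\<close>

lemma negligible_nonzero_of_integral_0:
  fixes h :: "real \<Rightarrow> real"
  assumes h: "(h has_integral 0) S" and nonneg: "\<And>t. t \<in> S \<Longrightarrow> 0 \<le> h t"
  shows "negligible {t \<in> S. h t \<noteq> 0}"
proof -
  have "h absolutely_integrable_on S"
    using h nonneg by (intro nonnegative_absolutely_integrable_1) auto
  then have int: "integrable lebesgue (\<lambda>x. indicator S x *\<^sub>R h x)"
    by (simp add: set_integrable_def)
  have "(LINT x|lebesgue. indicator S x *\<^sub>R h x) = 0"
    using set_lebesgue_integral_eq_integral(2)[OF \<open>h absolutely_integrable_on S\<close>] h
    by (simp add: set_lebesgue_integral_def integral_unique)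
  then have "AE x in lebesgue. indicator S x *\<^sub>R h x = 0"
    using int nonneg
    by (subst (asm) integral_nonneg_eq_0_iff_AE) (auto split: split_indicator)
  then obtain N where "negligible N" "{x. indicator S x *\<^sub>R h x \<noteq> 0} \<subseteq> N"
    unfolding eventually_ae_filter_negligible by auto
  then show ?thesis
    by (elim negligible_subset) (auto simp: indicator_def)
qed

text \<open>
  Henstock-Kurzweil integrals are not absolute, but Henstock's lemma compares the Riemann sums of
  \<open>\<bar>\<phi>\<bar>\<close> with \<open>\<Sum> \<bar>\<integral>\<phi>\<bar> = \<integral>\<phi>\<close>. This replaces Lebesgue differentiation.
\<close>
lemma abs_has_integral_of_nonneg_increments:
  fixes \<phi> :: "real \<Rightarrow> real"
  assumes \<phi>: "(\<phi> has_integral I) {x..y}"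
    and nonneg: "\<And>u v. x \<le> u \<Longrightarrow> u \<le> v \<Longrightarrow> v \<le> y \<Longrightarrow> 0 \<le> integral {u..v} \<phi>"
  shows "((\<lambda>t. \<bar>\<phi> t\<bar>) has_integral I) {x..y}"
  unfolding has_integral_real
proof (intro allI impI)
  fix e :: real assume "e > 0"
  have int: "\<phi> integrable_on cbox x y"
    using \<phi> by auto
  obtain \<gamma> where \<gamma>: "gauge \<gamma>"
    and H: "\<And>p. \<lbrakk>p tagged_partial_division_of (cbox x y); \<gamma> fine p\<rbrakk> \<Longrightarrow>
             sum (\<lambda>(x,k). norm (measure lborel k *\<^sub>R \<phi> x - integral k \<phi>)) p < e"
    using Henstock_lemma[OF int \<open>e > 0\<close>] by blast
  have "norm ((\<Sum>(x, k)\<in>p. measure lborel k *\<^sub>R \<bar>\<phi> x\<bar>) - I) < e"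
    if p: "p tagged_division_of {x..y}" "\<gamma> fine p" for p
  proof -
    have k_nonneg: "0 \<le> integral k \<phi>" if tk: "(t, k) \<in> p" for t k
    proof -
      obtain u v where k: "k = cbox u v"
        using tagged_division_ofD(4)[OF p(1) tk] by blast
      have "t \<in> k" "k \<subseteq> {x..y}"
        using tagged_division_ofD(2,3)[OF p(1) tk] by auto
      then show ?thesis
        unfolding k using nonneg[of u v] by auto
    qed
    have "I = (\<Sum>(t, k)\<in>p. integral k \<phi>)"
      using integral_combine_tagged_division_topdown[OF int, of p] p(1) integral_unique[OF \<phi>] by simp
    also have "\<dots> = (\<Sum>(t, k)\<in>p. \<bar>integral k \<phi>\<bar>)"
      by (rule sum.cong[OF refl]) (clarsimp simp: k_nonneg)
    finally have I: "I = (\<Sum>(t, k)\<in>p. \<bar>integral k \<phi>\<bar>)" .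
    have "norm ((\<Sum>(x, k)\<in>p. measure lborel k *\<^sub>R \<bar>\<phi> x\<bar>) - I)
        = \<bar>\<Sum>(t, k)\<in>p. \<bar>measure lborel k * \<phi> t\<bar> - \<bar>integral k \<phi>\<bar>\<bar>"
      by (simp add: I sum_subtractf case_prod_unfold abs_mult)
    also have "\<dots> \<le> (\<Sum>(t, k)\<in>p. \<bar>\<bar>measure lborel k * \<phi> t\<bar> - \<bar>integral k \<phi>\<bar>\<bar>)"
      by (rule order_trans[OF sum_abs]) (simp add: case_prod_unfold)
    also have "\<dots> \<le> (\<Sum>(t, k)\<in>p. norm (measure lborel k *\<^sub>R \<phi> t - integral k \<phi>))"
      by (intro sum_mono) (simp add: case_prod_unfold abs_triangle_ineq3)
    also have "\<dots> < e"
      using H p by (simp add: tagged_division_of_def)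
    finally show ?thesis .
  qed
  then show "\<exists>\<gamma>. gauge \<gamma> \<and> (\<forall>\<D>. \<D> tagged_division_of {x..y} \<and> \<gamma> fine \<D> \<longrightarrow>
      norm ((\<Sum>(x, k)\<in>\<D>. measure lborel k *\<^sub>R \<bar>\<phi> x\<bar>) - I) < e)"
    using \<gamma> by (intro exI[of _ \<gamma>]) simp
qed

text \<open>This translates between increments and almost everywhere signs. If all increments are
  nonnegative, |\<phi>| and \<phi> have the same integral, so the nonnegative difference |\<phi>| -
  \<phi> vanishes almost everywhere. Conversely, \<phi> may be replaced by its positive part off a
  null set.\<close>

lemma mono_on_iff_derivative_nonneg:
  assumes F: "has_ae_derivative F \<phi>"
  shows "mono_on {x..y} F \<longleftrightarrow> negligible {t \<in> {x..y}. \<phi> t < 0}"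
proof
  assume mono: "mono_on {x..y} F"
  show "negligible {t \<in> {x..y}. \<phi> t < 0}"
  proof (cases "x \<le> y")
    case True
    have \<phi>: "(\<phi> has_integral (F v - F u)) {u..v}" if "u \<le> v" for u v
      using F that by (simp add: has_ae_derivative_def)
    have "((\<lambda>t. \<bar>\<phi> t\<bar>) has_integral (F y - F x)) {x..y}"
    proof (rule abs_has_integral_of_nonneg_increments)
      fix u v assume "x \<le> u" "u \<le> v" "v \<le> y"
      then show "0 \<le> integral {u..v} \<phi>"
        using integral_unique[OF \<phi>[of u v]] mono by (auto simp: mono_on_def)
    qed (use \<phi> True in auto)
    from has_integral_diff[OF this \<phi>[OF True]]
    have "negligible {t \<in> {x..y}. \<bar>\<phi> t\<bar> - \<phi> t \<noteq> 0}"
      by (intro negligible_nonzero_of_integral_0) auto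
    then show ?thesis
      by (rule negligible_subset) auto
  qed simp
next
  assume neg: "negligible {t \<in> {x..y}. \<phi> t < 0}"
  show "mono_on {x..y} F"
  proof (rule mono_onI)
    fix u v assume uv: "u \<in> {x..y}" "v \<in> {x..y}" "u \<le> v"
    have "(\<phi> has_integral (F v - F u)) {u..v}"
      using F uv by (simp add: has_ae_derivative_def)
    then have "((\<lambda>t. max 0 (\<phi> t)) has_integral (F v - F u)) {u..v}"
      by (rule has_integral_spike[OF neg, rotated]) (use uv in auto)
    from has_integral_nonneg[OF this] show "F u \<le> F v"
      by simp
  qed
qed

section \<open>Calculus of integrated derivatives\<close>

lemma has_ae_derivative_continuous:
  assumes "has_ae_derivative F \<phi>"
  shows "continuous_on S F"
proof -
  have "isCont F x" for x
  proof -
    have eq: "F t = F (x - 1) + integral {x - 1..t} \<phi>" if "t \<ge> x - 1" for t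
      using assms that integral_unique[of \<phi> "F t - F (x - 1)" "{x - 1..t}"]
      by (simp add: has_ae_derivative_def)
    have "\<phi> integrable_on {x - 1..x + 1}"
      using assms by (intro has_integral_integrable[of _ "F (x + 1) - F (x - 1)"]) (simp add: has_ae_derivative_def)
    then have "continuous_on {x - 1..x + 1} (\<lambda>t. F (x - 1) + integral {x - 1..t} \<phi>)"
      by (rule continuous_on_add[OF continuous_on_const indefinite_integral_continuous_1])
    then have "continuous_on {x - 1..x + 1} F"
      by (rule continuous_on_eq) (rule eq[symmetric], simp)
    then show ?thesis
      by (rule continuous_on_interior) (auto simp: interior_atLeastAtMost_real)
  qed
  then show ?thesis
    by (simp add: continuous_at_imp_continuous_on)
qed

lemma has_ae_derivative_linear: "has_ae_derivative (\<lambda>t. c * t + d) (\<lambda>_. c)"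
  unfolding has_ae_derivative_def
proof (intro allI impI)
  fix x y :: real assume "x \<le> y"
  then show "((\<lambda>_. c) has_integral (c * y + d - (c * x + d))) {x..y}"
    using has_integral_const_real[of c x y] by (simp add: algebra_simps)
qed

lemma has_ae_derivative_diff:
  assumes F: "has_ae_derivative F \<phi>" and G: "has_ae_derivative G \<psi>"
  shows "has_ae_derivative (\<lambda>t. F t - G t) (\<lambda>t. \<phi> t - \<psi> t)"
  unfolding has_ae_derivative_def
proof (intro allI impI)
  fix x y :: real assume "x \<le> y"
  then have "((\<lambda>t. \<phi> t - \<psi> t) has_integral ((F y - F x) - (G y - G x))) {x..y}"
    using F G by (intro has_integral_diff) (auto simp: has_ae_derivative_def)
  then show "((\<lambda>t. \<phi> t - \<psi> t) has_integral (F y - G y - (F x - G x))) {x..y}"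
    by (simp add: algebra_simps)
qed

lemma has_ae_derivative_cmult:
  assumes F: "has_ae_derivative F \<phi>"
  shows "has_ae_derivative (\<lambda>t. c * F t) (\<lambda>t. c * \<phi> t)"
  unfolding has_ae_derivative_def
proof (intro allI impI)
  fix x y :: real assume "x \<le> y"
  then have "((\<lambda>t. c * \<phi> t) has_integral (c * (F y - F x))) {x..y}"
    using F by (intro has_integral_mult_right) (simp add: has_ae_derivative_def)
  then show "((\<lambda>t. c * \<phi> t) has_integral (c * F y - c * F x)) {x..y}"
    by (simp add: right_diff_distrib)
qed

lemma has_ae_derivative_const: "has_ae_derivative (\<lambda>t. c) (\<lambda>_. 0)"
  using has_ae_derivative_linear[of 0 c] by simp

lemma has_ae_derivative_add:
  assumes "has_ae_derivative F \<phi>" "has_ae_derivative G \<psi>"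
  shows "has_ae_derivative (\<lambda>t. F t + G t) (\<lambda>t. \<phi> t + \<psi> t)"
  using has_ae_derivative_diff[OF assms(1) has_ae_derivative_cmult[OF assms(2), of "-1"]] by simp

lemma has_ae_derivative_join:
  assumes F: "has_ae_derivative F \<phi>" and G: "has_ae_derivative G \<psi>" and c: "F c = G c"
  shows "has_ae_derivative (\<lambda>t. if t \<le> c then F t else G t) (\<lambda>t. if t \<le> c then \<phi> t else \<psi> t)"
    (is "has_ae_derivative ?J ?j")
  unfolding has_ae_derivative_def
proof (intro allI impI)
  have left: "(?j has_integral (F v - F u)) {u..v}" if "u \<le> v" "v \<le> c" for u v
    using F that has_integral_cong[of "{u..v}" ?j \<phi>] by (simp add: has_ae_derivative_def)
  \<comment> \<open>At \<open>c\<close> itself the joined derivative takes the value of \<phi>, not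
    of \<psi>; a single point does not change the integral.\<close>
  have right: "(?j has_integral (G v - G u)) {u..v}" if "u \<le> v" "c \<le> u" for u v
    by (rule has_integral_spike[where S = "{c}" and f = \<psi>])
      (use G that in \<open>auto simp: has_ae_derivative_def\<close>)
  have J: "?J t = G t" if "c \<le> t" for t
    using that c by (cases "t = c") simp_all
  fix x y :: real assume "x \<le> y"
  consider "y \<le> c" | "c \<le> x" | "x < c" "c < y" by linarith
  then show "(?j has_integral (?J y - ?J x)) {x..y}"
  proof cases
    case 1
    then show ?thesis using left[of x y] \<open>x \<le> y\<close> by simp
  next
    case 2
    then show ?thesis using right[of x y] \<open>x \<le> y\<close> J[of x] J[of y] by simp
  next
    case 3
    then show ?thesis
      using has_integral_combine[of x c y ?j, OF _ _ left right] J[of y] c by simp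
  qed
qed

section \<open>Convexity relative to a monotone function\<close>

text \<open>
  For increasing \<open>F\<close>: the difference quotients of \<open>H\<close> with respect to \<open>F\<close> increase.
\<close>

definition rel_convex :: "real set \<Rightarrow> (real \<Rightarrow> real) \<Rightarrow> (real \<Rightarrow> real) \<Rightarrow> bool" where
  "rel_convex S F H \<longleftrightarrow>
    (\<forall>u\<in>S. \<forall>v\<in>S. \<forall>w\<in>S. u < v \<longrightarrow> v < w \<longrightarrow>
      (H v - H u) * (F w - F v) \<le> (H w - H v) * (F v - F u))"

lemma convex_on_iff_rel_convex:
  assumes "convex S"
  shows "convex_on S \<eta> \<longleftrightarrow> rel_convex S (\<lambda>t. t) \<eta>"
proof
  assume cvx: "convex_on S \<eta>"
  show "rel_convex S (\<lambda>t. t) \<eta>"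
    unfolding rel_convex_def
  proof (intro ballI impI)
    fix u v w assume S: "u \<in> S" "v \<in> S" "w \<in> S" and less: "u < v" "v < w"
    have "(\<eta> u - \<eta> v) / (u - v) \<le> (\<eta> v - \<eta> w) / (v - w)"
      using convex_on_slope_le[OF cvx S(1,3) less] by linarith
    then show "(\<eta> v - \<eta> u) * (w - v) \<le> (\<eta> w - \<eta> v) * (v - u)"
      using less by (simp add: field_simps)
  qed
next
  assume rc: "rel_convex S (\<lambda>t. t) \<eta>"
  show "convex_on S \<eta>"
  proof (rule convex_on_linorderI)
    fix t x y :: real assume t: "0 < t" "t < 1" and xy: "x \<in> S" "y \<in> S" "x < y"
    define v where "v = (1 - t) * x + t * y"
    have "v \<in> S"
      using convexD[OF assms xy(1,2), of "1 - t" t] t by (simp add: v_def)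
    have vx: "v - x = t * (y - x)" and yv: "y - v = (1 - t) * (y - x)"
      by (simp_all add: v_def algebra_simps)
    have "0 < v - x" "0 < y - v"
      using t xy unfolding vx yv by auto
    then have "(\<eta> v - \<eta> x) * (y - v) \<le> (\<eta> y - \<eta> v) * (v - x)"
      using rc xy \<open>v \<in> S\<close> by (auto simp: rel_convex_def)
    then have "(\<eta> v - \<eta> x) * (1 - t) * (y - x) \<le> (\<eta> y - \<eta> v) * t * (y - x)"
      unfolding vx yv by (simp add: mult.assoc)
    then have "(\<eta> v - \<eta> x) * (1 - t) \<le> (\<eta> y - \<eta> v) * t"
      using xy(3) by simp
    then have "\<eta> v \<le> (1 - t) * \<eta> x + t * \<eta> y"
      by (simp add: algebra_simps)
    then show "\<eta> ((1 - t) *\<^sub>R x + t *\<^sub>R y) \<le> (1 - t) * \<eta> x + t * \<eta> y"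
      by (simp add: v_def)
  qed (rule assms)
qed

text \<open>
  The supporting slope \<open>s\<close> turns relative convexity into two monotonicity statements, which can be
  moved between the pairs \<open>(f, G)\<close> and \<open>(id, \<eta>)\<close> through their derivatives.
\<close>
lemma rel_convex_iff_support:
  assumes F: "strict_mono_on {lo..hi} F"
  shows "rel_convex {lo..hi} F H \<longleftrightarrow>
    (\<forall>v\<in>{lo<..<hi}. \<exists>s. mono_on {lo..v} (\<lambda>t. s * F t - H t) \<and> mono_on {v..hi} (\<lambda>t. H t - s * F t))"
    (is "?L \<longleftrightarrow> ?R")
proof
  assume rc: ?L
  show ?R
  proof
    fix v assume v: "v \<in> {lo<..<hi}"
    define q where "q x y = (H y - H x) / (F y - F x)" for x y
    have F': "F x < F y" if "lo \<le> x" "x < y" "y \<le> hi" for x y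
      using strict_mono_onD[OF F, of x y] that by auto
    have q: "q x y \<le> q y z" if "lo \<le> x" "x < y" "y < z" "z \<le> hi" for x y z
    proof -
      have "(H y - H x) * (F z - F y) \<le> (H z - H y) * (F y - F x)"
        using rc that by (auto simp: rel_convex_def)
      then show ?thesis
        using F'[of x y] F'[of y z] that by (simp add: q_def divide_simps mult.commute)
    qed
    \<comment> \<open>Any number between all left slopes and all right slopes at \<open>v\<close>
      supports. The supremum of the left slopes exists because the slope towards \<open>hi\<close>
      bounds them, which is why \<open>v\<close> must be interior.\<close>
    define s where "s = (SUP u\<in>{lo..<v}. q u v)"
    have bdd: "bdd_above ((\<lambda>u. q u v) ` {lo..<v})"
      by (rule bdd_aboveI2[where M = "q v hi"]) (use q v in auto)
    have s_ge: "q u v \<le> s" if "lo \<le> u" "u < v" for u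
      unfolding s_def using bdd that by (intro cSUP_upper) auto
    have s_le: "s \<le> q v w" if "v < w" "w \<le> hi" for w
      unfolding s_def using q v that by (intro cSUP_least) auto
    have "mono_on {lo..v} (\<lambda>t. s * F t - H t)"
    proof (rule mono_onI)
      fix x y assume xy: "x \<in> {lo..v}" "y \<in> {lo..v}" "x \<le> y"
      show "s * F x - H x \<le> s * F y - H y"
      proof (cases "x = y")
        case False
        have "q x y \<le> s"
        proof (cases "y = v")
          case True
          then show ?thesis using s_ge[of x] xy False by auto
        next
          case neq: False
          then have "q x y \<le> q y v"
            using q[of x y v] xy v False by auto
          also have "\<dots> \<le> s" using s_ge[of y] neq xy by auto
          finally show ?thesis .
        qed
        then show ?thesis
          using F'[of x y] xy v False by (simp add: q_def pos_divide_le_eq algebra_simps)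
      qed simp
    qed
    moreover have "mono_on {v..hi} (\<lambda>t. H t - s * F t)"
    proof (rule mono_onI)
      fix x y assume xy: "x \<in> {v..hi}" "y \<in> {v..hi}" "x \<le> y"
      show "H x - s * F x \<le> H y - s * F y"
      proof (cases "x = y")
        case False
        have "s \<le> q x y"
        proof (cases "x = v")
          case True
          then show ?thesis using s_le[of y] xy False by auto
        next
          case neq: False
          then have "s \<le> q v x" using s_le[of x] xy by auto
          also have "\<dots> \<le> q x y"
            using q[of v x y] xy v neq False by auto
          finally show ?thesis .
        qed
        then show ?thesis
          using F'[of x y] xy v False by (simp add: q_def pos_le_divide_eq algebra_simps)
      qed simp
    qed
    ultimately show "\<exists>s. mono_on {lo..v} (\<lambda>t. s * F t - H t) \<and> mono_on {v..hi} (\<lambda>t. H t - s * F t)"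
      by blast
  qed
next
  assume R: ?R
  show ?L
    unfolding rel_convex_def
  proof (intro ballI impI)
    fix u v w assume uvw: "u \<in> {lo..hi}" "v \<in> {lo..hi}" "w \<in> {lo..hi}" "u < v" "v < w"
    then obtain s where s: "mono_on {lo..v} (\<lambda>t. s * F t - H t)" "mono_on {v..hi} (\<lambda>t. H t - s * F t)"
      using R by force
    \<comment> \<open>The slope s separates the two chords; multiplying each bound by the positive
      increment of the other chord gives the division-free inequality.\<close>
    have 1: "H v - H u \<le> s * (F v - F u)"
      using mono_onD[OF s(1), of u v] uvw by (auto simp: algebra_simps)
    have 2: "s * (F w - F v) \<le> H w - H v"
      using mono_onD[OF s(2), of v w] uvw by (auto simp: algebra_simps)
    have "F u < F v" "F v < F w"
      using F uvw by (auto simp: strict_mono_on_def)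
    then have "(H v - H u) * (F w - F v) \<le> s * (F v - F u) * (F w - F v)"
      "s * (F w - F v) * (F v - F u) \<le> (H w - H v) * (F v - F u)"
      using 1 2 by (auto intro!: mult_right_mono)
    then show "(H v - H u) * (F w - F v) \<le> (H w - H v) * (F v - F u)"
      by (simp add: mult.commute mult.left_commute)
  qed
qed

lemma mono_on_flux_iff_entropy:
  assumes F: "has_ae_derivative F \<phi>" and \<eta>: "has_ae_derivative \<eta> \<eta>'"
    and H: "has_ae_derivative H (\<lambda>t. \<eta>' t * \<phi> t)"
    and pos: "negligible {t \<in> {lo..hi}. \<phi> t \<le> 0}" and sub: "{x..y} \<subseteq> {lo..hi}"
  shows "mono_on {x..y} (\<lambda>t. s * F t - H t) \<longleftrightarrow> mono_on {x..y} (\<lambda>t. s * t - \<eta> t)"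
    and "mono_on {x..y} (\<lambda>t. H t - s * F t) \<longleftrightarrow> mono_on {x..y} (\<lambda>t. \<eta> t - s * t)"
proof -
  have id: "has_ae_derivative (\<lambda>t. s * t) (\<lambda>_. s)"
    using has_ae_derivative_linear[of s 0] by simp
  \<comment> \<open>The sets where the two monotonicity conditions fail differ only inside the null
    set where \<phi> is not positive; adding that set to both makes them equal.\<close>
  have neg: "negligible A \<longleftrightarrow> negligible B"
    if "A \<union> {t \<in> {lo..hi}. \<phi> t \<le> 0} = B \<union> {t \<in> {lo..hi}. \<phi> t \<le> 0}" for A B
    using arg_cong[OF that, of negligible] pos unfolding negligible_Un_eq by blast
  note iffs = mono_on_iff_derivative_nonneg[OF has_ae_derivative_diff[OF has_ae_derivative_cmult[OF F] H]]
    mono_on_iff_derivative_nonneg[OF has_ae_derivative_diff[OF id \<eta>]]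
    mono_on_iff_derivative_nonneg[OF has_ae_derivative_diff[OF H has_ae_derivative_cmult[OF F]]]
    mono_on_iff_derivative_nonneg[OF has_ae_derivative_diff[OF \<eta> id]]
  have signs: "s * \<phi> t - \<eta>' t * \<phi> t < 0 \<longleftrightarrow> s - \<eta>' t < 0"
    "\<eta>' t * \<phi> t - s * \<phi> t < 0 \<longleftrightarrow> \<eta>' t - s < 0" if "\<phi> t > 0" for t
    using that by auto
  show "mono_on {x..y} (\<lambda>t. s * F t - H t) \<longleftrightarrow> mono_on {x..y} (\<lambda>t. s * t - \<eta> t)"
    unfolding iffs
  proof (rule neg, rule set_eqI)
    fix t show "t \<in> {t \<in> {x..y}. s * \<phi> t - \<eta>' t * \<phi> t < 0} \<union> {t \<in> {lo..hi}. \<phi> t \<le> 0} \<longleftrightarrow>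
        t \<in> {t \<in> {x..y}. s - \<eta>' t < 0} \<union> {t \<in> {lo..hi}. \<phi> t \<le> 0}"
      by (cases "\<phi> t > 0") (use signs[of t] sub in auto)
  qed
  show "mono_on {x..y} (\<lambda>t. H t - s * F t) \<longleftrightarrow> mono_on {x..y} (\<lambda>t. \<eta> t - s * t)"
    unfolding iffs
  proof (rule neg, rule set_eqI)
    fix t show "t \<in> {t \<in> {x..y}. \<eta>' t * \<phi> t - s * \<phi> t < 0} \<union> {t \<in> {lo..hi}. \<phi> t \<le> 0} \<longleftrightarrow>
        t \<in> {t \<in> {x..y}. \<eta>' t - s < 0} \<union> {t \<in> {lo..hi}. \<phi> t \<le> 0}"
      by (cases "\<phi> t > 0") (use signs[of t] sub in auto)
  qed
qed

text \<open>Both sides ask for a supporting slope at each interior state, and by the preceding lemma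
  the same s serves both.\<close>

lemma convex_on_iff_rel_convex_flux:
  assumes F: "has_ae_derivative F \<phi>" and \<eta>: "has_ae_derivative \<eta> \<eta>'"
    and H: "has_ae_derivative H (\<lambda>t. \<eta>' t * \<phi> t)"
    and pos: "negligible {t \<in> {lo..hi}. \<phi> t \<le> 0}" and incr: "strict_mono_on {lo..hi} F"
  shows "convex_on {lo..hi} \<eta> \<longleftrightarrow> rel_convex {lo..hi} F H"
proof -
  have "mono_on {lo..v} (\<lambda>t. s * F t - H t) \<longleftrightarrow> mono_on {lo..v} (\<lambda>t. s * t - \<eta> t)"
    "mono_on {v..hi} (\<lambda>t. H t - s * F t) \<longleftrightarrow> mono_on {v..hi} (\<lambda>t. \<eta> t - s * t)"
    if "v \<in> {lo<..<hi}" for v s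
    using mono_on_flux_iff_entropy[OF F \<eta> H pos] that by auto
  moreover have "strict_mono_on {lo..hi} (\<lambda>t::real. t)"
    by (auto simp: strict_mono_on_def)
  ultimately show ?thesis
    by (simp add: convex_on_iff_rel_convex rel_convex_iff_support incr)
qed

text \<open>Strict monotonicity alone would allow a zero derivative on a set of positive measure.
  Curvature excludes this on \<open>{u..v}\<close> strictly inside: in the convex case the smallest
  slope there is the one at \<open>u\<close>, positive since F lo < F u; in the concave case it is
  the one at \<open>v\<close>, positive since F v < F hi. With such a slope \<kappa> the function F
  - \<kappa> id is increasing, hence \<phi> \<ge> \<kappa> almost everywhere.\<close>

lemma derivative_pos_ae:
  assumes F: "has_ae_derivative F \<phi>" and incr: "strict_mono_on {lo..hi} F"
    and curv: "convex_on {lo..hi} F \<or> concave_on {lo..hi} F"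
  shows "negligible {t \<in> {lo..hi}. \<phi> t \<le> 0}"
proof -
  have id: "strict_mono_on {lo..hi} (\<lambda>t::real. t)"
    by (auto simp: strict_mono_on_def)
  have slope: "\<exists>\<kappa>>0. mono_on {u..v} (\<lambda>t. F t - \<kappa> * t)" if uv: "lo < u" "u < v" "v < hi" for u v
    using curv
  proof
    assume "convex_on {lo..hi} F"
    then have "rel_convex {lo..hi} (\<lambda>t. t) F"
      by (simp add: convex_on_iff_rel_convex)
    then obtain s where s: "mono_on {lo..u} (\<lambda>t. s * t - F t)" "mono_on {u..hi} (\<lambda>t. F t - s * t)"
      using uv unfolding rel_convex_iff_support[OF id] by force
    have "F lo < F u"
      using strict_mono_onD[OF incr, of lo u] uv by auto
    also have "F u \<le> F lo + s * (u - lo)"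
      using mono_onD[OF s(1), of lo u] uv by (simp add: algebra_simps)
    finally have "0 < s * (u - lo)" by simp
    then have "0 < s"
      using uv by (simp add: zero_less_mult_iff)
    moreover have "mono_on {u..v} (\<lambda>t. F t - s * t)"
      by (rule mono_on_subset[OF s(2)]) (use uv in auto)
    ultimately show ?thesis by blast
  next
    assume "concave_on {lo..hi} F"
    then have "rel_convex {lo..hi} (\<lambda>t. t) (\<lambda>t. - F t)"
      by (simp add: convex_on_iff_rel_convex concave_on_def)
    then obtain s where s: "mono_on {lo..v} (\<lambda>t. s * t - - F t)" "mono_on {v..hi} (\<lambda>t. - F t - s * t)"
      using uv unfolding rel_convex_iff_support[OF id] by force
    have "F v < F hi"
      using strict_mono_onD[OF incr, of v hi] uv by auto
    also have "F hi \<le> F v - s * (hi - v)"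
      using mono_onD[OF s(2), of v hi] uv by (simp add: algebra_simps)
    finally have "s * (hi - v) < 0" by simp
    then have "0 < - s"
      using uv by (simp add: mult_less_0_iff)
    moreover have "mono_on {u..v} (\<lambda>t. s * t - - F t)"
      by (rule mono_on_subset[OF s(1)]) (use uv in auto)
    then have "mono_on {u..v} (\<lambda>t. F t - (- s) * t)"
      by (simp add: add.commute)
    ultimately show ?thesis by blast
  qed
  have neg: "negligible {t \<in> {u..v}. \<phi> t \<le> 0}" if uv: "lo < u" "u < v" "v < hi" for u v
  proof -
    obtain \<kappa> where \<kappa>: "\<kappa> > 0" "mono_on {u..v} (\<lambda>t. F t - \<kappa> * t)"
      using slope[OF uv] by blast
    have "has_ae_derivative (\<lambda>t. F t - \<kappa> * t) (\<lambda>t. \<phi> t - \<kappa>)"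
      using has_ae_derivative_diff[OF F has_ae_derivative_linear[of \<kappa> 0]] by simp
    then have "negligible {t \<in> {u..v}. \<phi> t - \<kappa> < 0}"
      using \<kappa>(2) mono_on_iff_derivative_nonneg by blast
    then show ?thesis
      by (rule negligible_subset) (use \<kappa>(1) in auto)
  qed
  \<comment> \<open>The bound \<kappa> degenerates at the ends, so the open interval is exhausted by
    countably many compact ones; for small k these may be empty or a single point.\<close>
  define N where "N k = {t \<in> {lo + 1 / real (Suc k)..hi - 1 / real (Suc k)}. \<phi> t \<le> 0}" for k
  have "negligible (N k)" for k
  proof (cases "lo + 1 / real (Suc k) < hi - 1 / real (Suc k)")
    case True
    show ?thesis
      unfolding N_def by (rule neg) (use True in \<open>simp_all\<close>)
  next
    case False
    have "N k \<subseteq> {lo + 1 / real (Suc k)}"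
      using False by (auto simp: N_def)
    then show ?thesis
      by (rule negligible_subset[rotated]) simp
  qed
  then have "negligible ({lo, hi} \<union> (\<Union>k. N k))"
    by (intro negligible_Un negligible_Union_nat) auto
  moreover have "{t \<in> {lo..hi}. \<phi> t \<le> 0} \<subseteq> {lo, hi} \<union> (\<Union>k. N k)"
  proof
    fix t assume t: "t \<in> {t \<in> {lo..hi}. \<phi> t \<le> 0}"
    show "t \<in> {lo, hi} \<union> (\<Union>k. N k)"
    proof (cases "t = lo \<or> t = hi")
      case False
      then have "0 < min (t - lo) (hi - t)" using t by auto
      then obtain k where "1 / real (Suc k) < min (t - lo) (hi - t)"
        using nat_approx_posE by blast
      then have "t \<in> N k" using t by (auto simp: N_def)
      then show ?thesis by blast
    qed auto
  qed
  ultimately show ?thesis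
    by (rule negligible_subset)
qed

section \<open>Points of differentiability of a concave function\<close>

lemma concave_on_subset: "\<lbrakk>concave_on T f; S \<subseteq> T; convex S\<rbrakk> \<Longrightarrow> concave_on S f"
  by (auto simp: concave_on_def intro: convex_on_subset)

text \<open>\<open>Gamma_out\<close> is the closure of a set of differentiability points, so these
  must be shown to be dense. A choice of supergradients D is decreasing, hence has only countably
  many discontinuities; at a continuity point x the difference quotients are squeezed between D y
  and D x and converge. The supergradient inequality is kept because it yields the sign of the
  derivative.\<close>

lemma concave_on_dense_derivative:
  fixes f :: "real \<Rightarrow> real"
  assumes f: "concave_on {a..b} f" and uv: "a \<le> u" "u < v" "v \<le> b"
  obtains x D where "u < x" "x < v" "(f has_real_derivative D) (at x)"
    "\<And>y. y \<in> {a..b} \<Longrightarrow> f y \<le> f x + D * (y - x)"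
proof -
  have id: "strict_mono_on {a..b} (\<lambda>t::real. t)"
    by (auto simp: strict_mono_on_def)
  have "\<exists>D. \<forall>y\<in>{a..b}. f y \<le> f x + D * (y - x)" if x: "x \<in> {a<..<b}" for x
  proof -
    have "rel_convex {a..b} (\<lambda>t. t) (\<lambda>t. - f t)"
      using f by (simp add: convex_on_iff_rel_convex concave_on_def)
    then obtain s where s: "mono_on {a..x} (\<lambda>t. s * t - - f t)" "mono_on {x..b} (\<lambda>t. - f t - s * t)"
      using x unfolding rel_convex_iff_support[OF id] by force
    have "f y \<le> f x + (- s) * (y - x)" if y: "y \<in> {a..b}" for y
    proof (cases "y \<le> x")
      case True
      then show ?thesis using mono_onD[OF s(1), of y x] x y by (auto simp: algebra_simps)
    next
      case False
      then show ?thesis using mono_onD[OF s(2), of x y] x y by (auto simp: algebra_simps)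
    qed
    then show ?thesis by blast
  qed
  then obtain D where D: "\<And>x y. x \<in> {a<..<b} \<Longrightarrow> y \<in> {a..b} \<Longrightarrow> f y \<le> f x + D x * (y - x)"
    by metis
  \<comment> \<open>The supergradient inequalities at y and at x, each evaluated at the other
    point.\<close>
  have between: "D y * (y - x) \<le> f y - f x" "f y - f x \<le> D x * (y - x)"
    if "x \<in> {a<..<b}" "y \<in> {a<..<b}" for x y
    using D[of x y] D[of y x] that by (auto simp: algebra_simps)
  have "mono_on {u<..<v} (\<lambda>x. - D x)"
  proof (rule mono_onI)
    fix x y assume xy: "x \<in> {u<..<v}" "y \<in> {u<..<v}" "x \<le> y"
    show "- D x \<le> - D y"
    proof (cases "x = y")
      case False
      have "D y * (y - x) \<le> D x * (y - x)"
        using between[of x y] xy uv by auto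
      then show ?thesis using False xy by simp
    qed simp
  qed
  from mono_on_ctble_discont[OF this]
  have "countable {x \<in> {u<..<v}. \<not> continuous (at x within {u<..<v}) (\<lambda>x. - D x)}" .
  moreover have "uncountable {u<..<v}"
    using uv by (simp add: uncountable_open_interval)
  ultimately have "{u<..<v} \<noteq> {x \<in> {u<..<v}. \<not> continuous (at x within {u<..<v}) (\<lambda>x. - D x)}"
    by metis
  then obtain x where x: "u < x" "x < v" and "continuous (at x within {u<..<v}) (\<lambda>x. - D x)"
    by auto
  then have "continuous (at x within {u<..<v}) D"
    using continuous_minus[of "at x within {u<..<v}" "\<lambda>x. - D x"] by simp
  then have "(D \<longlongrightarrow> D x) (at x)"
    using x by (simp add: continuous_within at_within_open[of x "{u<..<v}"])
  then have lim: "((\<lambda>y. D y - D x) \<longlongrightarrow> 0) (at x)"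
    by (simp add: LIM_zero)
  have "\<forall>\<^sub>F y in at x. y \<in> {u<..<v} - {x}"
    using eventually_at_in_open[of "{u<..<v}" x] x by simp
  then have "\<forall>\<^sub>F y in at x. norm ((f y - f x) / (y - x) - D x) \<le> norm (D y - D x)"
  proof eventually_elim
    case (elim y)
    have q: "D y * (y - x) \<le> f y - f x" "f y - f x \<le> D x * (y - x)"
      using between[of x y] elim x uv by auto
    show ?case
    proof (cases "x < y")
      case True
      then have "D y \<le> (f y - f x) / (y - x)" "(f y - f x) / (y - x) \<le> D x"
        using q by (simp_all add: pos_le_divide_eq pos_divide_le_eq)
      then show ?thesis by simp
    next
      case False
      then have "y < x" using elim by auto
      then have "(f y - f x) / (y - x) \<le> D y" "D x \<le> (f y - f x) / (y - x)"
        using q by (simp_all add: neg_le_divide_eq neg_divide_le_eq)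
      then show ?thesis by simp
    qed
  qed
  then have "((\<lambda>y. (f y - f x) / (y - x) - D x) \<longlongrightarrow> 0) (at x)"
    using lim by (rule Lim_null_comparison[OF _ tendsto_norm_zero])
  then have "(f has_real_derivative D x) (at x)"
    by (simp add: has_field_derivative_iff LIM_zero_iff)
  then show thesis
    using that[of x "D x"] x D uv by auto
qed

section \<open>The branch of outgoing characteristics\<close>

locale flux_function =
  fixes a b :: real and f :: "real \<Rightarrow> real"
  assumes le: "a \<le> b" and nonneg: "\<And>\<rho>. \<rho> \<in> {a..b} \<Longrightarrow> 0 \<le> f \<rho>"
    and cont: "continuous_on {a..b} f" and concave: "concave_on {a..b} f"
    and ends: "f a = 0" "f b = 0" and max_pos: "0 < flux_max a b f"
begin

lemma le_flux_max: "\<rho> \<in> {a..b} \<Longrightarrow> f \<rho> \<le> flux_max a b f"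
  unfolding flux_max_def
  using compact_continuous_image[OF cont compact_Icc]
  by (intro cSUP_upper) (auto simp: compact_imp_bounded bounded_imp_bdd_above)

text \<open>The end point c is the least maximiser: on a plateau of maxima the derivative is 0, so
  the outgoing states stop where the maximum is first reached. Left of c, a chord to the maximum has
  positive slope; right of c, a positive derivative would force smaller values just before \<rho>,
  although concavity keeps f above its value at \<rho> on \<open>{c..\<rho>}\<close>.\<close>

lemma increasing_branch:
  obtains c where "a < c" "c < b" "f ` {a..c} = {0..flux_max a b f}" "strict_mono_on {a..c} f"
    "closure {\<rho> \<in> {a..b}. \<exists>D. (f has_real_derivative D) (at \<rho> within {a..b}) \<and> D > 0} = {a..c}"
proof -
  let ?M = "flux_max a b f"
  let ?A = "{x \<in> {a..b}. f x = ?M}"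
  obtain x0 where x0: "x0 \<in> {a..b}" "\<And>y. y \<in> {a..b} \<Longrightarrow> f y \<le> f x0"
    using continuous_attains_sup[OF compact_Icc _ cont] le by auto
  then have "?M \<le> f x0"
    unfolding flux_max_def using le by (intro cSUP_least) auto
  with x0 le_flux_max[of x0] have "x0 \<in> ?A" by auto
  moreover have "closed ?A"
    using continuous_closed_preimage_constant[OF cont, of ?M] by simp
  then have "compact ?A"
    by (rule compact_Icc[THEN compact_Int_closed, of _ a b, THEN back_subst[of compact]]) auto
  ultimately obtain c where "c \<in> ?A" "\<forall>x\<in>?A. c \<le> x"
    using compact_attains_inf[of ?A] by blast
  then have c: "c \<in> {a..b}" "f c = ?M" and c_least: "\<And>x. x \<in> {a..b} \<Longrightarrow> f x = ?M \<Longrightarrow> c \<le> x"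
    by auto
  have "c \<noteq> a" "c \<noteq> b"
    using c max_pos ends by auto
  then have ac: "a < c" "c < b" using c by auto
  have incr: "strict_mono_on {a..c} f"
  proof (rule strict_mono_onI)
    fix x y assume xy: "x \<in> {a..c}" "y \<in> {a..c}" "x < y"
    have "f x < ?M"
      using c_least[of x] le_flux_max[of x] xy c by force
    have "concave_on {x..c} f"
      by (rule concave_on_subset[OF concave]) (use xy c in auto)
    then have "(f c - f x) / (c - x) * (y - x) + f x \<le> f y"
      using concave_onD_Icc'[of x c f y] xy by auto
    moreover have "0 < (f c - f x) / (c - x) * (y - x)"
      using xy \<open>f x < ?M\<close> c by auto
    ultimately show "f x < f y" by linarith
  qed
  have "f ` {a..c} = {0..?M}"
  proof
    show "f ` {a..c} \<subseteq> {0..?M}"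
      using nonneg le_flux_max c by auto
    have "continuous_on {a..c} f"
      by (rule continuous_on_subset[OF cont]) (use c in auto)
    then show "{0..?M} \<subseteq> f ` {a..c}"
      using IVT'[of f a _ c] ac ends c by fastforce
  qed
  moreover have "closure {\<rho> \<in> {a..b}. \<exists>D. (f has_real_derivative D) (at \<rho> within {a..b}) \<and> D > 0} = {a..c}"
    (is "closure ?S = _")
  proof
    have "\<rho> \<le> c" if \<rho>: "\<rho> \<in> {a..b}" and D: "(f has_real_derivative D) (at \<rho> within {a..b})" "D > 0" for \<rho> D
    proof (rule ccontr)
      assume "\<not> \<rho> \<le> c"
      obtain d where d: "d > 0" "\<And>h. 0 < h \<Longrightarrow> \<rho> - h \<in> {a..b} \<Longrightarrow> h < d \<Longrightarrow> f (\<rho> - h) < f \<rho>"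
        using has_real_derivative_pos_inc_left[OF D] by blast
      \<comment> \<open>The step is short enough for the local strict increase and does not go back
        beyond c.\<close>
      define h where "h = min (d / 2) (\<rho> - c)"
      have h: "0 < h" "h < d" "\<rho> - h \<in> {c..\<rho>}"
        using d \<open>\<not> \<rho> \<le> c\<close> by (auto simp: h_def min_def)
      have "concave_on {c..\<rho>} f"
        by (rule concave_on_subset[OF concave]) (use \<rho> c in auto)
      then have "min (f c) (f \<rho>) \<le> f (\<rho> - h)"
        using concave_on_ge_min h by blast
      moreover have "f \<rho> \<le> f c"
        using le_flux_max \<rho> c by auto
      ultimately show False
        using d(2)[of h] h c \<rho> by auto
    qed
    then show "closure ?S \<subseteq> {a..c}"
      by (intro closure_minimal) auto
    show "{a..c} \<subseteq> closure ?S"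
    proof
      fix x assume x: "x \<in> {a..c}"
      show "x \<in> closure ?S"
        unfolding closure_approachable
      proof (intro allI impI)
        fix e :: real assume "e > 0"
        obtain p D where p: "max a (x - e) < p" "p < min c (x + e)" "(f has_real_derivative D) (at p)"
          and D: "\<And>y. y \<in> {a..b} \<Longrightarrow> f y \<le> f p + D * (y - p)"
          by (rule concave_on_dense_derivative[OF concave, of "max a (x - e)" "min c (x + e)"])
            (use x c ac \<open>e > 0\<close> in auto)
        have "f p < f c"
          using strict_mono_onD[OF incr, of p c] p by auto
        then have "0 < D * (c - p)"
          using D[of c] c by auto
        then have "0 < D"
          using p by (simp add: zero_less_mult_iff)
        then have "p \<in> ?S"
          using p c DERIV_subset[OF p(3)] by auto
        then show "\<exists>y\<in>?S. dist y x < e"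
          using p by (intro bexI[of _ p]) (auto simp: dist_real_def)
      qed
    qed
  qed
  ultimately show thesis
    using that ac incr by blast
qed

end

lemma flux_function_reflect:
  assumes "flux_function a b f"
  shows "flux_function (- b) (- a) (\<lambda>x. f (- x))"
    and "flux_max (- b) (- a) (\<lambda>x. f (- x)) = flux_max a b f"
proof -
  interpret flux_function a b f by fact
  have img: "uminus ` {- b..- a} = {a..b}" by simp
  show max: "flux_max (- b) (- a) (\<lambda>x. f (- x)) = flux_max a b f"
    unfolding flux_max_def img[symmetric] image_image ..
  show "flux_function (- b) (- a) (\<lambda>x. f (- x))"
  proof
    show "continuous_on {- b..- a} (\<lambda>x. f (- x))"
      by (rule continuous_on_compose2[OF cont]) (auto intro!: continuous_intros)
    show "concave_on {- b..- a} (\<lambda>x. f (- x))"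
    proof (rule concave_on_linorderI)
      fix t x y :: real assume "0 < t" "t < 1" "x \<in> {- b..- a}" "y \<in> {- b..- a}"
      then show "(1 - t) * f (- x) + t * f (- y) \<le> f (- ((1 - t) *\<^sub>R x + t *\<^sub>R y))"
        using concave_onD[OF concave, of t "- x" "- y"] by simp
    qed simp
  qed (use le nonneg ends max_pos max in auto)
qed

text \<open>Obtained from the increasing branch of the reflected flux x \<mapsto> f (- x).\<close>

lemma (in flux_function) decreasing_branch:
  obtains d where "a < d" "d < b" "f ` {d..b} = {0..flux_max a b f}" "strict_mono_on {d..b} (\<lambda>t. - f t)"
    "closure {\<rho> \<in> {a..b}. \<exists>D. (f has_real_derivative D) (at \<rho> within {a..b}) \<and> D < 0} = {d..b}"
proof -
  let ?f = "\<lambda>x. f (- x)"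
  interpret r: flux_function "- b" "- a" ?f
    by (rule flux_function_reflect(1)[OF flux_function_axioms])
  note max = flux_function_reflect(2)[OF flux_function_axioms]
  obtain c where c: "- b < c" "c < - a" "?f ` {- b..c} = {0..flux_max a b f}" "strict_mono_on {- b..c} ?f"
    and cl: "closure {\<rho> \<in> {- b..- a}. \<exists>D. (?f has_real_derivative D) (at \<rho> within {- b..- a}) \<and> D > 0} = {- b..c}"
    by (rule r.increasing_branch[unfolded max])
  \<comment> \<open>Stated within the interval, so that the one-sided derivatives at the end points
    of the state space are reflected as well.\<close>
  have mirror: "((\<lambda>x. g (- x)) has_real_derivative - D) (at (- \<rho>) within {- v..- u})"
    if "(g has_real_derivative D) (at \<rho> within {u..v})" for g :: "real \<Rightarrow> real" and D \<rho> u v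
  proof -
    have "(g has_real_derivative D) (at (- (- \<rho>)) within uminus ` {- v..- u})"
      using that by simp
    moreover have "(uminus has_real_derivative - 1) (at (- \<rho>) within {- v..- u})"
      by (auto intro!: derivative_eq_intros)
    ultimately show ?thesis
      using DERIV_image_chain[of g D uminus "- \<rho>" "{- v..- u}" "- 1"] by (simp add: o_def)
  qed
  have "{\<rho> \<in> {a..b}. \<exists>D. (f has_real_derivative D) (at \<rho> within {a..b}) \<and> D < 0} =
    uminus ` {\<rho> \<in> {- b..- a}. \<exists>D. (?f has_real_derivative D) (at \<rho> within {- b..- a}) \<and> D > 0}"
    (is "?S = uminus ` ?S'")
  proof (intro equalityI subsetI)
    fix \<rho> assume "\<rho> \<in> ?S"
    then obtain D where "\<rho> \<in> {a..b}" "(f has_real_derivative D) (at \<rho> within {a..b})" "D < 0" by auto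
    then have "- \<rho> \<in> ?S'"
      using mirror[of f D \<rho> a b] by (auto intro!: exI[of _ "- D"])
    then show "\<rho> \<in> uminus ` ?S'" by (rule rev_image_eqI) simp
  next
    fix \<rho> assume "\<rho> \<in> uminus ` ?S'"
    then obtain D where "- \<rho> \<in> {- b..- a}" "(?f has_real_derivative D) (at (- \<rho>) within {- b..- a})" "D > 0" by auto
    then show "\<rho> \<in> ?S"
      using mirror[of ?f D "- \<rho>" "- b" "- a"] by (auto intro!: exI[of _ "- D"])
  qed
  then have "closure ?S = uminus ` closure ?S'"
    by (simp add: closure_injective_linear_image[of uminus, symmetric] linear_uminus)
  then have "closure ?S = {- c..b}"
    unfolding cl by simp
  moreover have "f ` {- c..b} = {0..flux_max a b f}"
  proof -
    have "f ` {- c..b} = f ` (uminus ` {- b..c})" by simp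
    also have "\<dots> = {0..flux_max a b f}"
      unfolding image_image by (rule c(3))
    finally show ?thesis .
  qed
  moreover have "strict_mono_on {- c..b} (\<lambda>t. - f t)"
  proof (rule strict_mono_onI)
    fix x y assume "x \<in> {- c..b}" "y \<in> {- c..b}" "x < y"
    then show "- f x < - f y"
      using strict_mono_onD[OF c(4), of "- y" "- x"] by auto
  qed
  ultimately show thesis
    using that[of "- c"] c by auto
qed

text \<open>A common form for both kinds of road. The last conclusion is the order that makes a jump
  between \<rho> and \<gamma> an entropy shock for a concave flux, namely from the smaller state on
  the left to the larger on the right: \<gamma> is placed right of the junction on incoming and left
  of it on outgoing roads.\<close>

lemma (in flux_function) Gamma_out_branch:
  obtains lo hi where "lo < hi" "{lo..hi} \<subseteq> {a..b}" "Gamma_out n h a b f = {lo..hi}"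
    "f ` {lo..hi} = {0..flux_max a b f}" "strict_mono_on {lo..hi} (\<lambda>t. - road_sign n h * f t)"
    "\<And>\<rho> \<gamma>. \<rho> \<in> {a..b} \<Longrightarrow> \<gamma> \<in> {lo..hi} \<Longrightarrow> f \<rho> = f \<gamma> \<Longrightarrow> 0 \<le> road_sign n h * (\<gamma> - \<rho>)"
proof (cases "h \<le> n")
  case True
  obtain d where d: "a < d" "d < b" "f ` {d..b} = {0..flux_max a b f}" "strict_mono_on {d..b} (\<lambda>t. - f t)"
    "closure {\<rho> \<in> {a..b}. \<exists>D. (f has_real_derivative D) (at \<rho> within {a..b}) \<and> D < 0} = {d..b}"
    by (rule decreasing_branch)
  have less: "\<rho> \<le> \<gamma>" if "\<rho> \<in> {a..b}" "\<gamma> \<in> {d..b}" "f \<rho> = f \<gamma>" for \<rho> \<gamma>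
    using strict_mono_onD[OF d(4), of \<gamma> \<rho>] that by force
  show ?thesis
  proof (rule that)
    show "Gamma_out n h a b f = {d..b}"
      using d(5) True by (simp add: Gamma_out_def)
    show "0 \<le> road_sign n h * (\<gamma> - \<rho>)" if "\<rho> \<in> {a..b}" "\<gamma> \<in> {d..b}" "f \<rho> = f \<gamma>" for \<rho> \<gamma>
      using less[OF that] True by (simp add: road_sign_def)
  qed (use d True in \<open>simp_all add: road_sign_def\<close>)
next
  case False
  obtain c where c: "a < c" "c < b" "f ` {a..c} = {0..flux_max a b f}" "strict_mono_on {a..c} f"
    "closure {\<rho> \<in> {a..b}. \<exists>D. (f has_real_derivative D) (at \<rho> within {a..b}) \<and> D > 0} = {a..c}"
    by (rule increasing_branch)
  have less: "\<gamma> \<le> \<rho>" if "\<rho> \<in> {a..b}" "\<gamma> \<in> {a..c}" "f \<rho> = f \<gamma>" for \<rho> \<gamma>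
    using strict_mono_onD[OF c(4), of \<rho> \<gamma>] that by force
  show ?thesis
  proof (rule that)
    show "Gamma_out n h a b f = {a..c}"
      using c(5) False by (simp add: Gamma_out_def)
    show "0 \<le> road_sign n h * (\<gamma> - \<rho>)" if "\<rho> \<in> {a..b}" "\<gamma> \<in> {a..c}" "f \<rho> = f \<gamma>" for \<rho> \<gamma>
      using less[OF that] False by (simp add: road_sign_def)
  qed (use c False in \<open>simp_all add: road_sign_def\<close>)
qed

section \<open>Concavity of the flux objective\<close>

text \<open>The integral of |h| is 0, and a continuous nonnegative function with zero integral over
  a nondegenerate interval vanishes. This turns the almost everywhere relation between g and G into
  one for every y.\<close>

lemma continuous_AE_zero:
  fixes h :: "real \<Rightarrow> real"
  assumes cont: "continuous_on {a..b} h" and ae: "AE y in lborel. y \<in> {a..b} \<longrightarrow> h y = 0"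
    and less: "a < b" and y: "y \<in> {a..b}"
  shows "h y = 0"
proof -
  have "((\<lambda>y. \<bar>h y\<bar>) has_integral 0) {a..b} \<longleftrightarrow> ((\<lambda>_. 0::real) has_integral 0) {a..b}"
    by (rule has_integral_AE) (use ae in eventually_elim, simp)
  then have "((\<lambda>y. \<bar>h y\<bar>) has_integral 0) (cbox a b)"
    by simp
  then have "\<bar>h y\<bar> = 0"
    by (intro has_integral_0_cbox_imp_0[where f = "\<lambda>y. \<bar>h y\<bar>"]) (use cont less y in \<open>auto intro!: continuous_intros\<close>)
  then show ?thesis by simp
qed

section \<open>Change of variable from states to normalised fluxes\<close>

lemma rel_convex_scale:
  assumes "c > 0"
  shows "rel_convex S (\<lambda>t. c * F t) H \<longleftrightarrow> rel_convex S F H"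
proof -
  have "(H v - H u) * (c * F w - c * F v) \<le> (H w - H v) * (c * F v - c * F u) \<longleftrightarrow>
      (H v - H u) * (F w - F v) \<le> (H w - H v) * (F v - F u)" for u v w
  proof -
    have "(H v - H u) * (c * F w - c * F v) = c * ((H v - H u) * (F w - F v))"
      "(H w - H v) * (c * F v - c * F u) = c * ((H w - H v) * (F v - F u))"
      by (simp_all only: right_diff_distrib left_diff_distrib mult.left_commute mult.assoc)
    then show ?thesis using assms by (simp only: mult_le_cancel_left_pos)
  qed
  then show ?thesis by (simp only: rel_convex_def)
qed

lemma rel_convex_image:
  assumes k: "strict_mono_on S k"
  shows "rel_convex (k ` S) (\<lambda>t. t) q \<longleftrightarrow> rel_convex S k (\<lambda>t. q (k t))"
proof -
  have "k u < k v \<longleftrightarrow> u < v" if "u \<in> S" "v \<in> S" for u v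
    using strict_mono_on_less[OF k] that by blast
  then show ?thesis by (simp add: rel_convex_def)
qed

text \<open>A decreasing map reverses triples: the inequality for (u, v, w) becomes the one for (w,
  v, u), with both factors of each product changing sign.\<close>

lemma rel_convex_image_antimono:
  assumes k: "strict_mono_on S (\<lambda>t. - k t)"
  shows "rel_convex (k ` S) (\<lambda>t. t) q \<longleftrightarrow> rel_convex S (\<lambda>t. - k t) (\<lambda>t. q (k t))"
proof -
  have less: "k u < k v \<longleftrightarrow> v < u" if "u \<in> S" "v \<in> S" for u v
    using strict_mono_on_less[OF k, of v u] that by simp
  have "(q (k v) - q (k u)) * (k w - k v) \<le> (q (k w) - q (k v)) * (k v - k u) \<longleftrightarrow>
    (q (k v) - q (k w)) * (- k u - - k v) \<le> (q (k u) - q (k v)) * (- k v - - k w)" for u v w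
    by (simp add: algebra_simps)
  then show ?thesis
    unfolding rel_convex_def by (simp add: less) blast
qed

section \<open>Continuing the entropy to the whole line\<close>

lemma convex_on_UNIV_supportI:
  fixes F :: "real \<Rightarrow> real"
  assumes "\<And>x. \<exists>s. \<forall>y. F x + s * (y - x) \<le> F y"
  shows "convex_on UNIV F"
proof (rule convex_onI)
  fix t x y :: real assume t: "0 < t" "t < 1"
  let ?z = "(1 - t) *\<^sub>R x + t *\<^sub>R y"
  obtain s where s: "\<And>y. F ?z + s * (y - ?z) \<le> F y"
    using assms by blast
  have "(1 - t) * (F ?z + s * (x - ?z)) + t * (F ?z + s * (y - ?z)) \<le> (1 - t) * F x + t * F y"
    using s[of x] s[of y] t by (intro add_mono mult_left_mono) auto
  moreover have "(1 - t) * (F ?z + s * (x - ?z)) + t * (F ?z + s * (y - ?z)) = F ?z"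
    by (simp add: algebra_simps)
  ultimately show "F ?z \<le> (1 - t) * F x + t * F y" by simp
qed simp

text \<open>Outside of \<open>{lo..hi}\<close> the entropy is continued linearly, with slopes \<open>\<mp>M\<close>.\<close>
lemma entropy_pair_extension:
  assumes f: "has_ae_derivative f f'" and \<eta>: "has_ae_derivative \<eta> \<eta>'"
    and G: "has_ae_derivative G (\<lambda>t. \<eta>' t * f' t)" and less: "lo < hi"
    and cvx: "convex_on {lo..hi} \<eta>"
    and lip: "\<And>x y. lo \<le> x \<Longrightarrow> x \<le> y \<Longrightarrow> y \<le> hi \<Longrightarrow> \<bar>\<eta> y - \<eta> x\<bar> \<le> M * (y - x)"
  shows "\<exists>\<eta>2 G2. entropy_pair f \<eta>2 G2 \<and> (\<forall>\<rho>\<in>{lo..hi}. G2 \<rho> = G \<rho>)"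
proof -
  \<comment> \<open>The same continuation serves the entropy with k = id and its flux with k = f,
    because a constant slope M of the entropy forces the flux M f up to a constant. The constants
    \<open>c\<close> and \<open>l\<close> match the values at \<open>lo\<close> and
    \<open>hi\<close>.\<close>
  define ext where "ext k l c (F :: real \<Rightarrow> real) t =
    (if t \<le> lo then - M * k t + c else if t \<le> hi then F t else M * k t + l)"
    for k :: "real \<Rightarrow> real" and l c F t
  define \<eta>2 where "\<eta>2 = ext (\<lambda>t. t) (\<eta> hi - M * hi) (\<eta> lo + M * lo) \<eta>"
  define G2 where "G2 = ext f (G hi - M * f hi) (G lo + M * f lo) G"
  define \<eta>2' where "\<eta>2' t = (if t \<le> lo then - M else if t \<le> hi then \<eta>' t else M)" for t
  have ext: "has_ae_derivative (ext k (F hi - M * k hi) (F lo + M * k lo) F)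
      (\<lambda>t. if t \<le> lo then - M * k' t else if t \<le> hi then F' t else M * k' t)"
    if k: "has_ae_derivative k k'" and F: "has_ae_derivative F F'" for k k' F F'
  proof -
    have line: "has_ae_derivative (\<lambda>t. c * k t + d) (\<lambda>t. c * k' t)" for c d
      using has_ae_derivative_add[OF has_ae_derivative_cmult[OF k] has_ae_derivative_const, of c d] by simp
    have "has_ae_derivative (\<lambda>t. if t \<le> hi then F t else M * k t + (F hi - M * k hi))
        (\<lambda>t. if t \<le> hi then F' t else M * k' t)"
      by (rule has_ae_derivative_join[OF F line]) simp
    from has_ae_derivative_join[OF line[of "- M" "F lo + M * k lo"] this, of lo] less
    show ?thesis unfolding ext_def by simp
  qed
  have id: "has_ae_derivative (\<lambda>t. t) (\<lambda>_. 1)"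
    using has_ae_derivative_linear[of 1 0] by simp
  have "has_ae_derivative \<eta>2 \<eta>2'"
    using ext[OF id \<eta>] by (simp add: \<eta>2_def \<eta>2'_def[abs_def] cong: if_cong)
  moreover have "has_ae_derivative G2 (\<lambda>t. \<eta>2' t * f' t)"
    using ext[OF f G] by (simp add: G2_def \<eta>2'_def if_distrib[of "\<lambda>c. c * _"] cong: if_cong)
  ultimately have flux: "entropy_flux f \<eta>2 G2"
    using f unfolding entropy_flux_def by blast
  have lo: "\<eta>2 t = \<eta> lo - M * (t - lo)" if "t \<le> lo" for t
    using that by (simp add: \<eta>2_def ext_def algebra_simps)
  have mid: "\<eta>2 t = \<eta> t" if "t \<in> {lo..hi}" for t
    using that by (auto simp: \<eta>2_def ext_def)
  have hi: "\<eta>2 t = \<eta> hi + M * (t - hi)" if "hi \<le> t" for t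
    using that less by (auto simp: \<eta>2_def ext_def algebra_simps)
  have "0 \<le> M * (hi - lo)"
    using lip[of lo hi] less by simp
  then have M: "0 \<le> M"
    using less by (simp add: zero_le_mult_iff)
  have "\<exists>s. \<forall>y. \<eta>2 x + s * (y - x) \<le> \<eta>2 y" for x
  proof -
    consider "x \<le> lo" | "lo < x" "x < hi" | "hi \<le> x" by linarith
    then show ?thesis
    proof cases
      case 1
      have "\<eta>2 x - M * (y - x) \<le> \<eta>2 y" for y
      proof -
        consider "y \<le> lo" | "y \<in> {lo..hi}" | "hi \<le> y" by force
        then show ?thesis
        proof cases
          case 2
          then show ?thesis using lip[of lo y] lo[OF 1] mid by (auto simp: algebra_simps)
        next
          case 3
          then show ?thesis
            using lip[of lo hi] lo[OF 1] hi[OF 3] M less mult_left_mono[of hi y M]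
            by (auto simp: algebra_simps)
        qed (use lo[of y] lo[OF 1] in \<open>auto simp: algebra_simps\<close>)
      qed
      then show ?thesis by (intro exI[of _ "- M"]) simp
    next
      case 3
      have "\<eta>2 x + M * (y - x) \<le> \<eta>2 y" for y
      proof -
        consider "y \<le> lo" | "y \<in> {lo..hi}" | "hi \<le> y" by force
        then show ?thesis
        proof cases
          case 2
          then show ?thesis using lip[of y hi] hi[OF 3] mid by (auto simp: algebra_simps)
        next
          case 1
          then show ?thesis
            using lip[of lo hi] lo[OF 1] hi[OF 3] M less mult_left_mono[of y lo M]
            by (auto simp: algebra_simps)
        qed (use hi[of y] hi[OF 3] in \<open>auto simp: algebra_simps\<close>)
      qed
      then show ?thesis by blast
    next
      case 2
      have "rel_convex {lo..hi} (\<lambda>t. t) \<eta>"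
        using cvx by (simp add: convex_on_iff_rel_convex)
      moreover have "strict_mono_on {lo..hi} (\<lambda>t::real. t)"
        by (auto simp: strict_mono_on_def)
      ultimately obtain s where s: "mono_on {lo..x} (\<lambda>t. s * t - \<eta> t)" "mono_on {x..hi} (\<lambda>t. \<eta> t - s * t)"
        using 2 rel_convex_iff_support[of lo hi "\<lambda>t. t" \<eta>] by force
      have left: "\<eta> x + s * (y - x) \<le> \<eta> y" if "lo \<le> y" "y \<le> x" for y
        using mono_onD[OF s(1), of y x] that by (auto simp: algebra_simps)
      have right: "\<eta> x + s * (y - x) \<le> \<eta> y" if "x \<le> y" "y \<le> hi" for y
        using mono_onD[OF s(2), of x y] that by (auto simp: algebra_simps)
      \<comment> \<open>Evaluating the support line at \<open>lo\<close> and at \<open>hi\<close>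
        against the Lipschitz bound confines s to [-M, M], so it cannot cross the outer
        lines.\<close>
      have "(- M) * (x - lo) \<le> s * (x - lo)"
        using left[of lo] lip[of lo x] 2 by (auto simp: algebra_simps)
      then have s1: "- M \<le> s"
        by (rule mult_right_le_imp_le) (use 2 in simp)
      have "s * (hi - x) \<le> M * (hi - x)"
        using right[of hi] lip[of x hi] 2 by (auto simp: algebra_simps)
      then have s2: "s \<le> M"
        by (rule mult_right_le_imp_le) (use 2 in simp)
      have "\<eta>2 x + s * (y - x) \<le> \<eta>2 y" for y
      proof -
        consider "y \<le> lo" | "y \<in> {lo..hi}" | "hi \<le> y" by force
        then show ?thesis
        proof cases
          case 1
          \<comment> \<open>The support line is followed first to \<open>lo\<close>, where the inner
            inequality applies, and then along the outer line, where -M \<le> s decides.\<close>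
          have "\<eta>2 x + s * (y - x) = \<eta> x + s * (lo - x) + s * (y - lo)"
            using mid[of x] 2 by (simp add: algebra_simps)
          also have "\<dots> \<le> \<eta> lo + (- M) * (y - lo)"
            using left[of lo] 2 1 s1 by (intro add_mono mult_right_mono_neg) auto
          finally show ?thesis using lo[OF 1] by simp
        next
          case 2
          then show ?thesis
            using left[of y] right[of y] mid[of x] mid[of y] \<open>lo < x\<close> \<open>x < hi\<close> by (cases "y \<le> x") auto
        next
          case 3
          have "\<eta>2 x + s * (y - x) = \<eta> x + s * (hi - x) + s * (y - hi)"
            using mid[of x] 2 by (simp add: algebra_simps)
          also have "\<dots> \<le> \<eta> hi + M * (y - hi)"
            using right[of hi] 2 3 s2 by (intro add_mono mult_right_mono) auto
          finally show ?thesis using hi[OF 3] by simp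
        qed
      qed
      then show ?thesis by blast
    qed
  qed
  then have "convex_on UNIV \<eta>2"
    by (rule convex_on_UNIV_supportI)
  moreover have "G2 \<rho> = G \<rho>" if "\<rho> \<in> {lo..hi}" for \<rho>
    using that by (auto simp: G2_def ext_def)
  ultimately show ?thesis
    using flux unfolding entropy_pair_def by blast
qed

context flux_function
begin

text \<open>The inverse of f on the compact branch is continuous, so both sides of the almost
  everywhere relation are continuous in y; it therefore holds everywhere, in particular at the
  normalised flux of \<gamma>.\<close>

lemma g_eq_flux:
  assumes G: "continuous_on UNIV G" and g: "continuous_on {0..1} g"
    and ae: "AE y in lborel. y \<in> {0..1} \<longrightarrow>
      g y = road_sign n h * G (inv_into (Gamma_out n h a b f) f (y * flux_max a b f))"
    and \<gamma>: "\<gamma> \<in> Gamma_out n h a b f"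
  shows "g (f \<gamma> / flux_max a b f) = road_sign n h * G \<gamma>"
proof -
  let ?M = "flux_max a b f"
  obtain lo hi where lohi: "lo < hi" "{lo..hi} \<subseteq> {a..b}" and \<Gamma>: "Gamma_out n h a b f = {lo..hi}"
    and img: "f ` {lo..hi} = {0..?M}" and mono: "strict_mono_on {lo..hi} (\<lambda>t. - road_sign n h * f t)"
    using Gamma_out_branch[of n h] by metis
  have inj: "inj_on f {lo..hi}"
    using strict_mono_on_imp_inj_on[OF mono] by (auto simp: inj_on_def)
  have cont': "continuous_on {lo..hi} f"
    by (rule continuous_on_subset[OF cont lohi(2)])
  have inv: "continuous_on {0..?M} (inv_into {lo..hi} f)"
    unfolding img[symmetric] by (rule continuous_on_inv[OF cont']) (use inj in auto)
  have "continuous_on {0..1} (\<lambda>y. inv_into {lo..hi} f (y * ?M))"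
    by (rule continuous_on_compose2[OF inv])
      (use max_pos in \<open>auto intro!: continuous_intros simp: mult_le_cancel_right1\<close>)
  then have "continuous_on {0..1} (\<lambda>y. G (inv_into {lo..hi} f (y * ?M)))"
    by (rule continuous_on_compose2[OF G]) simp
  then have "continuous_on {0..1} (\<lambda>y. g y - road_sign n h * G (inv_into {lo..hi} f (y * ?M)))"
    by (intro continuous_intros g)
  moreover have "AE y in lborel. y \<in> {0..1} \<longrightarrow> g y - road_sign n h * G (inv_into {lo..hi} f (y * ?M)) = 0"
    using ae unfolding \<Gamma> by eventually_elim simp
  moreover have "f \<gamma> \<in> {0..?M}"
    using \<gamma> img \<Gamma> by blast
  then have "f \<gamma> / ?M \<in> {0..1}"
    using max_pos by simp
  ultimately have "g (f \<gamma> / ?M) - road_sign n h * G (inv_into {lo..hi} f (f \<gamma> / ?M * ?M)) = 0"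
    by (intro continuous_AE_zero[where a = 0 and b = 1]) auto
  then show ?thesis
    using \<gamma> max_pos inv_into_f_f[OF inj, of \<gamma>] by (simp add: \<Gamma>)
qed

text \<open>\<open>g\<close> sees \<open>G\<close> only along \<open>Gamma_out\<close>, so convexity
  is testable only there: either for the given entropy on the branch, or for some globally convex
  entropy whose flux agrees with \<open>G\<close> on it. For the second form a convex function on a
  compact interval must be extended to the line, which needs bounded slopes at the ends; they come
  from the Lipschitz bound on \<open>g\<close>.\<close>

theorem concave_iff_convex_entropy:
  assumes flux: "entropy_flux f \<eta> G" and g: "L-lipschitz_on {0..1} g"
    and gG: "\<And>\<gamma>. \<gamma> \<in> Gamma_out n h a b f \<Longrightarrow> g (f \<gamma> / flux_max a b f) = road_sign n h * G \<gamma>"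
  shows "concave_on {0..1} g \<longleftrightarrow> convex_on (Gamma_out n h a b f) \<eta>"
    and "concave_on {0..1} g \<longleftrightarrow>
      (\<exists>\<eta>' G'. entropy_pair f \<eta>' G' \<and> (\<forall>\<rho>\<in>Gamma_out n h a b f. G' \<rho> = G \<rho>))"
proof -
  let ?M = "flux_max a b f" and ?s = "road_sign n h"
  obtain lo hi where lohi: "lo < hi" "{lo..hi} \<subseteq> {a..b}" and \<Gamma>: "Gamma_out n h a b f = {lo..hi}"
    and img: "f ` {lo..hi} = {0..?M}" and mono: "strict_mono_on {lo..hi} (\<lambda>t. - ?s * f t)"
    using Gamma_out_branch[of n h] by metis
  \<comment> \<open>With this sign F increases on the branch of either kind of road, and the
    matching flux \<open>- ?s * G\<close> is the negative of g at the normalised flux, so that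
    convexity relative to F is concavity of g.\<close>
  define F where "F t = - ?s * f t" for t
  have sgn: "?s = 1 \<or> ?s = -1" by (simp add: road_sign_def)
  have curv: "convex_on {lo..hi} F \<or> concave_on {lo..hi} F"
  proof -
    have "concave_on {lo..hi} f"
      by (rule concave_on_subset[OF concave lohi(2)]) simp
    then show ?thesis
      using sgn by (auto simp: F_def[abs_def] concave_on_def)
  qed
  have FM: "F = (\<lambda>t. ?M * (- ?s * (f t / ?M)))"
    using max_pos by (auto simp: F_def)
  have img1: "(\<lambda>t. f t / ?M) ` {lo..hi} = {0..1}"
  proof -
    have "(\<lambda>t. f t / ?M) ` {lo..hi} = (\<lambda>y. y / ?M) ` {0..?M}"
      unfolding img[symmetric] by (simp add: image_image)
    then show ?thesis using max_pos by (simp add: image_divide_atLeastAtMost)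
  qed
  have mono1: "strict_mono_on {lo..hi} (\<lambda>t. - ?s * (f t / ?M))"
  proof (rule strict_mono_onI)
    fix x y assume "x \<in> {lo..hi}" "y \<in> {lo..hi}" "x < y"
    then have "- ?s * f x / ?M < - ?s * f y / ?M"
      using strict_mono_onD[OF mono] max_pos by (intro divide_strict_right_mono) auto
    then show "- ?s * (f x / ?M) < - ?s * (f y / ?M)" by simp
  qed
  \<comment> \<open>Stated for every pair whose flux agrees with \<open>G\<close> on the branch,
    since it is applied both to the given pair and to the globally convex one.\<close>
  have key: "concave_on {0..1} g \<longleftrightarrow> convex_on {lo..hi} \<eta>0"
    if "entropy_flux f \<eta>0 G0" "\<And>\<rho>. \<rho> \<in> {lo..hi} \<Longrightarrow> G0 \<rho> = G \<rho>" for \<eta>0 G0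
  proof -
    obtain f' \<eta>' where f': "has_ae_derivative f f'" and \<eta>': "has_ae_derivative \<eta>0 \<eta>'"
      and G': "has_ae_derivative G0 (\<lambda>t. \<eta>' t * f' t)"
      using \<open>entropy_flux f \<eta>0 G0\<close> unfolding entropy_flux_def by blast
    have F': "has_ae_derivative F (\<lambda>t. - ?s * f' t)"
      unfolding F_def[abs_def] by (rule has_ae_derivative_cmult[OF f'])
    have H': "has_ae_derivative (\<lambda>t. - ?s * G0 t) (\<lambda>t. \<eta>' t * (- ?s * f' t))"
      using has_ae_derivative_cmult[OF G', of "- ?s"] by (simp add: mult.left_commute)
    have "convex_on {lo..hi} \<eta>0 \<longleftrightarrow> rel_convex {lo..hi} F (\<lambda>t. - ?s * G0 t)"
      using mono derivative_pos_ae[OF F' _ curv]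
      by (intro convex_on_iff_rel_convex_flux[OF F' \<eta>' H']) (auto simp: F_def[abs_def])
    also have "\<dots> \<longleftrightarrow> rel_convex {lo..hi} F (\<lambda>t. - g (f t / ?M))"
    proof -
      have "- ?s * G0 t = - g (f t / ?M)" if "t \<in> {lo..hi}" for t
        using gG[of t] that \<open>\<And>\<rho>. \<rho> \<in> {lo..hi} \<Longrightarrow> G0 \<rho> = G \<rho>\<close>[of t] by (simp add: \<Gamma>)
      then show ?thesis by (simp add: rel_convex_def)
    qed
    also have "\<dots> \<longleftrightarrow> rel_convex {lo..hi} (\<lambda>t. - ?s * (f t / ?M)) (\<lambda>t. - g (f t / ?M))"
      unfolding FM by (rule rel_convex_scale[OF max_pos])
    also have "\<dots> \<longleftrightarrow> rel_convex {0..1} (\<lambda>t. t) (\<lambda>y. - g y)"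
      unfolding img1[symmetric]
      using sgn mono1 rel_convex_image_antimono[of "{lo..hi}" "\<lambda>t. f t / ?M" "\<lambda>y. - g y"]
        rel_convex_image[of "{lo..hi}" "\<lambda>t. f t / ?M" "\<lambda>y. - g y"] by auto
    also have "\<dots> \<longleftrightarrow> concave_on {0..1} g"
      by (simp add: convex_on_iff_rel_convex concave_on_def)
    finally show ?thesis ..
  qed
  show iff: "concave_on {0..1} g \<longleftrightarrow> convex_on (Gamma_out n h a b f) \<eta>"
    unfolding \<Gamma> by (rule key[OF flux]) simp
  show "concave_on {0..1} g \<longleftrightarrow>
      (\<exists>\<eta>' G'. entropy_pair f \<eta>' G' \<and> (\<forall>\<rho>\<in>Gamma_out n h a b f. G' \<rho> = G \<rho>))"
  proof
    assume "\<exists>\<eta>' G'. entropy_pair f \<eta>' G' \<and> (\<forall>\<rho>\<in>Gamma_out n h a b f. G' \<rho> = G \<rho>)"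
    then obtain \<eta>0 G0 where "entropy_pair f \<eta>0 G0" and G0: "\<forall>\<rho>\<in>{lo..hi}. G0 \<rho> = G \<rho>"
      unfolding \<Gamma> by blast
    then have "convex_on {lo..hi} \<eta>0" "entropy_flux f \<eta>0 G0"
      unfolding entropy_pair_def by (auto intro: convex_on_subset)
    then show "concave_on {0..1} g"
      using key[of \<eta>0 G0] G0 by blast
  next
    assume "concave_on {0..1} g"
    then have cvx: "convex_on {lo..hi} \<eta>"
      using iff by (simp add: \<Gamma>)
    obtain f' \<eta>' where f': "has_ae_derivative f f'" and \<eta>': "has_ae_derivative \<eta> \<eta>'"
      and G': "has_ae_derivative G (\<lambda>t. \<eta>' t * f' t)"
      using flux unfolding entropy_flux_def by blast
    have F': "has_ae_derivative F (\<lambda>t. - ?s * f' t)"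
      unfolding F_def[abs_def] by (rule has_ae_derivative_cmult[OF f'])
    have H': "has_ae_derivative (\<lambda>t. - ?s * G t) (\<lambda>t. \<eta>' t * (- ?s * f' t))"
      using has_ae_derivative_cmult[OF G', of "- ?s"] by (simp add: mult.left_commute)
    have pos: "negligible {t \<in> {lo..hi}. - ?s * f' t \<le> 0}"
      by (rule derivative_pos_ae[OF F' _ curv]) (use mono in \<open>simp add: F_def[abs_def]\<close>)
    \<comment> \<open>The Lipschitz constant of \<open>G\<close> with respect to the flux:
      \<open>g\<close> takes the flux divided by \<open>?M\<close>.\<close>
    define C where "C = L / ?M"
    have GF: "\<bar>(- ?s * G y) - (- ?s * G x)\<bar> \<le> C * (F y - F x)"
      if "x \<in> {lo..hi}" "y \<in> {lo..hi}" "x \<le> y" for x y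
    proof -
      have 01: "f x / ?M \<in> {0..1}" "f y / ?M \<in> {0..1}"
        using that img1 by blast+
      have "F x \<le> F y"
        using strict_mono_on_imp_mono_on[OF mono] that unfolding F_def mono_on_def by blast
      have "\<bar>(- ?s * G y) - (- ?s * G x)\<bar> = \<bar>g (f y / ?M) - g (f x / ?M)\<bar>"
        using gG[of x] gG[of y] that by (simp add: \<Gamma>)
      also have "\<dots> \<le> L * \<bar>f y / ?M - f x / ?M\<bar>"
        using lipschitz_onD[OF g 01(2,1)] by (simp add: dist_real_def)
      also have "\<dots> = C * \<bar>f y - f x\<bar>"
        using max_pos by (simp add: C_def diff_divide_distrib[symmetric] abs_divide)
      also have "\<bar>f y - f x\<bar> = \<bar>F y - F x\<bar>"
        using sgn by (auto simp: F_def)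
      finally show ?thesis using \<open>F x \<le> F y\<close> by simp
    qed
    \<comment> \<open>Slopes of \<open>G\<close> against the flux between -C and C, written as
      monotonicity so that the sign comparison of derivatives passes them on to the entropy.\<close>
    have m1: "mono_on {lo..hi} (\<lambda>t. C * F t - (- ?s * G t))"
      and m2: "mono_on {lo..hi} (\<lambda>t. (- ?s * G t) - (- C) * F t)"
    proof (safe intro!: mono_onI)
      fix x y assume "x \<in> {lo..hi}" "y \<in> {lo..hi}" "x \<le> y"
      from GF[OF this] have "(- ?s * G y) - (- ?s * G x) \<le> C * F y - C * F x"
        "- ((- ?s * G y) - (- ?s * G x)) \<le> C * F y - C * F x"
        unfolding right_diff_distrib abs_le_iff by blast+
      then show "C * F x - (- ?s * G x) \<le> C * F y - (- ?s * G y)"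
        "(- ?s * G x) - (- C) * F x \<le> (- ?s * G y) - (- C) * F y"
        by linarith+
    qed
    have e1: "mono_on {lo..hi} (\<lambda>t. C * t - \<eta> t)"
      using m1 mono_on_flux_iff_entropy(1)[OF F' \<eta>' H' pos order_refl] by blast
    have e2: "mono_on {lo..hi} (\<lambda>t. \<eta> t - (- C) * t)"
      using m2 mono_on_flux_iff_entropy(2)[OF F' \<eta>' H' pos order_refl] by blast
    have "\<bar>\<eta> y - \<eta> x\<bar> \<le> C * (y - x)" if "lo \<le> x" "x \<le> y" "y \<le> hi" for x y
      using mono_onD[OF e1, of x y] mono_onD[OF e2, of x y] that by (auto simp: algebra_simps)
    from entropy_pair_extension[OF f' \<eta>' G' lohi(1) cvx this]
    show "\<exists>\<eta>' G'. entropy_pair f \<eta>' G' \<and> (\<forall>\<rho>\<in>Gamma_out n h a b f. G' \<rho> = G \<rho>)"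
      unfolding \<Gamma> by blast
  qed
qed

end

section \<open>Testing with cutoffs at the junction\<close>

lemma integrable_bounded_support:
  fixes h :: "'a::euclidean_space \<Rightarrow> real"
  assumes [measurable]: "h \<in> borel_measurable borel"
    and bound: "\<And>p. \<bar>h p\<bar> \<le> C * indicator (cball 0 R) p"
  shows "integrable lborel h"
proof (rule Bochner_Integration.integrable_bound)
  show "integrable lborel (\<lambda>p. C * indicator (cball 0 R) p :: real)"
    by (intro integrable_mult_right integrable_real_indicator emeasure_compact_finite) auto
  show "AE p in lborel. norm (h p) \<le> norm (C * indicator (cball 0 R) p :: real)"
    using bound by (intro AE_I2) (metis abs_ge_self order_trans real_norm_def)
qed simp

text \<open>Nonnegativity and continuity of the derivative keep the product with a test function a
  test function; the bound 1 serves dominated convergence. The value \<theta>(0) is left open: it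
  distributes the limit between the left and the right trace.\<close>

definition cutoff :: "(real \<Rightarrow> real) \<Rightarrow> (real \<Rightarrow> real) \<Rightarrow> real \<Rightarrow> real \<Rightarrow> bool" where
  "cutoff \<theta> \<theta>' cl cr \<longleftrightarrow>
    (\<forall>x. (\<theta> has_real_derivative \<theta>' x) (at x)) \<and> continuous_on UNIV \<theta>' \<and>
    (\<forall>x. 0 \<le> \<theta> x \<and> \<theta> x \<le> 1) \<and> (\<forall>x. x \<le> -1 \<longrightarrow> \<theta> x = cl) \<and> (\<forall>x. 1 \<le> x \<longrightarrow> \<theta> x = cr)"

text \<open>The limit of \<open>\<theta> (k x)\<close> as \<open>k \<rightarrow> \<infinity>\<close>.\<close>

definition cutoff_limit :: "(real \<Rightarrow> real) \<Rightarrow> real \<Rightarrow> real \<Rightarrow> real \<Rightarrow> real" where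
  "cutoff_limit \<theta> cl cr x = (if x < 0 then cl else if x > 0 then cr else \<theta> 0)"

lemma cutoff_continuous: "cutoff \<theta> \<theta>' cl cr \<Longrightarrow> continuous_on S \<theta>"
  unfolding cutoff_def by (meson DERIV_isCont continuous_at_imp_continuous_on)

lemma cutoff_borel:
  assumes "cutoff \<theta> \<theta>' cl cr"
  shows "\<theta> \<in> borel_measurable borel" "\<theta>' \<in> borel_measurable borel"
    "cutoff_limit \<theta> cl cr \<in> borel_measurable borel"
proof -
  show "\<theta> \<in> borel_measurable borel"
    using assms by (intro borel_measurable_continuous_onI cutoff_continuous)
  show "\<theta>' \<in> borel_measurable borel"
    using assms by (intro borel_measurable_continuous_onI) (simp add: cutoff_def)
  show "cutoff_limit \<theta> cl cr \<in> borel_measurable borel"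
    unfolding cutoff_limit_def[abs_def] by measurable
qed

lemma cutoff_derivative_support:
  assumes \<theta>: "cutoff \<theta> \<theta>' cl cr" and x: "\<bar>x\<bar> > 1"
  shows "\<theta>' x = 0"
proof -
  define c where "c = (if x < 0 then cl else cr)"
  have "((\<lambda>_. c) has_real_derivative \<theta>' x) (at x)"
  proof (rule has_field_derivative_transform_within_open[of \<theta> _ _ "if x < 0 then {..<-1} else {1<..}"])
    show "(\<theta> has_real_derivative \<theta>' x) (at x)" using \<theta> by (simp add: cutoff_def)
  qed (use \<theta> x in \<open>auto simp: cutoff_def c_def split: if_splits\<close>)
  then show ?thesis
    using DERIV_const DERIV_unique by blast
qed

lemma cutoff_derivative_bound:
  assumes \<theta>: "cutoff \<theta> \<theta>' cl cr"
  obtains B where "B \<ge> 0" "\<And>x. \<bar>\<theta>' x\<bar> \<le> B * indicator {-1..1} x"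
proof -
  have "bounded (\<theta>' ` {-1..1})"
    using \<theta> unfolding cutoff_def
    by (intro compact_imp_bounded compact_continuous_image) (auto intro: continuous_on_subset)
  then obtain B where B: "\<And>x. x \<in> {-1..1} \<Longrightarrow> \<bar>\<theta>' x\<bar> \<le> B"
    unfolding bounded_iff by (metis imageI real_norm_def)
  have "0 \<le> B" using B[of 0] by simp
  moreover have "\<bar>\<theta>' x\<bar> \<le> B * indicator {-1..1} x" for x
    using B[of x] cutoff_derivative_support[OF \<theta>, of x] by (cases "x \<in> {-1..1}") (auto simp: abs_real_def)
  ultimately show thesis using that by blast
qed

lemma cutoff_tendsto:
  assumes \<theta>: "cutoff \<theta> \<theta>' cl cr"
  shows "(\<lambda>n. \<theta> (real (Suc n) * x)) \<longlonglongrightarrow> cutoff_limit \<theta> cl cr x"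
proof (cases "x = 0")
  case False
  obtain N where N: "1 / real (Suc N) < \<bar>x\<bar>"
    using False nat_approx_posE[of "\<bar>x\<bar>"] by auto
  have "\<forall>\<^sub>F n in sequentially. \<theta> (real (Suc n) * x) = cutoff_limit \<theta> cl cr x"
  proof (rule eventually_sequentiallyI[of N])
    fix n assume "N \<le> n"
    then have "1 / real (Suc n) \<le> 1 / real (Suc N)"
      by (intro divide_left_mono) auto
    with N have "1 / real (Suc n) < \<bar>x\<bar>" by linarith
    then have "1 < \<bar>x\<bar> * real (Suc n)"
      by (simp add: pos_divide_less_eq del: of_nat_Suc)
    then have "1 < \<bar>real (Suc n) * x\<bar>"
      by (simp add: abs_mult mult.commute del: of_nat_Suc)
    then show "\<theta> (real (Suc n) * x) = cutoff_limit \<theta> cl cr x"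
    proof (cases "x < 0")
      case True
      then have "real (Suc n) * x < 0" by (simp add: mult_less_0_iff del: of_nat_Suc)
      then have "real (Suc n) * x \<le> - 1" using \<open>1 < \<bar>real (Suc n) * x\<bar>\<close> by linarith
      then show ?thesis using \<theta> True unfolding cutoff_def cutoff_limit_def by simp
    next
      case nneg: False
      then have "0 < real (Suc n) * x" using False by (simp add: zero_less_mult_iff del: of_nat_Suc)
      then have "1 \<le> real (Suc n) * x" using \<open>1 < \<bar>real (Suc n) * x\<bar>\<close> by linarith
      then show ?thesis using \<theta> nneg False unfolding cutoff_def cutoff_limit_def by simp
    qed
  qed
  then show ?thesis by (rule tendsto_eventually)
qed (simp add: cutoff_limit_def)

text \<open>The map \<pi> reads off the space coordinate: \<open>snd\<close> in the plane and the
  identity on the initial line.\<close>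

lemma cutoff_integral_tendsto:
  fixes P \<pi> :: "'a::euclidean_space \<Rightarrow> real"
  assumes \<theta>: "cutoff \<theta> \<theta>' cl cr"
    and P[measurable]: "P \<in> borel_measurable borel"
    and bound: "\<And>p. \<bar>P p\<bar> \<le> C * indicator (cball 0 R) p"
    and \<pi>[measurable]: "\<pi> \<in> borel_measurable borel"
  shows "(\<lambda>n. LINT p|lborel. P p * \<theta> (real (Suc n) * \<pi> p))
    \<longlonglongrightarrow> (LINT p|lborel. P p * cutoff_limit \<theta> cl cr (\<pi> p))"
proof (rule integral_dominated_convergence)
  note [measurable] = cutoff_borel[OF \<theta>]
  show "integrable lborel (\<lambda>p. C * indicator (cball 0 R) p :: real)"
    by (intro integrable_mult_right integrable_real_indicator emeasure_compact_finite) auto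
  show "(\<lambda>p. P p * cutoff_limit \<theta> cl cr (\<pi> p)) \<in> borel_measurable lborel"
    "\<And>n. (\<lambda>p. P p * \<theta> (real (Suc n) * \<pi> p)) \<in> borel_measurable lborel"
    by measurable
  show "AE p in lborel. (\<lambda>n. P p * \<theta> (real (Suc n) * \<pi> p)) \<longlonglongrightarrow> P p * cutoff_limit \<theta> cl cr (\<pi> p)"
    by (intro AE_I2 tendsto_mult tendsto_const cutoff_tendsto[OF \<theta>])
  fix n
  have "\<bar>P p * \<theta> y\<bar> \<le> C * indicator (cball 0 R) p" for p y
  proof -
    have "\<bar>\<theta> y\<bar> \<le> 1"
      using \<theta> unfolding cutoff_def abs_le_iff by (smt (verit))
    then have "\<bar>P p * \<theta> y\<bar> \<le> \<bar>P p\<bar> * 1"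
      unfolding abs_mult by (intro mult_left_mono) auto
    then show ?thesis using bound[of p] by simp
  qed
  then show "AE p in lborel. norm (P p * \<theta> (real (Suc n) * \<pi> p)) \<le> C * indicator (cball 0 R) p"
    by simp
qed

lemma cutoff_derivative_integral:
  assumes \<theta>: "cutoff \<theta> \<theta>' cl cr"
  shows "(LINT x|lborel. (if x < 0 then ql else qr) * \<theta>' x) = ql * (\<theta> 0 - cl) + qr * (cr - \<theta> 0)"
proof -
  have der: "(\<theta> has_real_derivative \<theta>' x) (at x)" "isCont \<theta>' x" for x
    using \<theta> by (auto simp: cutoff_def continuous_on_eq_continuous_at)
  have "has_bochner_integral lborel (\<lambda>x. \<theta>' x * indicator {-1..0} x) (\<theta> 0 - \<theta> (-1))"
    "has_bochner_integral lborel (\<lambda>x. \<theta>' x * indicator {0..1} x) (\<theta> 1 - \<theta> 0)"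
    by (rule has_bochner_integral_FTC_Icc_real; use der in simp)+
  then have "has_bochner_integral lborel
      (\<lambda>x. ql * (\<theta>' x * indicator {-1..0} x) + qr * (\<theta>' x * indicator {0..1} x))
      (ql * (\<theta> 0 - \<theta> (-1)) + qr * (\<theta> 1 - \<theta> 0))"
    by (intro has_bochner_integral_add has_bochner_integral_mult_right) auto
  moreover have "AE x in lborel. (if x < 0 then ql else qr) * \<theta>' x =
      ql * (\<theta>' x * indicator {-1..0} x) + qr * (\<theta>' x * indicator {0..1} x)"
    using AE_lborel_singleton[of 0]
  proof eventually_elim
    case (elim x)
    then show ?case
      using cutoff_derivative_support[OF \<theta>, of x] by (cases "\<bar>x\<bar> > 1") (auto simp: indicator_def)
  qed
  moreover have "(\<lambda>x. (if x < 0 then ql else qr) * \<theta>' x) \<in> borel_measurable lborel"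
    using cutoff_borel[OF \<theta>] by measurable
  moreover have "(\<lambda>x. ql * (\<theta>' x * indicator {-1..0} x) + qr * (\<theta>' x * indicator {0..1} x)) \<in> borel_measurable lborel"
    using cutoff_borel[OF \<theta>] by measurable
  ultimately show ?thesis
    using \<theta> by (subst integral_cong_AE) (auto simp: has_bochner_integral_iff cutoff_def)
qed

text \<open>The functions k \<theta>'(k x) concentrate at the junction. Substituting y = k x moves
  the scaling into q(y / k), which tends to the one-sided essential limits of q for almost every y
  while \<theta>' stays supported in [-1, 1]. The bound uniform in n serves dominated convergence in
  time.\<close>

lemma cutoff_derivative_tendsto:
  fixes q :: "real \<Rightarrow> real"
  assumes \<theta>: "cutoff \<theta> \<theta>' cl cr"
    and q[measurable]: "q \<in> borel_measurable borel" and bound: "\<And>x. \<bar>q x\<bar> \<le> C"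
    and left: "\<And>\<epsilon>. \<epsilon> > 0 \<Longrightarrow> \<exists>\<delta>>0. AE x in lborel. - \<delta> < x \<and> x < 0 \<longrightarrow> \<bar>q x - ql\<bar> < \<epsilon>"
    and right: "\<And>\<epsilon>. \<epsilon> > 0 \<Longrightarrow> \<exists>\<delta>>0. AE x in lborel. 0 < x \<and> x < \<delta> \<longrightarrow> \<bar>q x - qr\<bar> < \<epsilon>"
  shows "(\<lambda>n. LINT x|lborel. q x * (real (Suc n) * \<theta>' (real (Suc n) * x)))
    \<longlonglongrightarrow> ql * (\<theta> 0 - cl) + qr * (cr - \<theta> 0)"
    and "\<And>n B. (\<And>x. \<bar>\<theta>' x\<bar> \<le> B * indicator {-1..1} x) \<Longrightarrow>
      \<bar>LINT x|lborel. q x * (real (Suc n) * \<theta>' (real (Suc n) * x))\<bar> \<le> 2 * C * B"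
proof -
  note [measurable] = cutoff_borel[OF \<theta>]
  obtain B where B: "B \<ge> 0" "\<And>x. \<bar>\<theta>' x\<bar> \<le> B * indicator {-1..1} x"
    using cutoff_derivative_bound[OF \<theta>] by blast
  have "0 \<le> C" using bound[of 0] by simp
  have affine: "(LINT x|lborel. q x * (real (Suc n) * \<theta>' (real (Suc n) * x)))
      = (LINT y|lborel. q (y / real (Suc n)) * \<theta>' y)" for n
    by (subst (2) lborel_integral_real_affine[where c = "real (Suc n)" and t = 0])
      (simp_all add: mult_ac del: of_nat_Suc flip: integral_mult_right_zero)
  have dom: "\<bar>q z * \<theta>' y\<bar> \<le> C * B' * indicator {-1..1} y"
    if "\<And>x. \<bar>\<theta>' x\<bar> \<le> B' * indicator {-1..1} x" for y z B'
    using mult_mono[OF bound that, of y z] \<open>0 \<le> C\<close> by (simp add: abs_mult mult.assoc)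
  have dom_int: "integrable lborel (\<lambda>y::real. D * indicator {-1..1} y)" for D :: real
    by (intro integrable_mult_right integrable_real_indicator) auto
  show "\<bar>LINT x|lborel. q x * (real (Suc n) * \<theta>' (real (Suc n) * x))\<bar> \<le> 2 * C * B'"
    if B': "\<And>x. \<bar>\<theta>' x\<bar> \<le> B' * indicator {-1..1} x" for n B'
  proof -
    have "integrable lborel (\<lambda>y. q (y / real (Suc n)) * \<theta>' y)"
      by (rule Bochner_Integration.integrable_bound[OF dom_int[of "C * B'"]])
        (use dom[OF B'] in \<open>auto intro!: AE_I2 intro: order_trans[OF _ abs_ge_self]\<close>)
    then have "\<bar>LINT y|lborel. q (y / real (Suc n)) * \<theta>' y\<bar> \<le> (LINT y|lborel. C * B' * indicator {-1..1::real} y)"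
      using Bochner_Integration.integral_norm_bound_integral[OF _ dom_int[of "C * B'"], of "\<lambda>y. q (y / real (Suc n)) * \<theta>' y"]
        dom[OF B'] by simp
    then show ?thesis unfolding affine by simp
  qed
  \<comment> \<open>Dilations preserve null sets, and countably many of them are handled at
    once.\<close>
  have scaled: "AE y in lborel. \<forall>n. P (y / real (Suc n))"
    if P: "AE x in lborel. P x" and [measurable]: "Measurable.pred borel P" for P
    unfolding AE_all_countable
  proof
    fix n show "AE y in lborel. P (y / real (Suc n))"
      using AE_borel_affine[of "1 / real (Suc n)" P 0] P by simp
  qed
  \<comment> \<open>The exceptional null set depends on the tolerance, so tolerances are restricted
    to the countable family 1 / (m + 1).\<close>
  have "AE y in lborel. \<forall>m. \<exists>N. \<forall>n\<ge>N. \<bar>q (y / real (Suc n)) - (if y < 0 then ql else qr)\<bar> < 1 / real (Suc m)"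
    unfolding AE_all_countable
  proof
    fix m
    obtain d1 where d1: "d1 > 0" "AE x in lborel. - d1 < x \<and> x < 0 \<longrightarrow> \<bar>q x - ql\<bar> < 1 / real (Suc m)"
      using left[of "1 / real (Suc m)"] by auto
    obtain d2 where d2: "d2 > 0" "AE x in lborel. 0 < x \<and> x < d2 \<longrightarrow> \<bar>q x - qr\<bar> < 1 / real (Suc m)"
      using right[of "1 / real (Suc m)"] by auto
    have "AE y in lborel. \<forall>n. - d1 < y / real (Suc n) \<and> y / real (Suc n) < 0 \<longrightarrow>
        \<bar>q (y / real (Suc n)) - ql\<bar> < 1 / real (Suc m)"
      by (rule scaled[OF d1(2)]) measurable
    moreover have "AE y in lborel. \<forall>n. 0 < y / real (Suc n) \<and> y / real (Suc n) < d2 \<longrightarrow>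
        \<bar>q (y / real (Suc n)) - qr\<bar> < 1 / real (Suc m)"
      by (rule scaled[OF d2(2)]) measurable
    moreover have "AE y in lborel. y \<noteq> (0::real)"
      by (rule AE_lborel_singleton)
    ultimately show "AE y in lborel. \<exists>N. \<forall>n\<ge>N.
        \<bar>q (y / real (Suc n)) - (if y < 0 then ql else qr)\<bar> < 1 / real (Suc m)"
    proof eventually_elim
      case (elim y)
      have "(\<lambda>n. \<bar>y\<bar> * inverse (real (Suc n))) \<longlonglongrightarrow> \<bar>y\<bar> * 0"
        by (intro tendsto_intros LIMSEQ_inverse_real_of_nat)
      then have "(\<lambda>n. \<bar>y\<bar> / real (Suc n)) \<longlonglongrightarrow> 0"
        by (simp add: divide_inverse)
      then have "\<forall>\<^sub>F n in sequentially. \<bar>y\<bar> / real (Suc n) < min d1 d2"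
        using d1(1) d2(1) by (intro order_tendstoD(2)) auto
      then obtain N where N: "\<And>n. n \<ge> N \<Longrightarrow> \<bar>y\<bar> / real (Suc n) < min d1 d2"
        by (auto simp: eventually_sequentially)
      have "\<bar>q (y / real (Suc n)) - (if y < 0 then ql else qr)\<bar> < 1 / real (Suc m)" if "n \<ge> N" for n
      proof (cases "y < 0")
        case True
        then have "y / real (Suc n) < 0" by (simp add: divide_neg_pos)
        moreover have "- d1 < y / real (Suc n)"
          using N[OF that] True by simp
        ultimately show ?thesis using elim(1) True by auto
      next
        case False
        then have "0 < y / real (Suc n)" using elim(3) by simp
        moreover have "y / real (Suc n) < d2"
          using N[OF that] False by simp
        ultimately show ?thesis using elim(2) False by auto
      qed
      then show ?case by blast
    qed
  qed
  then have lim: "AE y in lborel. (\<lambda>n. q (y / real (Suc n)) * \<theta>' y) \<longlonglongrightarrow> (if y < 0 then ql else qr) * \<theta>' y"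
  proof eventually_elim
    case (elim y)
    have "(\<lambda>n. q (y / real (Suc n))) \<longlonglongrightarrow> (if y < 0 then ql else qr)"
    proof (rule LIMSEQ_I)
      fix e :: real assume "e > 0"
      then obtain m where m: "1 / real (Suc m) < e"
        using nat_approx_posE by blast
      obtain N where "\<forall>n\<ge>N. \<bar>q (y / real (Suc n)) - (if y < 0 then ql else qr)\<bar> < 1 / real (Suc m)"
        using elim by blast
      then show "\<exists>no. \<forall>n\<ge>no. norm (q (y / real (Suc n)) - (if y < 0 then ql else qr)) < e"
        using m by (intro exI[of _ N]) (auto intro: order_less_trans)
    qed
    then show ?case by (intro tendsto_mult tendsto_const)
  qed
  have "(\<lambda>n. LINT y|lborel. q (y / real (Suc n)) * \<theta>' y) \<longlonglongrightarrow> (LINT y|lborel. (if y < 0 then ql else qr) * \<theta>' y)"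
  proof (rule integral_dominated_convergence[OF _ _ dom_int[of "C * B"] lim])
    show "AE y in lborel. norm (q (y / real (Suc n)) * \<theta>' y) \<le> C * B * indicator {-1..1} y" for n
      using dom[OF B(2)] by simp
  qed measurable
  then show "(\<lambda>n. LINT x|lborel. q x * (real (Suc n) * \<theta>' (real (Suc n) * x)))
    \<longlonglongrightarrow> ql * (\<theta> 0 - cl) + qr * (cr - \<theta> 0)"
    unfolding affine cutoff_derivative_integral[OF \<theta>] .
qed

lemma test_function_cutoff:
  assumes \<phi>: "test_function \<phi> \<phi>t \<phi>x" and \<theta>: "cutoff \<theta> \<theta>' cl cr"
  shows "test_function (\<lambda>p. \<phi> p * \<theta> (k * snd p)) (\<lambda>p. \<phi>t p * \<theta> (k * snd p))
    (\<lambda>p. \<phi>x p * \<theta> (k * snd p) + \<phi> p * (k * \<theta>' (k * snd p)))"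
  unfolding test_function_def
proof (intro conjI allI)
  have c\<phi>: "continuous_on UNIV \<phi>"
    using \<phi> unfolding test_function_def by (meson has_derivative_continuous continuous_at_imp_continuous_on)
  show "0 \<le> \<phi> p * \<theta> (k * snd p)" for p
    using \<phi> \<theta> unfolding test_function_def cutoff_def by (blast intro: mult_nonneg_nonneg)
  show "bounded {p. \<phi> p * \<theta> (k * snd p) \<noteq> 0}"
    using \<phi> unfolding test_function_def by (elim conjE) (rule bounded_subset, auto)
  show "((\<lambda>p. \<phi> p * \<theta> (k * snd p)) has_derivative
      (\<lambda>(s, y). \<phi>t p * \<theta> (k * snd p) * s + (\<phi>x p * \<theta> (k * snd p) + \<phi> p * (k * \<theta>' (k * snd p))) * y)) (at p)" for p
  proof -
    have 1: "(\<phi> has_derivative (\<lambda>(s, y). \<phi>t p * s + \<phi>x p * y)) (at p)"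
      using \<phi> unfolding test_function_def by blast
    have "(\<theta> has_derivative (*) (\<theta>' (k * snd p))) (at (k * snd p))"
      using \<theta> by (simp add: cutoff_def has_field_derivative_def)
    then have 2: "((\<lambda>p. \<theta> (k * snd p)) has_derivative (\<lambda>q. \<theta>' (k * snd p) * (k * snd q))) (at p)"
      by (rule has_derivative_compose[rotated]) (auto intro!: derivative_eq_intros)
    show ?thesis
      by (rule has_derivative_eq_rhs[OF has_derivative_mult[OF 1 2]])
        (auto simp: algebra_simps fun_eq_iff)
  qed
  have c\<theta>: "continuous_on UNIV (\<lambda>p::real \<times> real. \<theta> (k * snd p))"
    by (rule continuous_on_compose2[OF cutoff_continuous[OF \<theta>, of UNIV]]) (auto intro!: continuous_intros)
  have c\<theta>': "continuous_on UNIV (\<lambda>p::real \<times> real. \<theta>' (k * snd p))"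
    by (rule continuous_on_compose2[of UNIV \<theta>'])
      (use \<theta> in \<open>auto intro!: continuous_intros simp: cutoff_def\<close>)
  show "continuous_on UNIV (\<lambda>p. \<phi>t p * \<theta> (k * snd p))"
    "continuous_on UNIV (\<lambda>p. \<phi>x p * \<theta> (k * snd p) + \<phi> p * (k * \<theta>' (k * snd p)))"
    using \<phi> c\<phi> c\<theta> c\<theta>' unfolding test_function_def by (auto intro!: continuous_intros)
qed

lemma test_function_bound:
  assumes \<phi>: "test_function \<phi> \<phi>t \<phi>x"
  obtains C R where "R > 0" "\<And>p. \<bar>\<phi> p\<bar> \<le> C * indicator (cball 0 R) p"
    "\<And>p. \<bar>\<phi>t p\<bar> \<le> C * indicator (cball 0 R) p" "\<And>p. \<bar>\<phi>x p\<bar> \<le> C * indicator (cball 0 R) p"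
proof -
  obtain R where R: "R > 0" "\<And>p. \<phi> p \<noteq> 0 \<Longrightarrow> norm p \<le> R"
    using \<phi> unfolding test_function_def bounded_pos by auto
  have c: "continuous_on UNIV \<phi>" "continuous_on UNIV \<phi>t" "continuous_on UNIV \<phi>x"
    using \<phi> unfolding test_function_def by (meson has_derivative_continuous continuous_at_imp_continuous_on)+
  \<comment> \<open>Outside the closed ball \<phi> is zero on an open set, so its derivative
    vanishes there too.\<close>
  have zero: "\<phi>t p = 0 \<and> \<phi>x p = 0" if "p \<notin> cball 0 R" for p
  proof -
    have "((\<lambda>_. 0) has_derivative (\<lambda>(s, y). \<phi>t p * s + \<phi>x p * y)) (at p)"
    proof (rule has_derivative_transform_within_open[of \<phi> _ _ _ "- cball 0 R"])
      show "(\<phi> has_derivative (\<lambda>(s, y). \<phi>t p * s + \<phi>x p * y)) (at p)"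
        using \<phi> unfolding test_function_def by blast
    qed (use that R(2) in \<open>fastforce simp: open_Compl\<close>)+
    from has_derivative_unique[OF this has_derivative_const]
    have "\<phi>t p * s + \<phi>x p * y = 0" for s y
      by (auto simp: fun_eq_iff)
    from this[of 1 0] this[of 0 1] show ?thesis by simp
  qed
  have "\<exists>C. \<forall>p. \<bar>\<psi> p\<bar> \<le> C * indicator (cball 0 R) p"
    if "continuous_on UNIV \<psi>" "\<And>p. p \<notin> cball 0 R \<Longrightarrow> \<psi> p = 0" for \<psi> :: "real \<times> real \<Rightarrow> real"
  proof -
    have "bounded (\<psi> ` cball 0 R)"
      by (intro compact_imp_bounded compact_continuous_image continuous_on_subset[OF that(1)]) auto
    then obtain C where "\<And>p. p \<in> cball 0 R \<Longrightarrow> \<bar>\<psi> p\<bar> \<le> C"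
      unfolding bounded_iff by (metis imageI real_norm_def)
    then show ?thesis
      using that(2) by (intro exI[of _ C]) (auto simp: indicator_def)
  qed
  from this[OF c(1)] this[OF c(2)] this[OF c(3)] zero R(2)
  obtain C1 C2 C3 where C: "\<And>p. \<bar>\<phi> p\<bar> \<le> C1 * indicator (cball 0 R) p"
    "\<And>p. \<bar>\<phi>t p\<bar> \<le> C2 * indicator (cball 0 R) p" "\<And>p. \<bar>\<phi>x p\<bar> \<le> C3 * indicator (cball 0 R) p"
    by (metis mem_cball_0)
  define C where "C = max C1 (max C2 C3)"
  have "c * indicator (cball 0 R) p \<le> C * indicator (cball 0 R) p" if "c \<le> C" for c and p :: "real \<times> real"
    using that by (intro mult_right_mono) auto
  then have "\<And>p. \<bar>\<phi> p\<bar> \<le> C * indicator (cball 0 R) p"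
    "\<And>p. \<bar>\<phi>t p\<bar> \<le> C * indicator (cball 0 R) p" "\<And>p. \<bar>\<phi>x p\<bar> \<le> C * indicator (cball 0 R) p"
    using C unfolding C_def by (meson order_trans max.cobounded1 max.cobounded2)+
  then show thesis
    using that[OF R(1)] by blast
qed

lemma AE_interval_ex:
  assumes "AE x in lborel. u < x \<and> x < (v::real) \<longrightarrow> P x" and "u < v"
  obtains x where "u < x" "x < v" "P x"
proof -
  have "\<exists>x. u < x \<and> x < v \<and> P x"
  proof (rule ccontr)
    assume "\<not> ?thesis"
    then have "AE x in lborel. x \<notin> {u<..<v}"
      using assms(1) by (auto elim!: eventually_mono)
    then have "{u<..<v} \<in> null_sets lborel"
      by (subst (asm) AE_iff_null_sets[symmetric]) auto
    then show False
      using assms(2) by (auto simp: null_sets_def)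
  qed
  then show thesis using that by blast
qed

text \<open>The family D stands for the one-sided neighbourhoods of 0, so that the left and the
  right trace share one proof.\<close>

lemma ess_limit_mult:
  fixes D :: "real \<Rightarrow> real set" and G \<psi> v :: "real \<Rightarrow> real"
  assumes D: "\<And>\<delta> x. x \<in> D \<delta> \<Longrightarrow> \<bar>x\<bar> < \<delta>" "\<And>\<delta> \<delta>'. \<delta> \<le> \<delta>' \<Longrightarrow> D \<delta> \<subseteq> D \<delta>'"
    and v: "\<And>\<epsilon>. \<epsilon> > 0 \<Longrightarrow> \<exists>\<delta>>0. AE x in lborel. x \<in> D \<delta> \<longrightarrow> \<bar>v x - l\<bar> < \<epsilon>"
    and G: "isCont G l" and \<psi>: "isCont \<psi> 0" and \<epsilon>: "\<epsilon> > 0"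
  shows "\<exists>\<delta>>0. AE x in lborel. x \<in> D \<delta> \<longrightarrow> \<bar>G (v x) * \<psi> x - G l * \<psi> 0\<bar> < \<epsilon>"
proof -
  have "isCont (\<lambda>p. G (fst p) * \<psi> (snd p)) (l, 0)"
    using G \<psi> by (intro continuous_intros isCont_o2[of _ fst G] isCont_o2[of _ snd \<psi>]) auto
  then obtain d where d: "d > 0" "\<And>p. dist p (l, 0) < d \<Longrightarrow> \<bar>G (fst p) * \<psi> (snd p) - G l * \<psi> 0\<bar> < \<epsilon>"
    using \<epsilon> unfolding continuous_at_eps_delta dist_real_def by auto
  obtain \<delta> where \<delta>: "\<delta> > 0" "AE x in lborel. x \<in> D \<delta> \<longrightarrow> \<bar>v x - l\<bar> < d / 2"
    using v[of "d / 2"] d(1) by auto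
  have "AE x in lborel. x \<in> D (min \<delta> (d / 2)) \<longrightarrow> \<bar>G (v x) * \<psi> x - G l * \<psi> 0\<bar> < \<epsilon>"
    using \<delta>(2)
  proof (eventually_elim, intro impI)
    fix x assume x: "x \<in> D \<delta> \<longrightarrow> \<bar>v x - l\<bar> < d / 2" "x \<in> D (min \<delta> (d / 2))"
    then have "\<bar>v x - l\<bar> < d / 2" "\<bar>x\<bar> < d / 2"
      using D(1)[OF x(2)] D(2)[of "min \<delta> (d / 2)" \<delta>] by auto
    moreover have "dist (v x, x) (l, 0) \<le> \<bar>v x - l\<bar> + \<bar>x\<bar>"
      by (simp add: dist_Pair_Pair dist_real_def sqrt_sum_squares_le_sum_abs)
    ultimately have "dist (v x, x) (l, 0) < d" by linarith
    from d(2)[OF this] show "\<bar>G (v x) * \<psi> x - G l * \<psi> 0\<bar> < \<epsilon>" by simp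
  qed
  then show ?thesis
    using \<delta>(1) d(1) by (intro exI[of _ "min \<delta> (d / 2)"]) auto
qed

lemma entropy_pair_continuous:
  assumes "entropy_pair f \<eta> G"
  shows "continuous_on S \<eta>" "continuous_on S G" "isCont \<eta> x" "isCont G x"
proof -
  have "\<exists>\<psi>. has_ae_derivative F \<psi>" if "F = \<eta> \<or> F = G" for F
    using assms that unfolding entropy_pair_def entropy_flux_def by blast
  then have "continuous_on S F" if "F = \<eta> \<or> F = G" for F S
    using has_ae_derivative_continuous that by blast
  from this[of \<eta> S] this[of G S] this[of \<eta> UNIV] this[of G UNIV]
  show "continuous_on S \<eta>" "continuous_on S G" "isCont \<eta> x" "isCont G x"
    by (simp_all add: continuous_on_eq_continuous_at)
qed

text \<open>
  The trace terms in the limit of the entropy inequality tested with \<open>\<phi>(t, x) \<theta>(k x)\<close>, \<open>k \<rightarrow> \<infinity>\<close>.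
\<close>
lemma weak_entropy_solution_cutoff:
  assumes weak: "weak_entropy_solution f {a..b} u0 \<rho>"
    and u0[measurable]: "u0 \<in> borel_measurable borel" and u0_K: "\<And>x. u0 x \<in> {a..b}"
    and l: "left_trace \<rho> l" and r: "right_trace \<rho> r"
    and pair: "entropy_pair f \<eta> G" and test: "test_function \<phi> \<phi>t \<phi>x"
    and \<theta>: "cutoff \<theta> \<theta>' cl cr"
  defines "X \<equiv> \<lambda>p. indicator ({0..} \<times> UNIV) p *
      (\<eta> (\<rho> (fst p) (snd p)) * \<phi>t p + G (\<rho> (fst p) (snd p)) * \<phi>x p) * cutoff_limit \<theta> cl cr (snd p)"
    and "Y \<equiv> \<lambda>x. \<eta> (u0 x) * \<phi> (0, x) * cutoff_limit \<theta> cl cr x"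
  shows "integrable lborel X" and "integrable lborel Y"
    and "0 \<le> integral\<^sup>L lborel X + integral\<^sup>L lborel Y +
      (G l * (\<theta> 0 - cl) + G r * (cr - \<theta> 0)) * (LINT t|lborel. indicator {0..} t * \<phi> (t, 0))"
proof -
  let ?S = "{0..} \<times> UNIV :: (real \<times> real) set"
  note [measurable] = cutoff_borel[OF \<theta>]
  obtain C R where R: "R > 0" and C: "\<And>p. \<bar>\<phi> p\<bar> \<le> C * indicator (cball 0 R) p"
    "\<And>p. \<bar>\<phi>t p\<bar> \<le> C * indicator (cball 0 R) p" "\<And>p. \<bar>\<phi>x p\<bar> \<le> C * indicator (cball 0 R) p"
    by (rule test_function_bound[OF test]) (rule that)
  have C0: "0 \<le> C"
    using C(1)[of 0] R by simp
  have \<phi>_cont: "continuous_on UNIV \<phi>"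
    using test unfolding test_function_def by (meson has_derivative_continuous continuous_at_imp_continuous_on)
  have [measurable]: "\<phi> \<in> borel_measurable borel" "\<phi>t \<in> borel_measurable borel" "\<phi>x \<in> borel_measurable borel"
    using test \<phi>_cont unfolding test_function_def by (auto intro: borel_measurable_continuous_onI)
  have [measurable]: "\<eta> \<in> borel_measurable borel" "G \<in> borel_measurable borel"
    using entropy_pair_continuous[OF pair] by (auto intro: borel_measurable_continuous_onI)
  have [measurable]: "(snd :: real \<times> real \<Rightarrow> real) \<in> borel_measurable borel"
    by (intro borel_measurable_continuous_onI continuous_intros)
  \<comment> \<open>The solution is controlled only for t \<ge> 0; continuing it by 0 makes it
    measurable on the whole plane, at the price that its values lie in the hull of
    \<open>{a..b}\<close> and 0.\<close>
  define v where "v p = indicator ?S p * \<rho> (fst p) (snd p)" for p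
  have [measurable]: "v \<in> borel_measurable borel"
    using weak unfolding weak_entropy_solution_def set_borel_measurable_def v_def[abs_def]
    by (simp add: case_prod_unfold)
  have S[measurable]: "?S \<in> sets borel"
    by (intro borel_closed closed_Times) auto
  have \<rho>_K: "\<rho> t x \<in> {a..b}" if "t \<ge> 0" for t x
    using weak that unfolding weak_entropy_solution_def by blast
  have v_K: "v p \<in> {min a 0..max b 0}" for p
    using \<rho>_K[of "fst p" "snd p"] by (cases "p \<in> ?S") (auto simp: v_def indicator_def)
  have "\<exists>M. \<forall>y\<in>{min a 0..max b 0}. \<bar>\<eta> y\<bar> \<le> M \<and> \<bar>G y\<bar> \<le> M"
  proof -
    have "bounded (\<eta> ` {min a 0..max b 0})" "bounded (G ` {min a 0..max b 0})"
      by (intro compact_imp_bounded compact_continuous_image entropy_pair_continuous[OF pair] compact_Icc)+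
    then obtain M1 M2 where "\<forall>y\<in>\<eta> ` {min a 0..max b 0}. \<bar>y\<bar> \<le> M1" "\<forall>y\<in>G ` {min a 0..max b 0}. \<bar>y\<bar> \<le> M2"
      unfolding bounded_iff real_norm_def by blast
    then show ?thesis
      by (intro exI[of _ "max M1 M2"]) (auto simp: le_max_iff_disj)
  qed
  then obtain M where M: "\<And>y. y \<in> {min a 0..max b 0} \<Longrightarrow> \<bar>\<eta> y\<bar> \<le> M"
    "\<And>y. y \<in> {min a 0..max b 0} \<Longrightarrow> \<bar>G y\<bar> \<le> M"
    by blast
  have M0: "0 \<le> M" using M(1)[of 0] by simp
  have prod_bound: "\<bar>y * z\<bar> \<le> M * C * indicator A p"
    if "\<bar>y\<bar> \<le> M" "\<bar>z\<bar> \<le> C * indicator A p" for y z :: real and A :: "'z set" and p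
    using mult_mono[OF that M0] by (simp add: abs_mult mult.assoc)
  \<comment> \<open>P is the interior term, Z the initial term, and Q the factor that meets the
    derivative of the cutoff.\<close>
  define P where "P p = indicator ?S p * (\<eta> (v p) * \<phi>t p + G (v p) * \<phi>x p)" for p
  define Q where "Q p = indicator ?S p * (G (v p) * \<phi> p)" for p
  define Z where "Z x = \<eta> (u0 x) * \<phi> (0, x)" for x
  have [measurable]: "P \<in> borel_measurable borel" "Q \<in> borel_measurable borel" "Z \<in> borel_measurable borel"
    unfolding P_def[abs_def] Q_def[abs_def] Z_def[abs_def] by measurable
  have P_bound: "\<bar>P p\<bar> \<le> 2 * (M * C) * indicator (cball 0 R) p" for p
  proof -
    have "\<bar>\<eta> (v p) * \<phi>t p + G (v p) * \<phi>x p\<bar> \<le> M * C * indicator (cball 0 R) p + M * C * indicator (cball 0 R) p"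
      by (intro order_trans[OF abs_triangle_ineq] add_mono prod_bound M v_K C)
    moreover have "\<bar>P p\<bar> \<le> \<bar>\<eta> (v p) * \<phi>t p + G (v p) * \<phi>x p\<bar>"
      by (simp add: P_def indicator_def)
    ultimately show ?thesis by linarith
  qed
  have Q_bound: "\<bar>Q p\<bar> \<le> M * C * indicator (cball 0 R) p" for p
  proof -
    have "\<bar>G (v p) * \<phi> p\<bar> \<le> M * C * indicator (cball 0 R) p"
      by (intro prod_bound M v_K C)
    moreover have "\<bar>Q p\<bar> \<le> \<bar>G (v p) * \<phi> p\<bar>"
      by (simp add: Q_def indicator_def)
    ultimately show ?thesis by simp
  qed
  have Z_bound: "\<bar>Z x\<bar> \<le> M * C * indicator (cball 0 R) x" for x
  proof -
    have "u0 x \<in> {min a 0..max b 0}"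
      using u0_K[of x] by auto
    moreover have "\<bar>\<phi> (0, x)\<bar> \<le> C * indicator (cball 0 R) x"
      using C(1)[of "(0, x)"] by (simp add: indicator_def norm_Pair)
    ultimately show ?thesis
      unfolding Z_def by (intro prod_bound M)
  qed
  have \<theta>_bound: "\<bar>\<theta> x\<bar> \<le> 1" for x
  proof -
    have "0 \<le> \<theta> x \<and> \<theta> x \<le> 1"
      using \<theta> unfolding cutoff_def by blast
    then show ?thesis by simp
  qed
  have lim_bound: "\<bar>cutoff_limit \<theta> cl cr x\<bar> \<le> 1" for x
  proof -
    have "cl = \<theta> (-1)" "cr = \<theta> 1"
      using \<theta> unfolding cutoff_def by (metis order_refl)+
    then show ?thesis
      by (simp add: cutoff_limit_def \<theta>_bound)
  qed
  have le1: "\<bar>y * z\<bar> \<le> A" if "\<bar>y\<bar> \<le> A" "\<bar>z\<bar> \<le> 1" for y z A :: real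
  proof -
    have "0 \<le> A" using that(1) by linarith
    then have "\<bar>y\<bar> * \<bar>z\<bar> \<le> A * 1"
      using that by (intro mult_mono) auto
    then show ?thesis by (simp add: abs_mult)
  qed
  have X_eq: "X = (\<lambda>p. P p * cutoff_limit \<theta> cl cr (snd p))"
    unfolding X_def P_def v_def by (auto simp: indicator_def fun_eq_iff)
  have Y_eq: "Y = (\<lambda>x. Z x * cutoff_limit \<theta> cl cr x)"
    unfolding Y_def Z_def ..
  show "integrable lborel X"
    unfolding X_eq by (rule integrable_bounded_support[OF _ le1[OF P_bound lim_bound]]) measurable
  show "integrable lborel Y"
    unfolding Y_eq by (rule integrable_bounded_support[OF _ le1[OF Z_bound lim_bound]]) measurable
  obtain B where B: "B \<ge> 0" "\<And>x. \<bar>\<theta>' x\<bar> \<le> B * indicator {-1..1} x"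
    using cutoff_derivative_bound[OF \<theta>] by blast
  have B3: "\<bar>\<theta>' x\<bar> \<le> B" for x
    by (rule order_trans[OF B(2)]) (use B(1) in \<open>simp add: indicator_def\<close>)
  \<comment> \<open>The extra term produced by differentiating \<theta>(k x) with k = n + 1; the
    traces come out of it.\<close>
  define Q' where "Q' n p = Q p * (real (Suc n) * \<theta>' (real (Suc n) * snd p))" for n p
  have Q'_meas[measurable]: "Q' n \<in> borel_measurable borel" for n
    unfolding Q'_def[abs_def] by measurable
  have Q'_int: "integrable lborel (Q' n)" for n
  proof (rule integrable_bounded_support)
    fix p :: "real \<times> real"
    have "\<bar>real (Suc n) * \<theta>' (real (Suc n) * snd p)\<bar> \<le> real (Suc n) * B"
      using B3 unfolding abs_mult by (intro mult_mono) auto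
    then have "\<bar>Q' n p\<bar> \<le> M * C * indicator (cball 0 R) p * (real (Suc n) * B)"
      unfolding Q'_def abs_mult[of "Q p"] using Q_bound[of p] M0 C0 by (intro mult_mono) auto
    then show "\<bar>Q' n p\<bar> \<le> M * C * (real (Suc n) * B) * indicator (cball 0 R) p"
      by (simp add: mult_ac)
  qed measurable
  have ineq: "0 \<le> (LINT p|lborel. P p * \<theta> (real (Suc n) * snd p)) + integral\<^sup>L lborel (Q' n)
      + (LINT x|lborel. Z x * \<theta> (real (Suc n) * x))" for n
  proof -
    let ?k = "real (Suc n)"
    have "0 \<le> (LINT p:?S|lborel. \<eta> (\<rho> (fst p) (snd p)) * (\<phi>t p * \<theta> (?k * snd p)) +
          G (\<rho> (fst p) (snd p)) * (\<phi>x p * \<theta> (?k * snd p) + \<phi> p * (?k * \<theta>' (?k * snd p))))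
        + (LINT x|lborel. \<eta> (u0 x) * (\<phi> (0, x) * \<theta> (?k * snd (0 :: real, x))))"
      using weak pair test_function_cutoff[OF test \<theta>, of ?k] unfolding weak_entropy_solution_def by blast
    also have "(LINT p:?S|lborel. \<eta> (\<rho> (fst p) (snd p)) * (\<phi>t p * \<theta> (?k * snd p)) +
          G (\<rho> (fst p) (snd p)) * (\<phi>x p * \<theta> (?k * snd p) + \<phi> p * (?k * \<theta>' (?k * snd p))))
        = (LINT p|lborel. P p * \<theta> (?k * snd p) + Q' n p)"
      unfolding set_lebesgue_integral_def
      by (intro Bochner_Integration.integral_cong refl)
        (simp add: P_def Q'_def Q_def v_def indicator_def algebra_simps del: of_nat_Suc)
    also have "\<dots> = (LINT p|lborel. P p * \<theta> (?k * snd p)) + integral\<^sup>L lborel (Q' n)"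
    proof (rule Bochner_Integration.integral_add[OF _ Q'_int])
      show "integrable lborel (\<lambda>p. P p * \<theta> (?k * snd p))"
        by (rule integrable_bounded_support[OF _ le1[OF P_bound \<theta>_bound]]) measurable
    qed
    finally show ?thesis
      by (simp add: Z_def mult.assoc)
  qed
  define c where "c = G l * (\<theta> 0 - cl) + G r * (cr - \<theta> 0)"
  have Q'_fst: "integral\<^sup>L lborel (Q' n) = (LINT t|lborel. LINT x|lborel. Q' n (t, x))"
    "integrable lborel (\<lambda>t. LINT x|lborel. Q' n (t, x))" for n
    using lborel_pair.integral_fst'[of "Q' n"] lborel_pair.integrable_fst'[of "Q' n"] Q'_int[of n]
    by (simp_all add: lborel_prod)
  \<comment> \<open>On almost every time slice the traces give Q(t, x) the one-sided limits
    \<open>G l * \<phi> (t, 0)\<close> and \<open>G r * \<phi> (t, 0)\<close> at the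
    junction.\<close>
  have tr: "AE t in lborel. t > 0 \<longrightarrow>
      (\<lambda>n. LINT x|lborel. Q' n (t, x)) \<longlonglongrightarrow> c * \<phi> (t, 0) \<and>
      (\<forall>n. \<bar>LINT x|lborel. Q' n (t, x)\<bar> \<le> 2 * (M * C) * B)"
    using l[unfolded left_trace_def] r[unfolded right_trace_def]
  proof (eventually_elim, intro impI)
    fix t :: real
    assume "t > 0 \<longrightarrow> (\<forall>\<epsilon>>0. \<exists>\<delta>>0. AE x in lborel. - \<delta> < x \<and> x < 0 \<longrightarrow> \<bar>\<rho> t x - l\<bar> < \<epsilon>)"
      and "t > 0 \<longrightarrow> (\<forall>\<epsilon>>0. \<exists>\<delta>>0. AE x in lborel. 0 < x \<and> x < \<delta> \<longrightarrow> \<bar>\<rho> t x - r\<bar> < \<epsilon>)"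
      and t: "t > 0"
    then have left: "\<exists>\<delta>>0. AE x in lborel. x \<in> {-\<delta><..<0} \<longrightarrow> \<bar>\<rho> t x - l\<bar> < \<epsilon>"
      and right: "\<exists>\<delta>>0. AE x in lborel. x \<in> {0<..<\<delta>} \<longrightarrow> \<bar>\<rho> t x - r\<bar> < \<epsilon>" if "\<epsilon> > 0" for \<epsilon>
      using that by simp_all
    have "continuous_on UNIV (\<lambda>x. \<phi> (t, x))"
      by (rule continuous_on_compose2[OF \<phi>_cont]) (auto intro!: continuous_intros)
    then have cont: "isCont (\<lambda>x. \<phi> (t, x)) 0"
      by (simp add: continuous_on_eq_continuous_at)
    have Q_eq: "Q (t, x) = G (\<rho> t x) * \<phi> (t, x)" for x
      using t by (simp add: Q_def v_def)
    have Qt[measurable]: "(\<lambda>x. Q (t, x)) \<in> borel_measurable borel"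
      by measurable
    have bound: "\<bar>Q (t, x)\<bar> \<le> M * C" for x
      by (rule order_trans[OF Q_bound]) (use M0 C0 in \<open>simp add: indicator_def\<close>)
    have ql: "\<exists>\<delta>>0. AE x in lborel. - \<delta> < x \<and> x < 0 \<longrightarrow> \<bar>Q (t, x) - G l * \<phi> (t, 0)\<bar> < \<epsilon>"
      if "\<epsilon> > 0" for \<epsilon>
    proof -
      have "\<exists>\<delta>>0. AE x in lborel. x \<in> {-\<delta><..<0} \<longrightarrow>
          \<bar>G (\<rho> t x) * \<phi> (t, x) - G l * \<phi> (t, 0)\<bar> < \<epsilon>"
        by (rule ess_limit_mult[where D = "\<lambda>\<delta>. {-\<delta><..<0}", OF _ _ left entropy_pair_continuous(4)[OF pair] cont that])
          auto
      then show ?thesis by (simp add: Q_eq)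
    qed
    have qr: "\<exists>\<delta>>0. AE x in lborel. 0 < x \<and> x < \<delta> \<longrightarrow> \<bar>Q (t, x) - G r * \<phi> (t, 0)\<bar> < \<epsilon>"
      if "\<epsilon> > 0" for \<epsilon>
    proof -
      have "\<exists>\<delta>>0. AE x in lborel. x \<in> {0<..<\<delta>} \<longrightarrow>
          \<bar>G (\<rho> t x) * \<phi> (t, x) - G r * \<phi> (t, 0)\<bar> < \<epsilon>"
        by (rule ess_limit_mult[where D = "\<lambda>\<delta>. {0<..<\<delta>}", OF _ _ right entropy_pair_continuous(4)[OF pair] cont that])
          auto
      then show ?thesis by (simp add: Q_eq)
    qed
    have "(\<lambda>n. LINT x|lborel. Q' n (t, x)) \<longlonglongrightarrow> G l * \<phi> (t, 0) * (\<theta> 0 - cl) + G r * \<phi> (t, 0) * (cr - \<theta> 0)"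
      using cutoff_derivative_tendsto(1)[OF \<theta> Qt bound ql qr] by (simp add: Q'_def)
    moreover have "\<bar>LINT x|lborel. Q' n (t, x)\<bar> \<le> 2 * (M * C) * B" for n
      using cutoff_derivative_tendsto(2)[OF \<theta> Qt bound ql qr B(2), of n] by (simp add: Q'_def)
    ultimately show "(\<lambda>n. LINT x|lborel. Q' n (t, x)) \<longlonglongrightarrow> c * \<phi> (t, 0) \<and>
      (\<forall>n. \<bar>LINT x|lborel. Q' n (t, x)\<bar> \<le> 2 * (M * C) * B)"
      by (simp add: c_def algebra_simps)
  qed
  have Q'_lim: "(\<lambda>n. integral\<^sup>L lborel (Q' n)) \<longlonglongrightarrow> (LINT t|lborel. indicator {0..} t * (c * \<phi> (t, 0)))"
    unfolding Q'_fst(1)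
  proof (rule integral_dominated_convergence[where w = "\<lambda>t. 2 * (M * C) * B * indicator (cball 0 R) t"])
    show "integrable lborel (\<lambda>t::real. 2 * (M * C) * B * indicator (cball 0 R) t)"
      by (intro integrable_mult_right integrable_real_indicator emeasure_compact_finite) auto
    show "(\<lambda>t. LINT x|lborel. Q' n (t, x)) \<in> borel_measurable lborel" for n
      using Q'_fst(2) by (rule borel_measurable_integrable)
    show "(\<lambda>t. indicator {0..} t * (c * \<phi> (t, 0))) \<in> borel_measurable lborel"
      by measurable
    \<comment> \<open>With the next fact this confines the slice integrals to a bounded time
      interval, so that a constant there dominates them.\<close>
    have neg: "Q' n (t, x) = 0" if "t < 0" for n t x
      using that by (simp add: Q'_def Q_def)
    have far: "Q' n (t, x) = 0" if "t \<notin> cball 0 R" for n t x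
    proof -
      have "R < norm (t, x)"
        using that norm_fst_le[of t x] by simp
      then show ?thesis
        using Q_bound[of "(t, x)"] by (simp add: Q'_def)
    qed
    show "AE t in lborel. (\<lambda>n. LINT x|lborel. Q' n (t, x)) \<longlonglongrightarrow> indicator {0..} t * (c * \<phi> (t, 0))"
      using tr AE_lborel_singleton[of 0]
    proof eventually_elim
      case (elim t)
      then show ?case
        by (cases "t < 0") (auto simp: neg indicator_def)
    qed
    show "AE t in lborel. norm (LINT x|lborel. Q' n (t, x)) \<le> 2 * (M * C) * B * indicator (cball 0 R) t" for n
      using tr AE_lborel_singleton[of 0]
    proof eventually_elim
      case (elim t)
      show ?case
      proof (cases "t < 0 \<or> t \<notin> cball 0 R")
        case True
        then have "(LINT x|lborel. Q' n (t, x)) = 0"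
          using neg far by auto
        then show ?thesis
          using M0 C0 B(1) by simp
      next
        case False
        then show ?thesis using elim by auto
      qed
    qed
  qed
  have "0 \<le> integral\<^sup>L lborel X + (LINT t|lborel. indicator {0..} t * (c * \<phi> (t, 0))) + integral\<^sup>L lborel Y"
  proof (rule LIMSEQ_le_const)
    show "(\<lambda>n. (LINT p|lborel. P p * \<theta> (real (Suc n) * snd p)) + integral\<^sup>L lborel (Q' n)
      + (LINT x|lborel. Z x * \<theta> (real (Suc n) * x)))
      \<longlonglongrightarrow> integral\<^sup>L lborel X + (LINT t|lborel. indicator {0..} t * (c * \<phi> (t, 0))) + integral\<^sup>L lborel Y"
      unfolding X_eq Y_eq
      by (intro tendsto_add Q'_lim cutoff_integral_tendsto[OF \<theta> _ P_bound] cutoff_integral_tendsto[OF \<theta> _ Z_bound]) measurable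
  qed (use ineq in blast)
  also have "(LINT t|lborel. indicator {0..} t * (c * \<phi> (t, 0))) = c * (LINT t|lborel. indicator {0..} t * \<phi> (t, 0))"
    by (simp add: mult.left_commute)
  finally show "0 \<le> integral\<^sup>L lborel X + integral\<^sup>L lborel Y +
      (G l * (\<theta> 0 - cl) + G r * (cr - \<theta> 0)) * (LINT t|lborel. indicator {0..} t * \<phi> (t, 0))"
    by (simp add: c_def)
qed

section \<open>Concrete cutoffs, made C^1 by squaring positive parts\<close>

lemma pos_part_square_derivative:
  "((\<lambda>u::real. (max 0 u)\<^sup>2) has_real_derivative 2 * max 0 u) (at u)"
proof -
  consider "u < 0" | "u > 0" | "u = 0" by linarith
  then show ?thesis
  proof cases
    case 1
    have "((\<lambda>u::real. (max 0 u)\<^sup>2) has_real_derivative 0) (at u)"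
      by (rule has_field_derivative_transform_within_open[of "\<lambda>_. 0" _ _ "{..<0}"]) (use 1 in auto)
    with 1 show ?thesis by simp
  next
    case 2
    have "((\<lambda>u::real. (max 0 u)\<^sup>2) has_real_derivative 2 * u) (at u)"
      by (rule has_field_derivative_transform_within_open[of "\<lambda>u. u\<^sup>2" _ _ "{0<..}"])
        (use 2 in \<open>auto intro!: derivative_eq_intros\<close>)
    with 2 show ?thesis by simp
  next
    case 3
    have "((\<lambda>y::real. (max 0 y)\<^sup>2 / y) \<longlongrightarrow> 0) (at 0)"
    proof (rule Lim_null_comparison)
      show "\<forall>\<^sub>F y in at 0. norm ((max 0 y)\<^sup>2 / y) \<le> \<bar>y\<bar>"
        by (intro always_eventually allI) (simp add: max_def power2_eq_square)
      show "((\<lambda>y::real. \<bar>y\<bar>) \<longlongrightarrow> 0) (at 0)"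
        by (rule tendsto_rabs_zero) (rule tendsto_ident_at)
    qed
    with 3 show ?thesis by (simp add: has_field_derivative_iff)
  qed
qed

lemmas pos_part_square_DERIV [derivative_intros] =
  DERIV_chain2[OF pos_part_square_derivative]

lemma pos_part_square_le_1: "y \<le> 1 \<Longrightarrow> (max 0 y)\<^sup>2 \<le> (1::real)"
  by (intro power_le_one) auto

text \<open>The profile rises from 0 to 1 on [0, 1]. Since \<theta>(0) = 0, the left trace gets
  weight 0 and the right trace weight 1; the reflected profile gives the left trace weight -1 and
  the right one 0.\<close>

lemma cutoff_right:
  "cutoff (\<lambda>x. 1 - (max 0 (1 - (max 0 x)\<^sup>2))\<^sup>2) (\<lambda>x. 2 * max 0 (1 - (max 0 x)\<^sup>2) * (2 * max 0 x)) 0 1"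
  unfolding cutoff_def
proof (intro conjI allI impI)
  fix x :: real
  show "((\<lambda>x. 1 - (max 0 (1 - (max 0 x)\<^sup>2))\<^sup>2) has_real_derivative 2 * max 0 (1 - (max 0 x)\<^sup>2) * (2 * max 0 x)) (at x)"
    by (auto intro!: derivative_eq_intros)
  show "0 \<le> 1 - (max 0 (1 - (max 0 x)\<^sup>2))\<^sup>2"
    using pos_part_square_le_1[of "1 - (max 0 x)\<^sup>2"] by simp
  show "1 - (max 0 (1 - (max 0 x)\<^sup>2))\<^sup>2 \<le> 1" by simp
  show "1 - (max 0 (1 - (max 0 x)\<^sup>2))\<^sup>2 = 0" if "x \<le> -1"
    using that by simp
  show "1 - (max 0 (1 - (max 0 x)\<^sup>2))\<^sup>2 = 1" if "1 \<le> x"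
    using that one_le_power[of x 2] by simp
qed (auto intro!: continuous_intros)

lemma cutoff_reflect:
  assumes "cutoff \<theta> \<theta>' cl cr"
  shows "cutoff (\<lambda>x. \<theta> (- x)) (\<lambda>x. - \<theta>' (- x)) cr cl"
  unfolding cutoff_def
proof (intro conjI allI impI)
  fix x :: real
  have "(\<theta> has_real_derivative \<theta>' (- x)) (at (- x))"
    using assms by (simp add: cutoff_def)
  then show "((\<lambda>x. \<theta> (- x)) has_real_derivative - \<theta>' (- x)) (at x)"
    by (simp add: DERIV_mirror)
  show "0 \<le> \<theta> (- x)" "\<theta> (- x) \<le> 1"
    using assms by (simp_all add: cutoff_def)
  show "\<theta> (- x) = cr" if "x \<le> - 1" using assms that by (simp add: cutoff_def)
  show "\<theta> (- x) = cl" if "1 \<le> x" using assms that by (simp add: cutoff_def)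
next
  have "continuous_on UNIV \<theta>'"
    using assms by (simp add: cutoff_def)
  then have "continuous_on UNIV (\<lambda>x. \<theta>' (- x))"
    by (rule continuous_on_compose2) (auto intro: continuous_on_minus continuous_on_id)
  then show "continuous_on UNIV (\<lambda>x. - \<theta>' (- x))"
    by (rule continuous_on_minus)
qed

text \<open>A C^1 profile with value 1 at 0 and limits 0 on both sides: as a cutoff it isolates the
  jump G l - G r, and as a factor in each variable it supplies a concrete test function.\<close>

definition bump :: "real \<Rightarrow> real" where "bump x = (max 0 (1 - x\<^sup>2))\<^sup>2"
definition bump' :: "real \<Rightarrow> real" where "bump' x = - 4 * x * max 0 (1 - x\<^sup>2)"

lemma cutoff_bump: "cutoff bump bump' 0 0"
  unfolding cutoff_def
proof (intro conjI allI impI)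
  fix x :: real
  show "(bump has_real_derivative bump' x) (at x)"
    unfolding bump_def[abs_def] bump'_def by (auto intro!: derivative_eq_intros)
  show "0 \<le> bump x" "bump x \<le> 1"
    unfolding bump_def by (auto intro!: pos_part_square_le_1)
  show "bump x = 0" if "x \<le> - 1"
    using that one_le_power[of "- x" 2] by (simp add: bump_def)
  show "bump x = 0" if "1 \<le> x"
    using that one_le_power[of x 2] by (simp add: bump_def)
next
  show "continuous_on UNIV bump'"
    unfolding bump'_def[abs_def] by (intro continuous_intros)
qed

lemma test_function_bump:
  "test_function (\<lambda>p. bump (fst p) * bump (snd p)) (\<lambda>p. bump' (fst p) * bump (snd p))
    (\<lambda>p. bump (fst p) * bump' (snd p))"
  unfolding test_function_def
proof (intro conjI allI)
  have der: "(bump has_real_derivative bump' x) (at x)" for x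
    using cutoff_bump by (simp add: cutoff_def)
  have zero: "bump x = 0" if "\<bar>x\<bar> > 1" for x
    using that cutoff_bump by (cases "x > 0") (auto simp: cutoff_def)
  show "0 \<le> bump (fst p) * bump (snd p)" for p :: "real \<times> real"
    by (simp add: bump_def)
  have "{p :: real \<times> real. bump (fst p) * bump (snd p) \<noteq> 0} \<subseteq> {-1..1} \<times> {-1..1}"
    using zero by (force simp: abs_le_iff not_less)
  then show "bounded {p :: real \<times> real. bump (fst p) * bump (snd p) \<noteq> 0}"
    by (rule bounded_subset[rotated]) (intro bounded_Times bounded_closed_interval)
  show "((\<lambda>p. bump (fst p) * bump (snd p)) has_derivative
      (\<lambda>(s, y). bump' (fst p) * bump (snd p) * s + bump (fst p) * bump' (snd p) * y)) (at p)" for p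
  proof -
    have 1: "((\<lambda>p::real \<times> real. bump (fst p)) has_derivative (\<lambda>q. bump' (fst p) * fst q)) (at p)"
      by (rule has_derivative_compose[OF _ der[unfolded has_field_derivative_def], of fst])
        (auto intro!: derivative_eq_intros)
    have 2: "((\<lambda>p::real \<times> real. bump (snd p)) has_derivative (\<lambda>q. bump' (snd p) * snd q)) (at p)"
      by (rule has_derivative_compose[OF _ der[unfolded has_field_derivative_def], of snd])
        (auto intro!: derivative_eq_intros)
    show ?thesis
      by (rule has_derivative_eq_rhs[OF has_derivative_mult[OF 1 2]]) (auto simp: algebra_simps fun_eq_iff)
  qed
  have c: "continuous_on UNIV bump" "continuous_on UNIV bump'"
    using cutoff_continuous[OF cutoff_bump] cutoff_bump by (simp_all add: cutoff_def)
  show "continuous_on UNIV (\<lambda>p::real \<times> real. bump' (fst p) * bump (snd p))"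
    "continuous_on UNIV (\<lambda>p::real \<times> real. bump (fst p) * bump' (snd p))"
    by (intro continuous_intros continuous_on_compose2[OF c(1)] continuous_on_compose2[OF c(2)]; simp)+
qed

text \<open>The weight in front of the jump, equal to 8/15; its positivity lets the jump inequality
  be divided by it.\<close>

lemma bump_integral_pos: "0 < (LINT t|lborel. indicator {0..} t * (bump (fst (t, 0::real)) * bump (snd (t, 0))))"
proof -
  have "indicator {0..} t * (bump (fst (t, 0::real)) * bump (snd (t, 0))) = (1 - t\<^sup>2)\<^sup>2 * indicator {0..1} t" for t
  proof -
    consider "t < 0" | "0 \<le> t" "t \<le> 1" | "t > 1" by linarith
    then show ?thesis
    proof cases
      case 2
      then have "t\<^sup>2 \<le> 1" by (simp add: power_le_one)
      with 2 show ?thesis by (simp add: bump_def)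
    next
      case 3
      then have "1 \<le> t\<^sup>2" by (simp add: one_le_power)
      with 3 show ?thesis by (simp add: bump_def)
    qed simp
  qed
  moreover have "(LINT t|lborel. (1 - t\<^sup>2)\<^sup>2 * indicator {0..1} t) = (1 - 2 / 3 + 1 / 5) - (0::real)"
  proof -
    have "((\<lambda>t. t - 2 / 3 * t ^ 3 + t ^ 5 / 5) has_real_derivative (1 - t\<^sup>2)\<^sup>2) (at t)" for t :: real
      by (auto intro!: derivative_eq_intros simp: power2_eq_square algebra_simps eval_nat_numeral)
    from integral_FTC_Icc_real[of 0 1 "\<lambda>t::real. t - 2 / 3 * t ^ 3 + t ^ 5 / 5", OF _ this]
    show ?thesis by simp
  qed
  ultimately show ?thesis by simp
qed

section \<open>Jump inequality and Rankine-Hugoniot condition at the junction\<close>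

lemma AE_snd_nonzero: "AE p in (lborel :: (real \<times> real) measure). snd p \<noteq> 0"
proof -
  have "(0, 1) \<in> (Basis :: (real \<times> real) set)"
    by (simp add: Basis_prod_def)
  from AE_lborel_inner_neq[OF this, of 0] show ?thesis
    by (simp add: inner_prod_def)
qed

text \<open>The rescaled bump shrinks to the line x = 0, a null set, so the interior and initial
  terms disappear in the limit and only the jump of the entropy flux remains.\<close>

lemma weak_entropy_solution_traces:
  assumes weak: "weak_entropy_solution f {a..b} u0 \<rho>"
    and u0: "u0 \<in> borel_measurable borel" "\<And>x. u0 x \<in> {a..b}"
    and l: "left_trace \<rho> l" and r: "right_trace \<rho> r"
  shows "entropy_pair f \<eta> G \<Longrightarrow> G r \<le> G l"
    and "has_ae_derivative f f' \<Longrightarrow> f l = f r"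
proof -
  show ineq: "G r \<le> G l" if pair: "entropy_pair f \<eta> G" for \<eta> G
  proof -
    let ?I = "LINT t|lborel. indicator {0..} t * (bump (fst (t, 0::real)) * bump (snd (t, 0)))"
    let ?X = "\<lambda>p. indicator ({0..} \<times> UNIV) p * (\<eta> (\<rho> (fst p) (snd p)) * (bump' (fst p) * bump (snd p)) +
      G (\<rho> (fst p) (snd p)) * (bump (fst p) * bump' (snd p))) * cutoff_limit bump 0 0 (snd p)"
    let ?Y = "\<lambda>x. \<eta> (u0 x) * (bump (fst (0::real, x)) * bump (snd (0::real, x))) * cutoff_limit bump 0 0 x"
    note main = weak_entropy_solution_cutoff[OF weak u0 l r pair test_function_bump cutoff_bump]
    have "AE p in lborel. ?X p = 0"
      using AE_snd_nonzero by eventually_elim (simp add: cutoff_limit_def)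
    then have X: "integral\<^sup>L lborel ?X = 0"
      by (rule integral_eq_zero_AE)
    have "AE x in lborel. ?Y x = 0"
      using AE_lborel_singleton[of 0] by eventually_elim (simp add: cutoff_limit_def)
    then have Y: "integral\<^sup>L lborel ?Y = 0"
      by (rule integral_eq_zero_AE)
    have "bump 0 = 1" by (simp add: bump_def)
    then have "0 \<le> (G l - G r) * ?I"
      using main(3) unfolding X Y by simp
    then show ?thesis
      using bump_integral_pos by (simp add: zero_le_mult_iff)
  qed
  show "f l = f r" if f': "has_ae_derivative f f'"
  proof (rule antisym)
    \<comment> \<open>Linear entropies of both signs turn the jump inequality into equality of the
      fluxes.\<close>
    have lin: "entropy_pair f (\<lambda>t. c * t) (\<lambda>t. c * f t)" for c
      unfolding entropy_pair_def entropy_flux_def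
    proof (intro conjI exI)
      show "has_ae_derivative (\<lambda>t. c * t) (\<lambda>_. c)"
        using has_ae_derivative_linear[of c 0] by simp
      show "has_ae_derivative (\<lambda>t. c * f t) (\<lambda>t. c * f' t)"
        by (rule has_ae_derivative_cmult[OF f'])
      show "convex_on UNIV (\<lambda>t. c * t)"
        by (rule convex_on_UNIV_supportI) (rule exI[of _ c], simp add: algebra_simps)
    qed (rule f')
    show "f l \<le> f r" using ineq[OF lin[of "-1"]] by simp
    show "f r \<le> f l" using ineq[OF lin[of 1]] by simp
  qed
qed

text \<open>An essential limit is approached by actual values of the solution, and these lie in a
  closed interval.\<close>

lemma trace_in_closed_interval:
  assumes weak: "weak_entropy_solution f {a..b} u0 \<rho>"
  shows "left_trace \<rho> l \<Longrightarrow> l \<in> {a..b}" and "right_trace \<rho> r \<Longrightarrow> r \<in> {a..b}"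
proof -
  have K: "\<rho> t x \<in> {a..b}" if "t > 0" for t x
    using weak that unfolding weak_entropy_solution_def by (meson less_imp_le)
  have cl: "y \<in> {a..b}" if "\<And>\<epsilon>. \<epsilon> > 0 \<Longrightarrow> \<exists>z\<in>{a..b}. \<bar>z - y\<bar> < \<epsilon>" for y
    using closed_approachable[of "{a..b}" y] that by (auto simp: dist_real_def)
  show "l \<in> {a..b}" if l: "left_trace \<rho> l"
  proof (rule cl)
    fix \<epsilon> :: real assume "\<epsilon> > 0"
    have "AE t in lborel. 0 < t \<and> t < 1 \<longrightarrow>
        (\<forall>\<epsilon>>0. \<exists>\<delta>>0. AE x in lborel. - \<delta> < x \<and> x < 0 \<longrightarrow> \<bar>\<rho> t x - l\<bar> < \<epsilon>)"
      using l unfolding left_trace_def by eventually_elim simp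
    then obtain t where "0 < t" "\<forall>\<epsilon>>0. \<exists>\<delta>>0. AE x in lborel. - \<delta> < x \<and> x < 0 \<longrightarrow> \<bar>\<rho> t x - l\<bar> < \<epsilon>"
      by (rule AE_interval_ex) auto
    then obtain \<delta> where \<delta>: "\<delta> > 0" "AE x in lborel. - \<delta> < x \<and> x < 0 \<longrightarrow> \<bar>\<rho> t x - l\<bar> < \<epsilon>"
      using \<open>\<epsilon> > 0\<close> by blast
    obtain x where "\<bar>\<rho> t x - l\<bar> < \<epsilon>"
      by (rule AE_interval_ex[OF \<delta>(2)]) (use \<delta>(1) in auto)
    then show "\<exists>z\<in>{a..b}. \<bar>z - l\<bar> < \<epsilon>"
      using K[OF \<open>0 < t\<close>] by blast
  qed
  show "r \<in> {a..b}" if r: "right_trace \<rho> r"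
  proof (rule cl)
    fix \<epsilon> :: real assume "\<epsilon> > 0"
    have "AE t in lborel. 0 < t \<and> t < 1 \<longrightarrow>
        (\<forall>\<epsilon>>0. \<exists>\<delta>>0. AE x in lborel. 0 < x \<and> x < \<delta> \<longrightarrow> \<bar>\<rho> t x - r\<bar> < \<epsilon>)"
      using r unfolding right_trace_def by eventually_elim simp
    then obtain t where "0 < t" "\<forall>\<epsilon>>0. \<exists>\<delta>>0. AE x in lborel. 0 < x \<and> x < \<delta> \<longrightarrow> \<bar>\<rho> t x - r\<bar> < \<epsilon>"
      by (rule AE_interval_ex) auto
    then obtain \<delta> where \<delta>: "\<delta> > 0" "AE x in lborel. 0 < x \<and> x < \<delta> \<longrightarrow> \<bar>\<rho> t x - r\<bar> < \<epsilon>"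
      using \<open>\<epsilon> > 0\<close> by blast
    obtain x where "\<bar>\<rho> t x - r\<bar> < \<epsilon>"
      by (rule AE_interval_ex[OF \<delta>(2)]) (use \<delta>(1) in auto)
    then show "\<exists>z\<in>{a..b}. \<bar>z - r\<bar> < \<epsilon>"
      using K[OF \<open>0 < t\<close>] by blast
  qed
qed

section \<open>Constant states as weak entropy solutions\<close>

lemma test_function_integrals:
  assumes test: "test_function \<phi> \<phi>t \<phi>x"
  shows "integrable lborel (\<lambda>p. indicator ({0..} \<times> UNIV) p * \<phi>t p)"
    and "integrable lborel (\<lambda>p. indicator ({0..} \<times> UNIV) p * \<phi>x p)"
    and "(LINT p|lborel. indicator ({0..} \<times> UNIV) p * \<phi>t p) = - (LINT x|lborel. \<phi> (0, x))"
    and "(LINT p|lborel. indicator ({0..} \<times> UNIV) p * \<phi>x p) = 0"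
proof -
  let ?S = "{0..} \<times> UNIV :: (real \<times> real) set"
  obtain C R where R: "R > 0" and C: "\<And>p. \<bar>\<phi> p\<bar> \<le> C * indicator (cball 0 R) p"
    "\<And>p. \<bar>\<phi>t p\<bar> \<le> C * indicator (cball 0 R) p" "\<And>p. \<bar>\<phi>x p\<bar> \<le> C * indicator (cball 0 R) p"
    by (rule test_function_bound[OF test]) (rule that)
  have cont: "continuous_on UNIV \<phi>t" "continuous_on UNIV \<phi>x"
    using test unfolding test_function_def by blast+
  then have [measurable]: "\<phi>t \<in> borel_measurable borel" "\<phi>x \<in> borel_measurable borel"
    by (auto intro: borel_measurable_continuous_onI)
  have [measurable]: "?S \<in> sets borel"
    by (intro borel_closed closed_Times) auto
  show it: "integrable lborel (\<lambda>p. indicator ?S p * \<phi>t p)"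
  proof (rule integrable_bounded_support)
    show "\<bar>indicator ?S p * \<phi>t p\<bar> \<le> C * indicator (cball 0 R) p" for p
      by (rule order_trans[OF _ C(2)]) (simp add: indicator_def)
  qed measurable
  show ix: "integrable lborel (\<lambda>p. indicator ?S p * \<phi>x p)"
  proof (rule integrable_bounded_support)
    show "\<bar>indicator ?S p * \<phi>x p\<bar> \<le> C * indicator (cball 0 R) p" for p
      by (rule order_trans[OF _ C(3)]) (simp add: indicator_def)
  qed measurable
  have der: "(\<phi> has_derivative (\<lambda>(s, y). \<phi>t p * s + \<phi>x p * y)) (at p)" for p
    using test unfolding test_function_def by blast
  have der_t: "((\<lambda>t. \<phi> (t, x)) has_real_derivative \<phi>t (t, x)) (at t)" for t x
  proof -
    have "((\<lambda>t. (t, x)) has_derivative (\<lambda>s. (s, 0))) (at t)"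
      by (auto intro!: derivative_eq_intros)
    from has_derivative_compose[OF this der] show ?thesis
      by (rule has_derivative_imp_has_field_derivative) (simp add: mult.commute)
  qed
  have der_x: "((\<lambda>x. \<phi> (t, x)) has_real_derivative \<phi>x (t, x)) (at x)" for t x
  proof -
    have "((\<lambda>x. (t, x)) has_derivative (\<lambda>s. (0, s))) (at x)"
      by (auto intro!: derivative_eq_intros)
    from has_derivative_compose[OF this der] show ?thesis
      by (rule has_derivative_imp_has_field_derivative) (simp add: mult.commute)
  qed
  have zero: "\<phi> (t, x) = 0 \<and> \<phi>t (t, x) = 0 \<and> \<phi>x (t, x) = 0" if "\<bar>t\<bar> > R \<or> \<bar>x\<bar> > R" for t x
  proof -
    have "R < norm (t, x)"
      using that norm_fst_le[of t x] norm_snd_le[of x t] by auto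
    then show ?thesis
      using C[of "(t, x)"] by simp
  qed
  have cont_t: "isCont (\<lambda>t. \<phi>t (t, x)) t" for t x
    by (rule isCont_o2[where g = \<phi>t]) (use cont in \<open>auto intro!: continuous_intros simp: continuous_on_eq_continuous_at\<close>)
  have cont_x: "isCont (\<lambda>x. \<phi>x (t, x)) x" for t x
    by (rule isCont_o2[where g = \<phi>x]) (use cont in \<open>auto intro!: continuous_intros simp: continuous_on_eq_continuous_at\<close>)
  have inner_t: "(LINT t|lborel. indicator ?S (t, x) * \<phi>t (t, x)) = - \<phi> (0, x)" for x
  proof -
    have "(LINT t|lborel. indicator ?S (t, x) * \<phi>t (t, x)) = (LINT t|lborel. \<phi>t (t, x) * indicator {0..R + 1} t)"
      using zero by (intro Bochner_Integration.integral_cong refl) (auto simp: indicator_def)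
    also have "\<dots> = \<phi> (R + 1, x) - \<phi> (0, x)"
      using R by (intro integral_FTC_Icc_real der_t cont_t) auto
    also have "\<phi> (R + 1, x) = 0" using zero[of "R + 1" x] R by simp
    finally show ?thesis by simp
  qed
  have inner_x: "(LINT x|lborel. indicator ?S (t, x) * \<phi>x (t, x)) = 0" for t
  proof -
    have out: "\<phi>x (t, x) = 0" if "x \<notin> {- R - 1..R + 1}" for x
    proof -
      have "R < \<bar>x\<bar>" using that R by auto
      then show ?thesis using zero[of t x] by blast
    qed
    have "\<phi>x (t, x) = \<phi>x (t, x) * indicator {- R - 1..R + 1} x" for x
      using out[of x] by (cases "x \<in> {- R - 1..R + 1}") simp_all
    then have "(LINT x|lborel. \<phi>x (t, x)) = (LINT x|lborel. \<phi>x (t, x) * indicator {- R - 1..R + 1} x)"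
      by (rule Bochner_Integration.integral_cong[OF refl])
    also have "\<dots> = \<phi> (t, R + 1) - \<phi> (t, - R - 1)"
      using R by (intro integral_FTC_Icc_real der_x cont_x) auto
    also have "\<dots> = 0" using zero[of t "R + 1"] zero[of t "- R - 1"] R by simp
    finally show ?thesis
      by (cases "t \<ge> 0") simp_all
  qed
  \<comment> \<open>For the time derivative the inner integration has to run over t, so that the
    fundamental theorem leaves the boundary value at t = 0.\<close>
  have "(LINT p|lborel. indicator ?S p * \<phi>t p) = (LINT x|lborel. LINT t|lborel. indicator ?S (t, x) * \<phi>t (t, x))"
    using lborel_pair.integral_snd[of "\<lambda>t x. indicator ?S (t, x) * \<phi>t (t, x)"] it
    by (simp add: lborel_prod case_prod_unfold)
  then show "(LINT p|lborel. indicator ?S p * \<phi>t p) = - (LINT x|lborel. \<phi> (0, x))"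
    unfolding inner_t by simp
  have "(LINT p|lborel. indicator ?S p * \<phi>x p) = (LINT t|lborel. LINT x|lborel. indicator ?S (t, x) * \<phi>x (t, x))"
    using lborel_pair.integral_fst'[of "\<lambda>p. indicator ?S p * \<phi>x p"] ix
    by (simp add: lborel_prod)
  then show "(LINT p|lborel. indicator ?S p * \<phi>x p) = 0"
    unfolding inner_x by simp
qed

lemma weak_entropy_solution_const:
  assumes "c \<in> {a..b}"
  shows "weak_entropy_solution f {a..b} (\<lambda>_. c) (\<lambda>_ _. c)"
  unfolding weak_entropy_solution_def
proof (intro conjI allI impI)
  have [measurable]: "{0..} \<times> UNIV \<in> sets (borel :: (real \<times> real) measure)"
    by (intro borel_closed closed_Times) auto
  show "set_borel_measurable lborel ({0..} \<times> UNIV) (\<lambda>(t::real, x::real). c)"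
    unfolding set_borel_measurable_def case_prod_unfold by measurable
  fix \<eta> G \<phi> \<phi>t \<phi>x assume "test_function \<phi> \<phi>t \<phi>x"
  note ints = test_function_integrals[OF this]
  have "(LINT p:{0..} \<times> UNIV|lborel. \<eta> c * \<phi>t p + G c * \<phi>x p)
      = (LINT p|lborel. \<eta> c * (indicator ({0..} \<times> UNIV) p * \<phi>t p) + G c * (indicator ({0..} \<times> UNIV) p * \<phi>x p))"
    unfolding set_lebesgue_integral_def
    by (intro Bochner_Integration.integral_cong refl) (simp add: algebra_simps)
  also have "\<dots> = \<eta> c * - (LINT x|lborel. \<phi> (0, x)) + G c * 0"
    using ints by (subst Bochner_Integration.integral_add) auto
  finally show "0 \<le> (LINT p:{0..} \<times> UNIV|lborel. \<eta> c * \<phi>t p + G c * \<phi>x p) + (LINT x|lborel. \<eta> c * \<phi> (0, x))"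
    by simp
qed (use assms in auto)

section \<open>Replacing the solution beyond the junction\<close>

lemma left_trace_cong:
  assumes "\<And>t x. x < 0 \<Longrightarrow> \<rho> t x = \<rho>' t x"
  shows "left_trace \<rho> l \<longleftrightarrow> left_trace \<rho>' l"
proof -
  have "(- \<delta> < x \<and> x < 0 \<longrightarrow> \<bar>\<rho> t x - l\<bar> < \<epsilon>) \<longleftrightarrow> (- \<delta> < x \<and> x < 0 \<longrightarrow> \<bar>\<rho>' t x - l\<bar> < \<epsilon>)" for \<delta> x t \<epsilon>
    using assms by auto
  then show ?thesis unfolding left_trace_def by simp
qed

lemma right_trace_cong:
  assumes "\<And>t x. 0 < x \<Longrightarrow> \<rho> t x = \<rho>' t x"
  shows "right_trace \<rho> r \<longleftrightarrow> right_trace \<rho>' r"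
proof -
  have "(0 < x \<and> x < \<delta> \<longrightarrow> \<bar>\<rho> t x - r\<bar> < \<epsilon>) \<longleftrightarrow> (0 < x \<and> x < \<delta> \<longrightarrow> \<bar>\<rho>' t x - r\<bar> < \<epsilon>)" for \<delta> x t \<epsilon>
    using assms by auto
  then show ?thesis unfolding right_trace_def by simp
qed

lemma trace_const: "left_trace (\<lambda>_ _. c) c" "right_trace (\<lambda>_ _. c) c"
  unfolding left_trace_def right_trace_def by (auto intro!: AE_I2 exI[of _ 1])

text \<open>Testing the left solution with the reflected step and the right one with the step leaves
  the boundary terms - G l1 and + G r2, with a common nonnegative weight. In the sum of the two
  inequalities admissibility gives these terms the sign that permits dropping them. The state
  \<open>c\<close> fills the null line x = 0 and must be in the state space because the definition
  demands this everywhere.\<close>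

lemma weak_entropy_solution_glue:
  assumes weak1: "weak_entropy_solution f {a..b} u1 \<rho>1"
    and u1: "u1 \<in> borel_measurable borel" "\<And>x. u1 x \<in> {a..b}"
    and tr1: "left_trace \<rho>1 l1" "right_trace \<rho>1 r1"
    and weak2: "weak_entropy_solution f {a..b} u2 \<rho>2"
    and u2: "u2 \<in> borel_measurable borel" "\<And>x. u2 x \<in> {a..b}"
    and tr2: "left_trace \<rho>2 l2" "right_trace \<rho>2 r2"
    and admissible: "\<And>\<eta> G. entropy_pair f \<eta> G \<Longrightarrow> G r2 \<le> G l1"
    and c: "c \<in> {a..b}"
  shows "weak_entropy_solution f {a..b} (\<lambda>x. if x < 0 then u1 x else if 0 < x then u2 x else c)
    (\<lambda>t x. if x < 0 then \<rho>1 t x else if 0 < x then \<rho>2 t x else c)" (is "weak_entropy_solution f _ ?u ?\<rho>")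
proof -
  let ?S = "{0..} \<times> UNIV :: (real \<times> real) set"
  have [measurable]: "(snd :: real \<times> real \<Rightarrow> real) \<in> borel_measurable borel"
    by (intro borel_measurable_continuous_onI continuous_intros)
  have [measurable]: "?S \<in> sets borel"
    by (intro borel_closed closed_Times) auto
  have [measurable]: "(\<lambda>p. indicator ?S p *\<^sub>R \<rho>1 (fst p) (snd p)) \<in> borel_measurable borel"
    "(\<lambda>p. indicator ?S p *\<^sub>R \<rho>2 (fst p) (snd p)) \<in> borel_measurable borel"
    using weak1 weak2 unfolding weak_entropy_solution_def set_borel_measurable_def
    by (simp_all add: case_prod_unfold)
  have "(\<lambda>p. indicator ?S p *\<^sub>R ?\<rho> (fst p) (snd p)) =
    (\<lambda>p. if snd p < 0 then indicator ?S p *\<^sub>R \<rho>1 (fst p) (snd p)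
      else if 0 < snd p then indicator ?S p *\<^sub>R \<rho>2 (fst p) (snd p) else indicator ?S p *\<^sub>R c)"
    by auto
  also have "\<dots> \<in> borel_measurable borel"
    by measurable
  finally have meas: "set_borel_measurable lborel ?S (\<lambda>(t, x). ?\<rho> t x)"
    by (simp add: set_borel_measurable_def case_prod_unfold)
  have K: "?\<rho> t x \<in> {a..b}" if "t \<ge> 0" for t x
    using weak1 weak2 c that unfolding weak_entropy_solution_def by simp
  have main: "0 \<le> (LINT p:?S|lborel. \<eta> (?\<rho> (fst p) (snd p)) * \<phi>t p + G (?\<rho> (fst p) (snd p)) * \<phi>x p)
      + (LINT x|lborel. \<eta> (?u x) * \<phi> (0, x))"
    if pair: "entropy_pair f \<eta> G" and test: "test_function \<phi> \<phi>t \<phi>x" for \<eta> G \<phi> \<phi>t \<phi>x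
  proof -
    define \<theta> :: "real \<Rightarrow> real" where "\<theta> = (\<lambda>x. 1 - (max 0 (1 - (max 0 x)\<^sup>2))\<^sup>2)"
    define \<theta>' :: "real \<Rightarrow> real" where "\<theta>' = (\<lambda>x. 2 * max 0 (1 - (max 0 x)\<^sup>2) * (2 * max 0 x))"
    have \<theta>: "cutoff \<theta> \<theta>' 0 1"
      unfolding \<theta>_def \<theta>'_def by (rule cutoff_right)
    have \<theta>0: "\<theta> 0 = 0" by (simp add: \<theta>_def)
    define X where "X \<rho> J p = indicator ?S p *
      (\<eta> (\<rho> (fst p) (snd p)) * \<phi>t p + G (\<rho> (fst p) (snd p)) * \<phi>x p) * J (snd p)"
      for \<rho> :: "real \<Rightarrow> real \<Rightarrow> real" and J p
    define Y where "Y u J x = \<eta> (u x) * \<phi> (0, x) * J x" for u :: "real \<Rightarrow> real" and J x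
    define J1 where "J1 = cutoff_limit (\<lambda>x. \<theta> (- x)) 1 0"
    define J2 where "J2 = cutoff_limit \<theta> 0 1"
    let ?\<Phi> = "LINT t|lborel. indicator {0..} t * \<phi> (t, 0)"
    note cut1 = weak_entropy_solution_cutoff[OF weak1 u1 tr1 pair test cutoff_reflect[OF \<theta>],
        folded J1_def X_def Y_def]
    note cut2 = weak_entropy_solution_cutoff[OF weak2 u2 tr2 pair test \<theta>, folded J2_def X_def Y_def]
    have int: "integrable lborel (X \<rho>1 J1)" "integrable lborel (Y u1 J1)"
      "integrable lborel (X \<rho>2 J2)" "integrable lborel (Y u2 J2)"
      using cut1(1,2) cut2(1,2) unfolding X_def[abs_def] Y_def[abs_def] by blast+
    have ineq1: "0 \<le> integral\<^sup>L lborel (X \<rho>1 J1) + integral\<^sup>L lborel (Y u1 J1) - G l1 * ?\<Phi>"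
      using cut1(3) unfolding X_def[abs_def] Y_def[abs_def] by (simp add: \<theta>0)
    have ineq2: "0 \<le> integral\<^sup>L lborel (X \<rho>2 J2) + integral\<^sup>L lborel (Y u2 J2) + G r2 * ?\<Phi>"
      using cut2(3) unfolding X_def[abs_def] Y_def[abs_def] by (simp add: \<theta>0)
    have "0 \<le> ?\<Phi>"
      using test by (intro Bochner_Integration.integral_nonneg) (simp add: test_function_def)
    then have \<Phi>: "G r2 * ?\<Phi> \<le> G l1 * ?\<Phi>"
      using admissible[OF pair] by (rule mult_right_mono[rotated])
    have meas\<phi>: "\<phi>t \<in> borel_measurable borel" "\<phi>x \<in> borel_measurable borel"
      using test unfolding test_function_def by (auto intro: borel_measurable_continuous_onI)
    \<comment> \<open>Off the junction the limits J1 and J2 are the indicators of the two half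
      lines.\<close>
    have split_X: "AE p in lborel. X \<rho>1 J1 p + X \<rho>2 J2 p = X ?\<rho> (\<lambda>_. 1) p"
      using AE_snd_nonzero
    proof eventually_elim
      case (elim p)
      then show ?case by (simp add: X_def J1_def J2_def cutoff_limit_def)
    qed
    have split_Y: "AE x in lborel. Y u1 J1 x + Y u2 J2 x = Y ?u (\<lambda>_. 1) x"
      using AE_lborel_singleton[of 0]
    proof eventually_elim
      case (elim x)
      then show ?case by (simp add: Y_def J1_def J2_def cutoff_limit_def)
    qed
    have meas_X: "X ?\<rho> (\<lambda>_. 1) \<in> borel_measurable lborel"
    proof -
      have [measurable]: "\<eta> \<in> borel_measurable borel" "G \<in> borel_measurable borel"
        using entropy_pair_continuous[OF pair] by (auto intro: borel_measurable_continuous_onI)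
      note [measurable] = meas\<phi>
      define v where "v p = indicator ?S p *\<^sub>R ?\<rho> (fst p) (snd p)" for p
      have [measurable]: "v \<in> borel_measurable borel"
        using meas unfolding set_borel_measurable_def v_def[abs_def] by (simp add: case_prod_unfold)
      have "X ?\<rho> (\<lambda>_. 1) = (\<lambda>p. indicator ?S p * (\<eta> (v p) * \<phi>t p + G (v p) * \<phi>x p))"
        unfolding X_def v_def by (auto simp: indicator_def fun_eq_iff)
      then show ?thesis by simp
    qed
    have meas_Y: "Y ?u (\<lambda>_. 1) \<in> borel_measurable lborel"
    proof -
      have "continuous_on UNIV \<phi>"
        using test unfolding test_function_def by (meson has_derivative_continuous continuous_at_imp_continuous_on)
      then have [measurable]: "\<phi> \<in> borel_measurable borel"
        by (rule borel_measurable_continuous_onI)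
      have [measurable]: "\<eta> \<in> borel_measurable borel"
        using entropy_pair_continuous[OF pair] by (auto intro: borel_measurable_continuous_onI)
      note [measurable] = u1(1) u2(1)
      show ?thesis unfolding Y_def[abs_def] by measurable
    qed
    have "integral\<^sup>L lborel (X \<rho>1 J1) + integral\<^sup>L lborel (X \<rho>2 J2) = integral\<^sup>L lborel (X ?\<rho> (\<lambda>_. 1))"
      unfolding Bochner_Integration.integral_add[OF int(1,3), symmetric]
      using int meas_X split_X by (intro integral_cong_AE) auto
    moreover have "integral\<^sup>L lborel (Y u1 J1) + integral\<^sup>L lborel (Y u2 J2) = integral\<^sup>L lborel (Y ?u (\<lambda>_. 1))"
      unfolding Bochner_Integration.integral_add[OF int(2,4), symmetric]
      using int meas_Y split_Y by (intro integral_cong_AE) auto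
    ultimately have "0 \<le> integral\<^sup>L lborel (X ?\<rho> (\<lambda>_. 1)) + integral\<^sup>L lborel (Y ?u (\<lambda>_. 1))"
      using ineq1 ineq2 \<Phi> by linarith
    then show ?thesis
      unfolding X_def[abs_def] Y_def[abs_def] set_lebesgue_integral_def by simp
  qed
  show ?thesis
    unfolding weak_entropy_solution_def using meas K main by blast
qed

section \<open>Stationary shocks into the branch of outgoing characteristics\<close>

context flux_function
begin

text \<open>Let p maximise f on \<open>{l..r}\<close> and let s be a supporting slope of the entropy
  at p. By concavity f increases before p and decreases after it, while s - \<eta>' changes sign in
  the same way, so the derivative (s - \<eta>') f' of s f - G is nonnegative throughout. Comparing
  the end points, where f agrees, gives the claim.\<close>

lemma stationary_shock_admissible:
  assumes pair: "entropy_pair f \<eta> G" and lr: "l \<in> {a..b}" "r \<in> {a..b}" "l \<le> r" and eq: "f l = f r"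
  shows "G r \<le> G l"
proof -
  obtain f' \<eta>' where f': "has_ae_derivative f f'" and \<eta>': "has_ae_derivative \<eta> \<eta>'"
    and G': "has_ae_derivative G (\<lambda>t. \<eta>' t * f' t)" and cvx: "convex_on UNIV \<eta>"
    using pair unfolding entropy_pair_def entropy_flux_def by blast
  have "continuous_on {l..r} f"
    by (rule continuous_on_subset[OF cont]) (use lr in auto)
  then obtain p where p: "p \<in> {l..r}" "\<And>y. y \<in> {l..r} \<Longrightarrow> f y \<le> f p"
    using continuous_attains_sup[of "{l..r}" f] lr by auto
  have cc: "concave_on {x..y} f" if "x \<in> {l..r}" "y \<in> {l..r}" for x y
    by (rule concave_on_subset[OF concave]) (use that lr in auto)
  have "mono_on {l..p} f"
  proof (rule mono_onI)
    fix x y assume xy: "x \<in> {l..p}" "y \<in> {l..p}" "x \<le> y"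
    then have "min (f x) (f p) \<le> f y"
      using p(1) by (intro concave_on_ge_min[OF cc]) auto
    moreover have "f x \<le> f p" using p xy by auto
    ultimately show "f x \<le> f y" by simp
  qed
  then have n1: "negligible {t \<in> {l..p}. f' t < 0}"
    using mono_on_iff_derivative_nonneg[OF f'] by blast
  have "mono_on {p..r} (\<lambda>t. - 1 * f t)"
  proof (rule mono_onI)
    fix x y assume xy: "x \<in> {p..r}" "y \<in> {p..r}" "x \<le> y"
    then have "min (f p) (f y) \<le> f x"
      using p(1) by (intro concave_on_ge_min[OF cc]) auto
    moreover have "f y \<le> f p" using p xy by auto
    ultimately show "- 1 * f x \<le> - 1 * f y" by simp
  qed
  then have n2: "negligible {t \<in> {p..r}. - 1 * f' t < 0}"
    using mono_on_iff_derivative_nonneg[OF has_ae_derivative_cmult[OF f']] by blast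
  \<comment> \<open>The interval is enlarged because p may be an end point of \<open>{l..r}\<close>,
    while supporting slopes are available at interior points.\<close>
  have "convex_on {l - 1..r + 1} \<eta>"
    by (rule convex_on_subset[OF cvx]) auto
  then have "rel_convex {l - 1..r + 1} (\<lambda>t. t) \<eta>"
    by (simp add: convex_on_iff_rel_convex)
  moreover have "strict_mono_on {l - 1..r + 1} (\<lambda>t::real. t)"
    by (auto simp: strict_mono_on_def)
  moreover have "p \<in> {l - 1<..<r + 1}" using p(1) by auto
  ultimately obtain s where s: "mono_on {l - 1..p} (\<lambda>t. s * t - \<eta> t)" "mono_on {p..r + 1} (\<lambda>t. \<eta> t - s * t)"
    using rel_convex_iff_support[of "l - 1" "r + 1" "\<lambda>t. t" \<eta>] by blast
  have lin: "has_ae_derivative (\<lambda>t. s * t) (\<lambda>_. s)"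
    using has_ae_derivative_linear[of s 0] by simp
  have n3: "negligible {t \<in> {l..p}. s - \<eta>' t < 0}"
    using mono_on_iff_derivative_nonneg[OF has_ae_derivative_diff[OF lin \<eta>'], of l p] s(1)
    by (meson atLeastatMost_subset_iff diff_le_eq le_add_same_cancel1 mono_on_subset order_refl zero_le_one)
  have n4: "negligible {t \<in> {p..r}. \<eta>' t - s < 0}"
    using mono_on_iff_derivative_nonneg[OF has_ae_derivative_diff[OF \<eta>' lin], of p r] s(2)
    by (meson atLeastatMost_subset_iff le_add_same_cancel1 mono_on_subset order_refl zero_le_one)
  note sfG = mono_on_iff_derivative_nonneg[OF has_ae_derivative_diff[OF has_ae_derivative_cmult[OF f', of s] G']]
  have "mono_on {l..p} (\<lambda>t. s * f t - G t)"
    unfolding sfG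
  proof (rule negligible_subset[OF negligible_Un[OF n1 n3]], rule subsetI)
    fix t assume t: "t \<in> {t \<in> {l..p}. s * f' t - \<eta>' t * f' t < 0}"
    then have "(s - \<eta>' t) * f' t < 0" by (simp add: algebra_simps)
    then show "t \<in> {t \<in> {l..p}. f' t < 0} \<union> {t \<in> {l..p}. s - \<eta>' t < 0}"
      using t by (auto simp: mult_less_0_iff)
  qed
  then have "s * f l - G l \<le> s * f p - G p"
    using p(1) by (auto dest: mono_onD)
  moreover have "mono_on {p..r} (\<lambda>t. s * f t - G t)"
    unfolding sfG
  proof (rule negligible_subset[OF negligible_Un[OF n2 n4]], rule subsetI)
    fix t assume t: "t \<in> {t \<in> {p..r}. s * f' t - \<eta>' t * f' t < 0}"
    then have "(s - \<eta>' t) * f' t < 0" by (simp add: algebra_simps)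
    then show "t \<in> {t \<in> {p..r}. - 1 * f' t < 0} \<union> {t \<in> {p..r}. \<eta>' t - s < 0}"
      using t by (auto simp: mult_less_0_iff)
  qed
  then have "s * f p - G p \<le> s * f r - G r"
    using p(1) by (auto dest: mono_onD)
  ultimately show ?thesis using eq by simp
qed

text \<open>The flux at the junction lies in the range of f on \<open>Gamma_out\<close>, so a state
  \<gamma> there carries the same flux. The constant \<gamma> is a solution, and gluing it to the
  road side creates a stationary shock whose states are ordered as admissibility requires. The road
  itself keeps its solution and its trace.\<close>

lemma junction_trace_replacement:
  assumes weak: "weak_entropy_solution f {a..b} (\<lambda>x. if x \<in> road_domain n h then \<rho>0 else \<sigma>) \<rho>"
    and K: "\<rho>0 \<in> {a..b}" "\<sigma> \<in> {a..b}" and l: "left_trace \<rho> l" and r: "right_trace \<rho> r"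
    and f': "has_ae_derivative f f'"
  obtains \<gamma> where "\<gamma> \<in> Gamma_out n h a b f" "\<gamma> \<in> {a..b}" "f \<gamma> = f l"
    "weak_entropy_solution f {a..b} (\<lambda>x. if x \<in> road_domain n h then \<rho>0 else \<gamma>)
      (\<lambda>t x. if x \<in> road_domain n h then \<rho> t x else \<gamma>)"
    "left_trace (\<lambda>t x. if x \<in> road_domain n h then \<rho> t x else \<gamma>) (if h \<le> n then l else \<gamma>)"
    "right_trace (\<lambda>t x. if x \<in> road_domain n h then \<rho> t x else \<gamma>) (if h \<le> n then \<gamma> else r)"
proof -
  let ?u = "\<lambda>x. if x \<in> road_domain n h then \<rho>0 else \<sigma>"
  have [measurable]: "road_domain n h \<in> sets borel"
    by (simp add: road_domain_def)
  have u: "?u \<in> borel_measurable borel" "\<And>x. ?u x \<in> {a..b}"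
    using K by auto
  have lK: "l \<in> {a..b}" and rK: "r \<in> {a..b}"
    using trace_in_closed_interval[OF weak] l r by auto
  have RH: "f l = f r"
    by (rule weak_entropy_solution_traces(2)[OF weak u l r f'])
  obtain lo hi where lohi: "lo < hi" "{lo..hi} \<subseteq> {a..b}" "Gamma_out n h a b f = {lo..hi}"
    "f ` {lo..hi} = {0..flux_max a b f}"
    and sgn: "\<And>\<rho> \<gamma>. \<rho> \<in> {a..b} \<Longrightarrow> \<gamma> \<in> {lo..hi} \<Longrightarrow> f \<rho> = f \<gamma> \<Longrightarrow> 0 \<le> road_sign n h * (\<gamma> - \<rho>)"
    by (rule Gamma_out_branch[of n h]) (rule that)
  \<comment> \<open>The branch attains every flux from 0 to the maximum.\<close>
  have "f l \<in> f ` {lo..hi}"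
    using lohi(4) nonneg[OF lK] le_flux_max[OF lK] by simp
  then obtain \<gamma> where \<gamma>: "\<gamma> \<in> {lo..hi}" "f \<gamma> = f l" by (metis imageE)
  then have \<gamma>K: "\<gamma> \<in> {a..b}" using lohi(2) by blast
  note const = weak_entropy_solution_const[OF \<gamma>K, of f]
  have c_meas: "(\<lambda>_::real. \<gamma>) \<in> borel_measurable borel" by simp
  show thesis
  proof (cases "h \<le> n")
    case True
    have dom: "x \<in> road_domain n h \<longleftrightarrow> x < 0" for x
      using True by (simp add: road_domain_def)
    have adm: "G \<gamma> \<le> G l" if "entropy_pair f \<eta> G" for \<eta> G
      using stationary_shock_admissible[OF that lK \<gamma>K] sgn[OF lK \<gamma>(1)] \<gamma>(2) True
      by (simp add: road_sign_def)
    have "weak_entropy_solution f {a..b} (\<lambda>x. if x < 0 then ?u x else if 0 < x then \<gamma> else \<gamma>)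
        (\<lambda>t x. if x < 0 then \<rho> t x else if 0 < x then \<gamma> else \<gamma>)"
      by (rule weak_entropy_solution_glue[OF weak u l r const c_meas \<gamma>K trace_const adm \<gamma>K])
    then have w: "weak_entropy_solution f {a..b} (\<lambda>x. if x \<in> road_domain n h then \<rho>0 else \<gamma>)
      (\<lambda>t x. if x \<in> road_domain n h then \<rho> t x else \<gamma>)"
      by (simp add: dom cong: if_cong)
    have lt: "left_trace (\<lambda>t x. if x \<in> road_domain n h then \<rho> t x else \<gamma>) l"
      by (subst left_trace_cong[of _ \<rho>]) (auto simp: dom l)
    have rt: "right_trace (\<lambda>t x. if x \<in> road_domain n h then \<rho> t x else \<gamma>) \<gamma>"
      by (subst right_trace_cong[of _ "\<lambda>_ _. \<gamma>"]) (auto simp: dom trace_const)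
    show ?thesis
      using that[of \<gamma>] \<gamma> \<gamma>K lohi(3) w lt rt True by simp
  next
    case False
    have dom: "x \<in> road_domain n h \<longleftrightarrow> 0 < x" for x
      using False by (simp add: road_domain_def)
    have adm: "G r \<le> G \<gamma>" if "entropy_pair f \<eta> G" for \<eta> G
      using stationary_shock_admissible[OF that \<gamma>K rK] sgn[OF rK \<gamma>(1)] \<gamma>(2) RH False
      by (simp add: road_sign_def)
    have "weak_entropy_solution f {a..b} (\<lambda>x. if x < 0 then \<gamma> else if 0 < x then ?u x else \<gamma>)
        (\<lambda>t x. if x < 0 then \<gamma> else if 0 < x then \<rho> t x else \<gamma>)"
      by (rule weak_entropy_solution_glue[OF const c_meas \<gamma>K trace_const weak u l r adm \<gamma>K])
    moreover have "(\<lambda>x. if x < 0 then \<gamma> else if 0 < x then ?u x else \<gamma>) = (\<lambda>x. if x \<in> road_domain n h then \<rho>0 else \<gamma>)"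
      "(\<lambda>t x. if x < 0 then \<gamma> else if 0 < x then \<rho> t x else \<gamma>) = (\<lambda>t x. if x \<in> road_domain n h then \<rho> t x else \<gamma>)"
      by (auto simp: dom fun_eq_iff)
    ultimately have w: "weak_entropy_solution f {a..b} (\<lambda>x. if x \<in> road_domain n h then \<rho>0 else \<gamma>)
      (\<lambda>t x. if x \<in> road_domain n h then \<rho> t x else \<gamma>)"
      by simp
    have lt: "left_trace (\<lambda>t x. if x \<in> road_domain n h then \<rho> t x else \<gamma>) \<gamma>"
      by (subst left_trace_cong[of _ "\<lambda>_ _. \<gamma>"]) (auto simp: dom trace_const)
    have rt: "right_trace (\<lambda>t x. if x \<in> road_domain n h then \<rho> t x else \<gamma>) r"
      by (subst right_trace_cong[of _ \<rho>]) (auto simp: dom r)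
    show ?thesis
      using that[of \<gamma>] \<gamma> \<gamma>K lohi(3) w lt rt False by simp
  qed
qed

end

section \<open>Equivalence of the two optimization problems\<close>

lemma sum_atLeastAtMost_split:
  fixes n m :: nat
  shows "(\<Sum>h=1..n+m. F h) = (\<Sum>i=1..n. F i) + (\<Sum>j=n+1..n+m. F j :: real)"
proof -
  have "{1..n + m} = {1..n} \<union> {n+1..n+m}" by auto
  then show ?thesis by (simp add: sum.union_disjoint)
qed

text \<open>On solutions with outgoing junction traces both objectives have the same value, and any
  solution can be moved into that class without changing its restriction to the roads or its
  junction fluxes. Hence the two problems have the same optimal value and realise the same
  restrictions.\<close>

theorem hr_solution_iff_med_solution:
  assumes flux: "\<And>h. h \<in> {1..n + m} \<Longrightarrow> flux_function (a h) (b h) (f h)"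
    and diff: "\<And>h. h \<in> {1..n + m} \<Longrightarrow> \<exists>f'. has_ae_derivative (f h) f'"
    and gG: "\<And>h \<gamma>. h \<in> {1..n + m} \<Longrightarrow> \<gamma> \<in> Gamma_out n h (a h) (b h) (f h) \<Longrightarrow>
      g h (f h \<gamma> / flux_max (a h) (b h) (f h)) = road_sign n h * G h \<gamma>"
    and \<rho>0: "\<And>h. h \<in> {1..n + m} \<Longrightarrow> \<rho>0 h \<in> {a h..b h}"
  shows "hr_solution n m a b f g \<rho>0 u \<longleftrightarrow> med_solution n m a b f G \<rho>0 u"
proof -
  let ?hr = "hr_objective n m a b f g" and ?med = "med_objective n m G"
  let ?sol = "riemann_solutions n m a b f \<rho>0" and ?out = "junction_traces_outgoing n m a b f"
  have RH: "f h (l h) = f h (r h)" if sol: "?sol \<sigma> \<rho> l r" and h: "h \<in> {1..n + m}" for \<sigma> \<rho> l r h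
  proof -
    let ?u = "\<lambda>x. if x \<in> road_domain n h then \<rho>0 h else \<sigma> h"
    obtain f' where f': "has_ae_derivative (f h) f'" using diff[OF h] by blast
    have "road_domain n h \<in> sets borel"
      by (simp add: road_domain_def)
    then have meas: "?u \<in> borel_measurable borel" by measurable
    have props: "weak_entropy_solution (f h) {a h..b h} ?u (\<rho> h)" "\<sigma> h \<in> {a h..b h}"
      "left_trace (\<rho> h) (l h)" "right_trace (\<rho> h) (r h)"
      using sol h by (simp_all add: riemann_solutions_def)
    have "?u x \<in> {a h..b h}" for x
      using props(2) \<rho>0[OF h] by simp
    from weak_entropy_solution_traces(2)[OF props(1) meas this props(3,4) f'] show ?thesis .
  qed
  have obj: "?med l r = ?hr l" if sol: "?sol \<sigma> \<rho> l r" and out: "?out l r" for \<sigma> \<rho> l r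
  proof -
    have "(if h \<le> n then G h (r h) else - G h (l h)) = g h (f h (l h) / flux_max (a h) (b h) (f h))"
      if h: "h \<in> {1..n + m}" for h
    proof -
      have "(if h \<le> n then r h else l h) \<in> Gamma_out n h (a h) (b h) (f h)"
        using out h by (simp add: junction_traces_outgoing_def)
      from gG[OF h this] show ?thesis
        using RH[OF sol h] by (simp add: road_sign_def split: if_splits)
    qed
    then have "?hr l = (\<Sum>h=1..n+m. if h \<le> n then G h (r h) else - G h (l h))"
      unfolding hr_objective_def by (intro sum.cong) auto
    also have "\<dots> = (\<Sum>i=1..n. G i (r i)) + (\<Sum>j=n+1..n+m. - G j (l j))"
      unfolding sum_atLeastAtMost_split by (intro arg_cong2[where f = "(+)"] sum.cong) auto
    finally show ?thesis
      by (simp add: med_objective_def sum_negf)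
  qed
  have replace: "\<exists>\<sigma>' \<rho>' l' r'. ?sol \<sigma>' \<rho>' l' r' \<and> conserves_mass n m f l' \<and> ?out l' r' \<and>
      ?hr l' = ?hr l \<and> restricts_to_roads n m \<rho>' v"
    if sol: "?sol \<sigma> \<rho> l r" and mass: "conserves_mass n m f l" and restr: "restricts_to_roads n m \<rho> v"
    for \<sigma> \<rho> l r v
  proof -
    let ?P = "\<lambda>h \<gamma>. \<gamma> \<in> Gamma_out n h (a h) (b h) (f h) \<and> \<gamma> \<in> {a h..b h} \<and> f h \<gamma> = f h (l h) \<and>
      weak_entropy_solution (f h) {a h..b h} (\<lambda>x. if x \<in> road_domain n h then \<rho>0 h else \<gamma>)
        (\<lambda>t x. if x \<in> road_domain n h then \<rho> h t x else \<gamma>) \<and>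
      left_trace (\<lambda>t x. if x \<in> road_domain n h then \<rho> h t x else \<gamma>) (if h \<le> n then l h else \<gamma>) \<and>
      right_trace (\<lambda>t x. if x \<in> road_domain n h then \<rho> h t x else \<gamma>) (if h \<le> n then \<gamma> else r h)"
    have "\<exists>\<gamma>. ?P h \<gamma>" if h: "h \<in> {1..n + m}" for h
    proof -
      interpret flux_function "a h" "b h" "f h" by (rule flux[OF h])
      obtain f' where f': "has_ae_derivative (f h) f'" using diff[OF h] by blast
      have "weak_entropy_solution (f h) {a h..b h} (\<lambda>x. if x \<in> road_domain n h then \<rho>0 h else \<sigma> h) (\<rho> h)"
        "\<sigma> h \<in> {a h..b h}" "left_trace (\<rho> h) (l h)" "right_trace (\<rho> h) (r h)"
        using sol h by (simp_all add: riemann_solutions_def)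
      then show ?thesis
        by (rule junction_trace_replacement[OF _ \<rho>0[OF h] _ _ _ f']) (intro exI conjI; assumption)
    qed
    then have "\<forall>h\<in>{1..n + m}. \<exists>\<gamma>. ?P h \<gamma>" by (rule ballI)
    from bchoice[OF this] obtain \<gamma> where "\<forall>h\<in>{1..n + m}. ?P h (\<gamma> h)" ..
    then have \<gamma>: "?P h (\<gamma> h)" if "h \<in> {1..n + m}" for h
      using that by (rule bspec)
    define \<rho>' where "\<rho>' h t x = (if x \<in> road_domain n h then \<rho> h t x else \<gamma> h)" for h t x
    define l' where "l' h = (if h \<le> n then l h else \<gamma> h)" for h
    define r' where "r' h = (if h \<le> n then \<gamma> h else r h)" for h
    have fl: "f h (l' h) = f h (l h)" if "h \<in> {1..n + m}" for h
      using \<gamma>[OF that] by (simp add: l'_def)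
    have "?sol \<gamma> \<rho>' l' r'"
      unfolding riemann_solutions_def
    proof
      fix h assume h: "h \<in> {1..n + m}"
      have "\<rho>' h = (\<lambda>t x. if x \<in> road_domain n h then \<rho> h t x else \<gamma> h)"
        by (simp add: \<rho>'_def fun_eq_iff)
      then show "\<gamma> h \<in> {a h..b h} \<and>
          weak_entropy_solution (f h) {a h..b h} (\<lambda>x. if x \<in> road_domain n h then \<rho>0 h else \<gamma> h) (\<rho>' h) \<and>
          left_trace (\<rho>' h) (l' h) \<and> right_trace (\<rho>' h) (r' h)"
        using \<gamma>[OF h] by (simp only: l'_def r'_def)
    qed
    moreover have "conserves_mass n m f l'"
      using mass fl by (simp add: conserves_mass_def)
    moreover have "?out l' r'"
      unfolding junction_traces_outgoing_def
    proof
      fix h assume "h \<in> {1..n + m}"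
      then show "(if h \<le> n then r' h else l' h) \<in> Gamma_out n h (a h) (b h) (f h)"
        using \<gamma>[of h] by (simp add: l'_def r'_def)
    qed
    moreover have "?hr l' = ?hr l"
      unfolding hr_objective_def by (intro sum.cong refl) (simp add: fl)
    moreover have "restricts_to_roads n m \<rho>' v"
      using restr by (auto simp: restricts_to_roads_def \<rho>'_def)
    ultimately show ?thesis by blast
  qed
  \<comment> \<open>A competitor carries no prescribed restriction; it is replaced relative to
    itself.\<close>
  have restricts_refl: "restricts_to_roads n m \<rho> \<rho>" for \<rho>
    by (simp add: restricts_to_roads_def)
  show ?thesis
  proof
    assume "hr_solution n m a b f g \<rho>0 u"
    then obtain \<sigma> \<rho> l r where sol: "?sol \<sigma> \<rho> l r" "conserves_mass n m f l" "restricts_to_roads n m \<rho> u"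
      and opt: "\<And>\<sigma>' \<rho>' l' r'. ?sol \<sigma>' \<rho>' l' r' \<Longrightarrow> conserves_mass n m f l' \<Longrightarrow> ?hr l' \<le> ?hr l"
      unfolding hr_solution_def by blast
    obtain \<sigma>1 \<rho>1 l1 r1 where new: "?sol \<sigma>1 \<rho>1 l1 r1" "conserves_mass n m f l1" "?out l1 r1"
      "?hr l1 = ?hr l" "restricts_to_roads n m \<rho>1 u"
      using replace[OF sol] by blast
    have "?med l' r' \<le> ?med l1 r1" if "?sol \<sigma>' \<rho>' l' r'" "conserves_mass n m f l'" "?out l' r'" for \<sigma>' \<rho>' l' r'
      using opt[OF that(1,2)] obj[OF that(1,3)] obj[OF new(1,3)] new(4) by simp
    then show "med_solution n m a b f G \<rho>0 u"
      unfolding med_solution_def using new by blast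
  next
    assume "med_solution n m a b f G \<rho>0 u"
    then obtain \<sigma> \<rho> l r where sol: "?sol \<sigma> \<rho> l r" "conserves_mass n m f l" "?out l r" "restricts_to_roads n m \<rho> u"
      and opt: "\<And>\<sigma>' \<rho>' l' r'. ?sol \<sigma>' \<rho>' l' r' \<Longrightarrow> conserves_mass n m f l' \<Longrightarrow> ?out l' r' \<Longrightarrow>
        ?med l' r' \<le> ?med l r"
      unfolding med_solution_def by blast
    \<comment> \<open>The competitor may have junction traces outside \<open>Gamma_out\<close>, so
      it is replaced before optimality is applied.\<close>
    have "?hr l' \<le> ?hr l" if comp: "?sol \<sigma>' \<rho>' l' r'" "conserves_mass n m f l'" for \<sigma>' \<rho>' l' r'
    proof -
      obtain \<sigma>1 \<rho>1 l1 r1 where new: "?sol \<sigma>1 \<rho>1 l1 r1" "conserves_mass n m f l1" "?out l1 r1" "?hr l1 = ?hr l'"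
        using replace[OF comp restricts_refl] by blast
      then show ?thesis
        using opt[OF new(1-3)] obj[OF new(1,3)] obj[OF sol(1,3)] by simp
    qed
    then show "hr_solution n m a b f g \<rho>0 u"
      unfolding hr_solution_def using sol by blast
  qed
qed

text \<open>Being an entropy flux to a convex entropy is expressed in two ways, both confined to the
  states that the relation between g and G reaches: convexity of the given entropy on
  \<open>Gamma_out\<close>, and existence of an entropy pair convex on the whole line whose flux
  agrees with \<open>G\<close> there.\<close>

theorem proposition4:
  fixes n m :: nat
    and a b :: "nat \<Rightarrow> real"
    and f g \<eta> G :: "nat \<Rightarrow> real \<Rightarrow> real"
  assumes K: "\<And>h. h \<in> {1..n + m} \<Longrightarrow> a h \<le> b h"
    and f_nonneg: "\<And>h \<rho>. h \<in> {1..n + m} \<Longrightarrow> \<rho> \<in> {a h..b h} \<Longrightarrow> 0 \<le> f h \<rho>"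
    and f_Lipschitz: "\<And>h. h \<in> {1..n + m} \<Longrightarrow> \<exists>L. L-lipschitz_on {a h..b h} (f h)"
    and f_concave: "\<And>h. h \<in> {1..n + m} \<Longrightarrow> concave_on {a h..b h} (f h)"
    and f_ends: "\<And>h. h \<in> {1..n + m} \<Longrightarrow> f h (a h) = 0 \<and> f h (b h) = 0"
    and f_outside: "\<And>h \<rho>. h \<in> {1..n + m} \<Longrightarrow> \<rho> \<notin> {a h..b h} \<Longrightarrow> f h \<rho> = 0"
    and f_max_pos: "\<And>h. h \<in> {1..n + m} \<Longrightarrow> 0 < flux_max (a h) (b h) (f h)"
    and f_zero: "(\<Sum>i=1..n. f i 0) - (\<Sum>j=n+1..n+m. f j 0) = 0"
    and g_Lipschitz: "\<And>h. h \<in> {1..n + m} \<Longrightarrow> \<exists>L. L-lipschitz_on {0..1} (g h)"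
    and G_flux: "\<And>h. h \<in> {1..n + m} \<Longrightarrow> entropy_flux (f h) (\<eta> h) (G h)"
    and g_G: "\<And>h. h \<in> {1..n + m} \<Longrightarrow>
      AE y in lborel. y \<in> {0..1} \<longrightarrow>
        g h y = road_sign n h *
          G h (inv_into (Gamma_out n h (a h) (b h) (f h)) (f h) (y * flux_max (a h) (b h) (f h)))"
  shows "(\<forall>h\<in>{1..n + m}.
            (concave_on {0..1} (g h) \<longleftrightarrow>
              convex_on (Gamma_out n h (a h) (b h) (f h)) (\<eta> h)) \<and>
            (concave_on {0..1} (g h) \<longleftrightarrow>
              (\<exists>\<eta>' G'. entropy_pair (f h) \<eta>' G' \<and>
                 (\<forall>\<rho>\<in>Gamma_out n h (a h) (b h) (f h). G' \<rho> = G h \<rho>)))) \<and>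
         ((\<forall>h\<in>{1..n + m}. concave_on {0..1} (g h)) \<longrightarrow>
          (\<forall>h\<in>{1..n + m}. med_entropy_pair (a h) (b h) (f h) (\<eta> h) (G h)) \<longrightarrow>
          (\<forall>\<rho>0. (\<forall>h\<in>{1..n + m}. \<rho>0 h \<in> {a h..b h}) \<longrightarrow>
             (\<forall>u. hr_solution n m a b f g \<rho>0 u \<longleftrightarrow> med_solution n m a b f G \<rho>0 u)))"
proof -
  have flux: "flux_function (a h) (b h) (f h)" if h: "h \<in> {1..n + m}" for h
  proof
    obtain L where "L-lipschitz_on {a h..b h} (f h)"
      using f_Lipschitz[OF h] by blast
    then show "continuous_on {a h..b h} (f h)"
      by (rule lipschitz_on_continuous_on)
  qed (use K f_nonneg f_concave f_ends f_max_pos h in auto)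
  have gG: "g h (f h \<gamma> / flux_max (a h) (b h) (f h)) = road_sign n h * G h \<gamma>"
    if h: "h \<in> {1..n + m}" and \<gamma>: "\<gamma> \<in> Gamma_out n h (a h) (b h) (f h)" for h \<gamma>
  proof -
    interpret flux_function "a h" "b h" "f h" by (rule flux[OF h])
    obtain L where "L-lipschitz_on {0..1} (g h)"
      using g_Lipschitz[OF h] by blast
    then have "continuous_on {0..1} (g h)"
      by (rule lipschitz_on_continuous_on)
    moreover have "continuous_on UNIV (G h)"
      using G_flux[OF h] has_ae_derivative_continuous unfolding entropy_flux_def by blast
    ultimately show ?thesis
      using g_eq_flux g_G[OF h] \<gamma> by blast
  qed
  have "(concave_on {0..1} (g h) \<longleftrightarrow> convex_on (Gamma_out n h (a h) (b h) (f h)) (\<eta> h)) \<and>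
      (concave_on {0..1} (g h) \<longleftrightarrow>
        (\<exists>\<eta>' G'. entropy_pair (f h) \<eta>' G' \<and> (\<forall>\<rho>\<in>Gamma_out n h (a h) (b h) (f h). G' \<rho> = G h \<rho>)))"
    if h: "h \<in> {1..n + m}" for h
  proof -
    interpret flux_function "a h" "b h" "f h" by (rule flux[OF h])
    obtain L where L: "L-lipschitz_on {0..1} (g h)"
      using g_Lipschitz[OF h] by blast
    show ?thesis
      using concave_iff_convex_entropy[OF G_flux[OF h] L gG[OF h]] by blast
  qed
  moreover have "hr_solution n m a b f g \<rho>0 u \<longleftrightarrow> med_solution n m a b f G \<rho>0 u"
    if "\<forall>h\<in>{1..n + m}. \<rho>0 h \<in> {a h..b h}" for \<rho>0 u
  proof (rule hr_solution_iff_med_solution)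
    fix h assume "h \<in> {1..n + m}"
    then show "\<exists>f'. has_ae_derivative (f h) f'"
      using G_flux unfolding entropy_flux_def by blast
  qed (use that flux gG in auto)
  ultimately show ?thesis by blast
qed

end
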